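(* Let $d\ge1$, $0<\alpha<2$, $m>0$, let $X^m_t$ be the relativistic $\alpha$-stable process with parameter $m$ on $\mathbb R^d$, let $\mathbb H=\{x\in\mathbb R^d:x_d>0\}$ and $\tau_{\mathbb H}=\inf\{t\ge0:X^m_t\notin\mathbb H\}$. For $x\in\mathbb H$ let $P^m_{\mathbb H}(x,u)$ denote the density with respect to Lebesgue measure of the measure $$A\mapsto E^x\left[\tau_{\mathbb H}<\infty;\ e^{-m\tau_{\mathbb H}}\mathbf 1_A(X^m_{\tau_{\mathbb H}})\right],\qquad A\subset\mathbb R^d\setminus\mathbb H\ \text{Borel}.$$ Then this density exists and $$P^m_{\mathbb H}(x,u)=2\,\frac{\sin(\pi\alpha/2)}{\pi}\left(\frac{m^{1/\alpha}}{2\pi}\right)^{d/2}\left(\frac{x_d}{-u_d}\right)^{\alpha/2}\frac{K_{d/2}(m^{1/\alpha}|x-u|)}{|x-u|^{d/2}},\qquad u_d<0<x_d.$$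
   Context: For $0<\alpha<2$, $m>0$, the relativistic $\alpha$-stable process $X^m_t$ with parameter $m$ on $\mathbb R^d$ is the Lévy process with càdlàg paths with characteristic function $E^0e^{i(z,X^m_t)}=e^{mt}e^{-t(|z|^2+m^{2/\alpha})^{\alpha/2}}$, $z\in\mathbb R^d$. $P^x,E^x$ refer to the process started at $x$; $E^x[A;Y]$ means $E^x[\mathbf 1_AY]$. $K_\nu$ is the modified Bessel function of the second kind, $K_\nu(r)=2^{-1-\nu}r^\nu\int_0^\infty e^{-v}e^{-r^2/(4v)}v^{-1-\nu}\,dv$, $r>0$. $x_d$ denotes the last coordinate of $x\in\mathbb R^d$. *)

theory Defs
  imports "HOL-Probability.Probability"
begin

definition bessel_K :: "real \<Rightarrow> real \<Rightarrow> real" where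
  "bessel_K \<nu> r = 2 powr (-1 - \<nu>) * r powr \<nu> *
     (LINT v:{0<..}|lborel. exp (- v) * exp (- r\<^sup>2 / (4 * v)) * v powr (-1 - \<nu>))"

definition last_coord :: "real ^ ('n :: {finite, linorder}) \<Rightarrow> real" where
  "last_coord x = x $ Max UNIV"

definition half_space :: "(real ^ ('n :: {finite, linorder})) set" where
  "half_space = {x. last_coord x > 0}"

definition cadlag :: "(real \<Rightarrow> 'a :: topological_space) \<Rightarrow> bool" where
  "cadlag f \<longleftrightarrow>
     (\<forall>t\<ge>0. (f \<longlongrightarrow> f t) (at_right t)) \<and>
     (\<forall>t>0. \<exists>l. (f \<longlongrightarrow> l) (at_left t))"

text \<open>Processes are indexed by all reals, but only times \<open>t \<ge> 0\<close> are constrained or used.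
  Continuity in probability is not listed because it follows from the path regularity.\<close>

definition levy_process :: "'w measure \<Rightarrow> (real \<Rightarrow> 'w \<Rightarrow> 'a :: euclidean_space) \<Rightarrow> bool" where
  "levy_process M X \<longleftrightarrow>
     prob_space M \<and>
     (\<forall>t\<ge>0. X t \<in> borel_measurable M) \<and>
     (AE \<omega> in M. X 0 \<omega> = 0) \<and>
     (\<forall>(n::nat) (t :: nat \<Rightarrow> real). 0 \<le> t 0 \<and> (\<forall>i<n. t i < t (Suc i)) \<longrightarrow>
        prob_space.indep_vars M (\<lambda>_. borel) (\<lambda>i \<omega>. X (t (Suc i)) \<omega> - X (t i) \<omega>) {..<n}) \<and>
     (\<forall>s\<ge>0. \<forall>t\<ge>0. distr M borel (\<lambda>\<omega>. X (s + t) \<omega> - X s \<omega>) = distr M borel (X t)) \<and>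
     (AE \<omega> in M. cadlag (\<lambda>t. X t \<omega>))"

text \<open>The process under \<open>P\<^sup>0\<close>. The process started at \<open>x\<close> is realised on the same
  probability space as \<open>x + X t\<close>.\<close>

definition relativistic_stable_process ::
  "real \<Rightarrow> real \<Rightarrow> 'w measure \<Rightarrow> (real \<Rightarrow> 'w \<Rightarrow> 'a :: euclidean_space) \<Rightarrow> bool" where
  "relativistic_stable_process \<alpha> m M X \<longleftrightarrow>
     levy_process M X \<and>
     (\<forall>t\<ge>0. \<forall>z. (LINT \<omega>|M. exp (\<i> * complex_of_real (z \<bullet> X t \<omega>))) =
        complex_of_real
          (exp (m * t) * exp (- t * ((norm z)\<^sup>2 + m powr (2 / \<alpha>)) powr (\<alpha> / 2))))"

text \<open>The infimum is taken in the extended reals, so that a path that never leaves \<open>D\<close>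
  has exit time \<open>\<infinity>\<close>.\<close>

definition exit_time :: "'a set \<Rightarrow> (real \<Rightarrow> 'a) \<Rightarrow> ereal" where
  "exit_time D f = Inf (ereal ` {t. 0 \<le> t \<and> f t \<notin> D})"

text \<open>\<open>A \<mapsto> E\<^sup>x[\<tau> < \<infinity>; exp (- m \<tau>) 1\<^sub>A(X\<^sub>\<tau>)]\<close> with \<open>\<tau>\<close> the exit time from \<open>D\<close>.
  The expectation is over the completion of the probability space: the first hitting time of a
  closed set by a cadlag process is in general measurable only after completion.\<close>

definition exit_measure ::
  "'w measure \<Rightarrow> (real \<Rightarrow> 'w \<Rightarrow> 'a :: euclidean_space) \<Rightarrow> real \<Rightarrow> 'a set \<Rightarrow> 'a \<Rightarrow> 'a set \<Rightarrow> real" where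
  "exit_measure M X m D x A =
     (let \<tau> = (\<lambda>\<omega>. exit_time D (\<lambda>t. x + X t \<omega>)) in
      LINT \<omega>:{\<omega> \<in> space M. \<tau> \<omega> < \<infinity>}|completion M.
        exp (- m * real_of_ereal (\<tau> \<omega>)) *
        indicat_real A (x + X (real_of_ereal (\<tau> \<omega>)) \<omega>))"

text \<open>\<open>p\<close> is a density of the exit measure on the Borel subsets of the complement of \<open>D\<close>;
  the values of \<open>p\<close> on \<open>D\<close> are irrelevant.\<close>

definition is_poisson_kernel ::
  "'w measure \<Rightarrow> (real \<Rightarrow> 'w \<Rightarrow> 'a :: euclidean_space) \<Rightarrow> real \<Rightarrow> 'a set \<Rightarrow> 'a \<Rightarrow>
     ('a \<Rightarrow> real) \<Rightarrow> bool" where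
  "is_poisson_kernel M X m D x p \<longleftrightarrow>
     p \<in> borel_measurable borel \<and> (\<forall>u. 0 \<le> p u) \<and>
     (\<forall>A \<in> sets borel. A \<subseteq> - D \<longrightarrow>
        set_integrable lborel A p \<and> exit_measure M X m D x A = (LINT u:A|lborel. p u))"

end

theory Submission
  imports Defs
begin

text \<open>
  Let \<open>T\<close> be the hitting time of the open lower half-space. The strong Markov property gives
  \<open>U f(x) = E\<^sup>x[e\<^sup>-\<^sup>m\<^sup>T U f(X\<^sub>T)]\<close> for the \<open>m\<close>-potential operator \<open>U\<close> and every \<open>f\<close> that vanishes
  on the upper half-space. After a Fourier transform in the tangential variables, at frequency \<open>z\<close> and with
  \<open>w\<^sup>2 = |z|\<^sup>2 + m\<^bsup>2/\<alpha>\<^esup>\<close>, the operator \<open>U\<close> is a convolution on the line with symbol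
  \<open>(w\<^sup>2 + \<xi>\<^sup>2)\<^bsup>-\<alpha>/2\<^esup> = (w - i \<xi>)\<^bsup>-\<alpha>/2\<^esup> (w + i \<xi>)\<^bsup>-\<alpha>/2\<^esup>\<close>, that is, with the product of
  an upward and a downward gamma kernel. Functions \<open>f\<close> for which the downward part can be inverted explicitly
  determine the Fourier transform of \<open>E\<^sup>x[e\<^sup>-\<^sup>m\<^sup>T; X\<^sub>T \<in> \<cdot>]\<close>. The Fourier transform of the claimed kernel is a
  Gaussian computation, started from the integral representation of the Bessel function, and agrees with it.
  The total mass of the kernel is continuous in \<open>x\<^sub>d\<close>; since hitting times are monotone in \<open>x\<^sub>d\<close>, this forces the
  hitting times of the open and of the closed half-space to agree almost surely.
\<close>

section \<open>Fourier transforms determine integrals of continuous functions\<close>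

text \<open>Discounting at rate \<open>m\<close> is what makes the symbol factor: it cancels
  \<open>exp (m * t)\<close> in the characteristic function, so that the time integral is a pure
  power of w^2 + \<xi>^2. The open half-space is used because a right-continuous path that enters an
  open set stays in it for a moment, so fine time grids detect the visit; a visit to the closed
  half-space can be missed by every grid, and equality of the two hitting times becomes accessible
  only once the law is known. Neither a transition density nor a density of the hitting law is
  available beforehand, hence all identities are tested against functions, and Fourier uniqueness is
  proved for images of complex measures. A test function for frequency \<xi> yields only the
  difference of two values of one unknown function, at i\<xi> and at w, because truncating an
  exponential at 0 creates a second exponential; the value at w is common to all \<xi> and is
  removed by the decay of the gamma transform. The constant sin(\<pi>\<alpha>/2)/\<pi> is
  1/(Gamma(\<alpha>/2) Gamma(1-\<alpha>/2)), the reciprocal of the Beta integral that arises when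
  powers of orders \<alpha>/2 and 1-\<alpha>/2 are convolved.\<close>

text \<open>Lebesgue measure is the image of the product measure over the basis, so integrands that
  split into coordinates are handled factor by factor. This serves both the Gaussian below and the
  Poisson kernel later on.\<close>

lemma
  fixes f :: "'a::euclidean_space \<Rightarrow> real \<Rightarrow> complex"
  assumes "\<And>b. b \<in> Basis \<Longrightarrow> integrable lborel (f b)"
  shows integrable_lborel_prod: "integrable lborel (\<lambda>x::'a. \<Prod>b\<in>Basis. f b (x \<bullet> b))"
    and integral_lborel_prod: "(LINT x::'a|lborel. (\<Prod>b\<in>Basis. f b (x \<bullet> b))) = (\<Prod>b\<in>Basis. (LINT x|lborel. f b x))"
proof -
  interpret product_sigma_finite "\<lambda>_::'a. lborel :: real measure" by standard
  let ?T = "\<lambda>g::'a\<Rightarrow>real. \<Sum>b\<in>Basis. g b *\<^sub>R b"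
  have [measurable]: "f b \<in> borel_measurable borel" if "b \<in> Basis" for b
    using assms[OF that] by auto
  have meas: "(\<lambda>x::'a. \<Prod>b\<in>Basis. f b (x \<bullet> b)) \<in> borel_measurable borel"
    by measurable
  have T: "?T \<in> (\<Pi>\<^sub>M b\<in>Basis. lborel) \<rightarrow>\<^sub>M borel" by measurable
  have eq: "(\<Prod>b\<in>Basis. f b (?T g \<bullet> b)) = (\<Prod>b\<in>Basis. f b (g b))" for g
    by (intro prod.cong) auto
  show "integrable lborel (\<lambda>x::'a. \<Prod>b\<in>Basis. f b (x \<bullet> b))"
    by (subst lborel_eq) (use assms in \<open>auto simp: integrable_distr_eq[OF T meas] eq intro!: product_integrable_prod\<close>)
  show "(LINT x::'a|lborel. (\<Prod>b\<in>Basis. f b (x \<bullet> b))) = (\<Prod>b\<in>Basis. (LINT x|lborel. f b x))"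
    by (subst lborel_eq) (use assms in \<open>auto simp: integral_distr[OF T meas] eq intro!: product_integral_prod\<close>)
qed

text \<open>Up to the factor \<open>sqrt (2 * pi)\<close> this is the characteristic function of the
  standard normal distribution.\<close>

lemma
  fixes t :: real
  shows integrable_gaussian_exp: "integrable lborel (\<lambda>x. iexp (t * x) * complex_of_real (exp (- x\<^sup>2 / 2)))"
    and integral_gaussian_exp: "(LINT x|lborel. iexp (t * x) * complex_of_real (exp (- x\<^sup>2 / 2)))
      = complex_of_real (sqrt (2 * pi) * exp (- t\<^sup>2 / 2))"
proof -
  interpret N: real_distribution std_normal_distribution by (rule real_dist_normal_dist)
  have dens: "exp (- x\<^sup>2 / 2) = sqrt (2 * pi) * std_normal_density x" for x :: real
    by (simp add: std_normal_density_def)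
  have exp_eq: "iexp (t * x) * complex_of_real (exp (- x\<^sup>2 / 2))
      = of_real (sqrt (2 * pi)) * (std_normal_density x *\<^sub>R iexp (t * x))" for x
    unfolding dens by (simp add: scaleR_conv_of_real mult_ac)
  have "integrable std_normal_distribution (\<lambda>x. iexp (t * x))"
    by (rule N.integrable_iexp) (auto simp del: of_real_mult)
  hence 1: "integrable lborel (\<lambda>x. std_normal_density x *\<^sub>R iexp (t * x))"
    by (subst (asm) integrable_density) (auto simp: normal_density_nonneg)
  thus "integrable lborel (\<lambda>x. iexp (t * x) * complex_of_real (exp (- x\<^sup>2 / 2)))"
    unfolding exp_eq by (rule integrable_mult_right)
  have "char std_normal_distribution t = (LINT x|lborel. std_normal_density x *\<^sub>R iexp (t * x))"
    unfolding char_def by (subst integral_density) (auto simp: normal_density_nonneg)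
  thus "(LINT x|lborel. iexp (t * x) * complex_of_real (exp (- x\<^sup>2 / 2)))
     = complex_of_real (sqrt (2 * pi) * exp (- t\<^sup>2 / 2))"
    unfolding exp_eq integral_mult_right_zero by (simp add: char_std_normal_distribution)
qed

lemma norm_sq_Basis: "(norm v)\<^sup>2 = (\<Sum>b\<in>Basis. (v \<bullet> b)\<^sup>2)" for v :: "'a::euclidean_space"
  unfolding power2_norm_eq_inner euclidean_inner[of v v] by (simp add: power2_eq_square)

lemma
  fixes z :: "'a::euclidean_space"
  shows integrable_gaussian_exp_inner:
      "integrable lborel (\<lambda>v::'a. iexp (z \<bullet> v) * complex_of_real (exp (- (norm v)\<^sup>2 / 2)))"
    and integral_gaussian_exp_inner:
      "(LINT v::'a|lborel. iexp (z \<bullet> v) * complex_of_real (exp (- (norm v)\<^sup>2 / 2)))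
      = of_real (sqrt (2 * pi) ^ DIM('a) * exp (- (norm z)\<^sup>2 / 2))"
proof -
  have exp_norm: "exp (- (norm v)\<^sup>2 / 2) = (\<Prod>b\<in>Basis. exp (- (v \<bullet> b)\<^sup>2 / 2))" for v :: 'a
    by (simp add: norm_sq_Basis exp_sum[symmetric] sum_negf sum_divide_distrib)
  have exp_in: "iexp (z \<bullet> v) = (\<Prod>b\<in>Basis. iexp ((z \<bullet> b) * (v \<bullet> b)))" for v :: 'a
    by (simp add: exp_sum[symmetric] euclidean_inner[of z v] sum_distrib_left)
  have eq: "iexp (z \<bullet> v) * complex_of_real (exp (- (norm v)\<^sup>2 / 2)) =
     (\<Prod>b\<in>Basis. iexp ((z \<bullet> b) * (v \<bullet> b)) * complex_of_real (exp (- (v \<bullet> b)\<^sup>2 / 2)))" for v :: 'a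
    unfolding exp_norm exp_in prod.distrib of_real_prod ..
  let ?f = "\<lambda>b x. iexp ((z \<bullet> b) * x) * complex_of_real (exp (- x\<^sup>2 / 2))"
  show "integrable lborel (\<lambda>v::'a. iexp (z \<bullet> v) * complex_of_real (exp (- (norm v)\<^sup>2 / 2)))"
    unfolding eq by (rule integrable_lborel_prod[of ?f, OF integrable_gaussian_exp])
  show "(LINT v::'a|lborel. iexp (z \<bullet> v) * complex_of_real (exp (- (norm v)\<^sup>2 / 2)))
      = of_real (sqrt (2 * pi) ^ DIM('a) * exp (- (norm z)\<^sup>2 / 2))"
    unfolding eq unfolding integral_lborel_prod[of ?f, OF integrable_gaussian_exp] integral_gaussian_exp
    by (simp only: exp_norm prod.distrib prod_constant of_real_prod of_real_mult of_real_power)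
qed

lemma integrable_gaussian: "integrable lborel (\<lambda>v::'a::euclidean_space. exp (- (norm v)\<^sup>2 / 2))"
proof -
  have "integrable lborel (\<lambda>v::'a. complex_of_real (exp (- (norm v)\<^sup>2 / 2)))"
    using integrable_gaussian_exp_inner[of "0::'a"] by simp
  from integrable_norm[OF this] show ?thesis by simp
qed

lemma
  fixes g :: "'a::euclidean_space \<Rightarrow> complex"
  assumes n: "n > 0" and g [measurable]: "g \<in> borel_measurable borel"
  shows integrable_gaussian_shift: "integrable lborel (\<lambda>v. g (p + v /\<^sub>R n) * of_real (exp (- (norm v)\<^sup>2 / 2))) \<Longrightarrow>
       integrable lborel (\<lambda>y. g y * of_real (exp (- (norm (n *\<^sub>R (y - p)))\<^sup>2 / 2)))"
    and integral_gaussian_shift: "(LINT y|lborel. g y * of_real (exp (- (norm (n *\<^sub>R (y - p)))\<^sup>2 / 2)))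
       = of_real ((1 / n) ^ DIM('a)) * (LINT v|lborel. g (p + v /\<^sub>R n) * of_real (exp (- (norm v)\<^sup>2 / 2)))"
proof -
  let ?F = "\<lambda>y. g y * complex_of_real (exp (- (norm (n *\<^sub>R (y - p)))\<^sup>2 / 2))"
  have [measurable]: "?F \<in> borel_measurable borel" by measurable
  have n': "1 / n \<noteq> 0" using n by simp
  have aff: "?F (p + (1/n) *\<^sub>R v) = g (p + v /\<^sub>R n) * of_real (exp (- (norm v)\<^sup>2 / 2))" for v
    using n by (simp add: inverse_eq_divide)
  show "integrable lborel ?F" if "integrable lborel (\<lambda>v. g (p + v /\<^sub>R n) * of_real (exp (- (norm v)\<^sup>2 / 2)))"
  proof -
    have "integrable lborel (\<lambda>v. (\<bar>1/n\<bar>^DIM('a)) *\<^sub>R ?F (p + (1/n) *\<^sub>R v))"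
      unfolding aff by (intro integrable_scaleR_right that)
    hence "integrable (distr lborel borel (\<lambda>x. p + (1/n) *\<^sub>R x)) (\<lambda>v. (\<bar>1/n\<bar>^DIM('a)) *\<^sub>R ?F v)"
      by (subst integrable_distr_eq) auto
    hence "integrable (density (distr lborel borel (\<lambda>x. p + (1/n) *\<^sub>R x)) (\<lambda>_. \<bar>1/n\<bar>^DIM('a))) ?F"
      by (subst integrable_density) auto
    thus ?thesis unfolding lborel_affine[OF n', symmetric] .
  qed
  have "integral\<^sup>L lborel ?F = integral\<^sup>L (density (distr lborel borel (\<lambda>x. p + (1/n) *\<^sub>R x)) (\<lambda>_. \<bar>1/n\<bar>^DIM('a))) ?F"
    by (rule arg_cong[where f="\<lambda>M. integral\<^sup>L M ?F"]) (rule lborel_affine[OF n'])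
  also have "\<dots> = (LINT v|distr lborel borel (\<lambda>x. p + (1/n) *\<^sub>R x). (\<bar>1/n\<bar>^DIM('a)) *\<^sub>R ?F v)"
    by (rule integral_density) auto
  also have "\<dots> = (LINT v|lborel. (\<bar>1/n\<bar>^DIM('a)) *\<^sub>R ?F (p + (1/n) *\<^sub>R v))"
    by (rule integral_distr) measurable
  also have "\<dots> = (\<bar>1/n\<bar>^DIM('a)) *\<^sub>R (LINT v|lborel. ?F (p + (1/n) *\<^sub>R v))"
    by (rule Bochner_Integration.integral_scaleR_right)
  also have "(LINT v|lborel. ?F (p + (1/n) *\<^sub>R v)) = (LINT v|lborel. g (p + v /\<^sub>R n) * of_real (exp (- (norm v)\<^sup>2 / 2)))"
    unfolding aff ..
  finally show "integral\<^sup>L lborel ?F = of_real ((1 / n) ^ DIM('a)) * (LINT v|lborel. g (p + v /\<^sub>R n) * of_real (exp (- (norm v)\<^sup>2 / 2)))"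
    using n unfolding scaleR_conv_of_real by simp
qed

section \<open>Uniqueness of Fourier transforms by Gaussian smoothing\<close>

text \<open>The Gaussian is its own Fourier transform up to a constant. Writing it as a
  superposition of oscillations and exchanging integrals expresses the smoothed measure through its
  Fourier transform alone. The complex measure is represented as the image under
  \<open>\<phi>\<close> of \<open>N\<close> with weight \<open>c\<close>; integrability of
  \<open>c\<close> replaces finiteness of \<open>N\<close>.\<close>

lemma fourier_smoothing:
  fixes \<phi> :: "'w \<Rightarrow> 'a::euclidean_space" and c :: "'w \<Rightarrow> complex"
  assumes "sigma_finite_measure N" and c: "integrable N c" and [measurable]: "\<phi> \<in> borel_measurable N"
  shows "of_real (sqrt (2 * pi) ^ DIM('a)) * (LINT \<omega>|N. c \<omega> * of_real (exp (- (norm (n *\<^sub>R (y - \<phi> \<omega>)))\<^sup>2 / 2)))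
     = (LINT z|lborel. (LINT \<omega>|N. c \<omega> * iexp ((- n *\<^sub>R z) \<bullet> \<phi> \<omega>))
          * (iexp (z \<bullet> (n *\<^sub>R y)) * of_real (exp (- (norm z)\<^sup>2 / 2))))"
proof -
  interpret N: sigma_finite_measure N by fact
  interpret P: pair_sigma_finite N "lborel :: 'a measure" ..
  have [measurable]: "c \<in> borel_measurable N" using c by auto
  let ?h = "\<lambda>(z::'a) \<omega>. c \<omega> * (iexp (z \<bullet> (n *\<^sub>R (y - \<phi> \<omega>))) * complex_of_real (exp (- (norm z)\<^sup>2 / 2)))"
  have int: "integrable (N \<Otimes>\<^sub>M lborel) (\<lambda>(\<omega>, z). ?h z \<omega>)"
  proof (rule P.Fubini_integrable)
    have "integrable N (\<lambda>\<omega>. norm (c \<omega>) * (LINT z|lborel. exp (- (norm (z::'a))\<^sup>2 / 2)))"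
      using c by simp
    thus "integrable N (\<lambda>\<omega>. LINT z|lborel. norm (case (\<omega>, z) of (\<omega>, z) \<Rightarrow> ?h z \<omega>))"
      by (simp add: norm_mult)
    have "integrable lborel (\<lambda>z. ?h z \<omega>)" for \<omega>
      using integrable_gaussian_exp_inner[of "n *\<^sub>R (y - \<phi> \<omega>)"] by (auto simp: inner_commute)
    thus "AE \<omega> in N. integrable lborel (\<lambda>z. case (\<omega>, z) of (\<omega>, z) \<Rightarrow> ?h z \<omega>)"
      by simp
  qed measurable
  have gauss: "(LINT z|lborel. iexp (z \<bullet> v) * complex_of_real (exp (- (norm z)\<^sup>2 / 2)))
      = of_real (sqrt (2 * pi) ^ DIM('a) * exp (- (norm v)\<^sup>2 / 2))" for v :: 'a
    using integral_gaussian_exp_inner[of v] unfolding inner_commute[of v] .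
  have "of_real (sqrt (2 * pi) ^ DIM('a)) * (LINT \<omega>|N. c \<omega> * of_real (exp (- (norm (n *\<^sub>R (y - \<phi> \<omega>)))\<^sup>2 / 2)))
    = (LINT \<omega>|N. c \<omega> * of_real (sqrt (2 * pi) ^ DIM('a) * exp (- (norm (n *\<^sub>R (y - \<phi> \<omega>)))\<^sup>2 / 2)))"
    by (subst integral_mult_right_zero[symmetric]) (simp add: mult_ac)
  also have "\<dots> = (LINT \<omega>|N. LINT z|lborel. ?h z \<omega>)"
    unfolding integral_mult_right_zero gauss ..
  also have "\<dots> = (LINT z|lborel. LINT \<omega>|N. ?h z \<omega>)"
    using P.Fubini_integral[OF int] by simp
  also have "\<dots> = (LINT z|lborel. LINT \<omega>|N. c \<omega> * iexp ((- n *\<^sub>R z) \<bullet> \<phi> \<omega>)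
      * (iexp (z \<bullet> (n *\<^sub>R y)) * of_real (exp (- (norm z)\<^sup>2 / 2))))"
    by (intro Bochner_Integration.integral_cong refl) (simp add: exp_add[symmetric] algebra_simps)
  finally show ?thesis by simp
qed

text \<open>Gaussians of width \<open>1 / Suc n\<close> form an approximate identity. Fubini moves
  the smoothing from the measure to \<open>g\<close>, where continuity and boundedness allow
  dominated convergence.\<close>

lemma fourier_test_limit:
  fixes \<phi> :: "'w \<Rightarrow> 'a::euclidean_space" and c :: "'w \<Rightarrow> complex" and g :: "'a \<Rightarrow> complex"
  assumes "sigma_finite_measure N" and c: "integrable N c" and [measurable]: "\<phi> \<in> borel_measurable N"
    and g: "continuous_on UNIV g" and B: "\<And>x. norm (g x) \<le> B"
  shows "(\<lambda>n. of_real (real (Suc n) ^ DIM('a)) * (LINT y|lborel. g y *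
       (LINT \<omega>|N. c \<omega> * of_real (exp (- (norm (real (Suc n) *\<^sub>R (y - \<phi> \<omega>)))\<^sup>2 / 2)))))
     \<longlonglongrightarrow> of_real (sqrt (2 * pi) ^ DIM('a)) * (LINT \<omega>|N. c \<omega> * g (\<phi> \<omega>))"
proof -
  interpret N: sigma_finite_measure N by fact
  interpret P: pair_sigma_finite N "lborel :: 'a measure" ..
  have [measurable]: "c \<in> borel_measurable N" using c by auto
  have gm [measurable]: "g \<in> borel_measurable borel" using g by (rule borel_measurable_continuous_onI)
  let ?K = "LINT v|lborel. exp (- (norm (v::'a))\<^sup>2 / 2)"
  let ?E = "\<lambda>v::'a. complex_of_real (exp (- (norm v)\<^sup>2 / 2))"
  have K: "(LINT v|lborel. ?E v) = of_real (sqrt (2 * pi) ^ DIM('a))"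
    using integral_gaussian_exp_inner[of "0::'a"] by simp
  have intE: "integrable lborel ?E" using integrable_gaussian_exp_inner[of "0::'a"] by simp
  \<comment> \<open>The local Gaussian average of \<open>g\<close> around \<open>p\<close>, after
    the substitution y = p + v/(n+1); the Jacobian cancels the prefactor in the statement.\<close>
  define G where "G n p = (LINT v|lborel. g (p + v /\<^sub>R real (Suc n)) * ?E v)" for n p
  have G_meas [measurable]: "G n \<in> borel_measurable borel" for n
    unfolding G_def by measurable
  have B0: "B \<ge> 0" using B[of 0] norm_ge_zero order_trans by blast
  have intg: "integrable lborel (\<lambda>v. g (p + v /\<^sub>R real (Suc n)) * ?E v)" for p n
    by (rule Bochner_Integration.integrable_bound[OF integrable_mult_right[OF integrable_norm[OF intE], of B]])
      (auto simp: norm_mult B0 intro!: mult_right_mono B)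
  have G_bound: "norm (G n p) \<le> B * ?K" for n p
  proof -
    have "norm (G n p) \<le> (LINT v|lborel. norm (g (p + v /\<^sub>R real (Suc n)) * ?E v))"
      unfolding G_def by (rule integral_norm_bound)
    also have "\<dots> \<le> (LINT v|lborel. B * exp (- (norm (v::'a))\<^sup>2 / 2))"
      by (rule Bochner_Integration.integral_mono[OF integrable_norm[OF intg] integrable_mult_right[OF integrable_gaussian]])
         (auto simp: norm_mult intro!: mult_right_mono B)
    finally show ?thesis by simp
  qed
  have G_lim: "(\<lambda>n. G n p) \<longlonglongrightarrow> (LINT v|lborel. g p * ?E v)" for p
    unfolding G_def
  proof (rule integral_dominated_convergence)
    show "integrable lborel (\<lambda>v::'a. B * exp (- (norm v)\<^sup>2 / 2))"
      by (intro integrable_mult_right integrable_gaussian)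
    show "AE v in lborel. (\<lambda>n. g (p + v /\<^sub>R real (Suc n)) * ?E v) \<longlonglongrightarrow> g p * ?E v"
    proof (intro AE_I2 tendsto_mult tendsto_const)
      fix v :: 'a
      have "(\<lambda>n. p + v /\<^sub>R real (Suc n)) \<longlonglongrightarrow> p + 0 *\<^sub>R v"
        by (intro tendsto_intros LIMSEQ_inverse_real_of_nat)
      moreover have "isCont g p" using g by (simp add: continuous_on_eq_continuous_at)
      ultimately show "(\<lambda>n. g (p + v /\<^sub>R real (Suc n))) \<longlonglongrightarrow> g p"
        by (auto intro: isCont_tendsto_compose)
    qed
  qed (auto simp: norm_mult intro!: mult_right_mono B)
  have eq: "of_real (real (Suc n) ^ DIM('a)) * (LINT y|lborel. g y *
       (LINT \<omega>|N. c \<omega> * of_real (exp (- (norm (real (Suc n) *\<^sub>R (y - \<phi> \<omega>)))\<^sup>2 / 2)))) = (LINT \<omega>|N. c \<omega> * G n (\<phi> \<omega>))" for n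
  proof -
    let ?h = "\<lambda>y \<omega>. c \<omega> * (g y * complex_of_real (exp (- (norm (real (Suc n) *\<^sub>R (y - \<phi> \<omega>)))\<^sup>2 / 2)))"
    have inner: "(LINT y|lborel. g' y * complex_of_real (exp (- (norm (real (Suc n) *\<^sub>R (y - p)))\<^sup>2 / 2)))
       = of_real ((1 / real (Suc n)) ^ DIM('a)) * (LINT v|lborel. g' (p + v /\<^sub>R real (Suc n)) * ?E v)"
      if "g' \<in> borel_measurable borel" for g' p
      by (rule integral_gaussian_shift) (use that in auto)
    have int_h: "integrable lborel (\<lambda>y. ?h y \<omega>)" for \<omega>
      by (intro integrable_mult_right integrable_gaussian_shift intg) auto
    have int: "integrable (N \<Otimes>\<^sub>M lborel) (\<lambda>(\<omega>, y). ?h y \<omega>)"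
    proof (rule P.Fubini_integrable)
      have "(LINT y|lborel. norm (?h y \<omega>)) \<le> norm (c \<omega>) * ((1 / real (Suc n)) ^ DIM('a) * (B * ?K))" for \<omega>
      proof -
        have *: "complex_of_real (LINT y|lborel. norm (g y * complex_of_real (exp (- (norm (real (Suc n) *\<^sub>R (y - \<phi> \<omega>)))\<^sup>2 / 2))))
          = complex_of_real ((1 / real (Suc n)) ^ DIM('a) * (LINT v|lborel. norm (g (\<phi> \<omega> + v /\<^sub>R real (Suc n)) * ?E v)))"
          using inner[of "\<lambda>y. of_real (norm (g y))" "\<phi> \<omega>"]
          unfolding norm_mult norm_of_real abs_exp_cancel of_real_mult[symmetric] integral_complex_of_real by simp
        have "(LINT v|lborel. norm (g (\<phi> \<omega> + v /\<^sub>R real (Suc n)) * ?E v)) \<le> (LINT v|lborel. B * exp (- (norm (v::'a))\<^sup>2 / 2))"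
          by (rule Bochner_Integration.integral_mono[OF integrable_norm[OF intg] integrable_mult_right[OF integrable_gaussian]])
            (auto simp: norm_mult intro!: mult_right_mono B)
        with * show ?thesis
          unfolding norm_mult[of "c \<omega>"] integral_mult_right_zero of_real_eq_iff by (auto intro!: mult_left_mono)
      qed
      thus "integrable N (\<lambda>\<omega>. LINT y|lborel. norm (case (\<omega>, y) of (\<omega>, y) \<Rightarrow> ?h y \<omega>))"
        by (intro Bochner_Integration.integrable_bound[OF integrable_mult_left[OF integrable_norm[OF c], of "(1 / real (Suc n)) ^ DIM('a) * (B * ?K)"]])
          (auto intro: order_trans[OF _ abs_ge_self])
      show "AE \<omega> in N. integrable lborel (\<lambda>y. case (\<omega>, y) of (\<omega>, y) \<Rightarrow> ?h y \<omega>)"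
        using int_h by simp
    qed measurable
    have "(LINT y|lborel. g y * (LINT \<omega>|N. c \<omega> * of_real (exp (- (norm (real (Suc n) *\<^sub>R (y - \<phi> \<omega>)))\<^sup>2 / 2))))
       = (LINT y|lborel. LINT \<omega>|N. ?h y \<omega>)"
      by (subst integral_mult_right_zero[symmetric]) (simp add: mult_ac)
    also have "\<dots> = (LINT \<omega>|N. LINT y|lborel. ?h y \<omega>)"
      using P.Fubini_integral[OF int] by simp
    also have "\<dots> = (LINT \<omega>|N. of_real ((1 / real (Suc n)) ^ DIM('a)) * (c \<omega> * G n (\<phi> \<omega>)))"
      unfolding integral_mult_right_zero inner[OF gm] G_def
      by (subst integral_mult_right_zero[symmetric]) (simp only: mult_ac)
    moreover have "1 + complex_of_nat n \<noteq> 0" using of_nat_neq_0[of n, where 'a=complex] by simp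
    ultimately show ?thesis by (simp add: power_one_over)
  qed
  have "(\<lambda>n. LINT \<omega>|N. c \<omega> * G n (\<phi> \<omega>)) \<longlonglongrightarrow> (LINT \<omega>|N. c \<omega> * (LINT v|lborel. g (\<phi> \<omega>) * ?E v))"
  proof (rule integral_dominated_convergence)
    show "integrable N (\<lambda>\<omega>. norm (c \<omega>) * (B * ?K))"
      using c by simp
    show "AE \<omega> in N. (\<lambda>n. c \<omega> * G n (\<phi> \<omega>)) \<longlonglongrightarrow> c \<omega> * (LINT v|lborel. g (\<phi> \<omega>) * ?E v)"
      by (intro AE_I2 tendsto_mult tendsto_const G_lim)
  qed (auto simp: norm_mult simp del: minus_divide_left intro!: mult_left_mono G_bound[simplified])
  also have "(LINT \<omega>|N. c \<omega> * (LINT v|lborel. g (\<phi> \<omega>) * ?E v)) = (LINT \<omega>|N. of_real (sqrt (2 * pi) ^ DIM('a)) * (c \<omega> * g (\<phi> \<omega>)))"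
    unfolding integral_mult_right_zero[where M=lborel] K by (intro Bochner_Integration.integral_cong refl) (simp only: mult_ac)
  finally show ?thesis unfolding eq integral_mult_right_zero .
qed

text \<open>Equal transforms give equal smoothings at every scale, and the limit of small scale
  recovers the integrals of \<open>g\<close>. Complex weights are essential for the later use, where
  one of them contains the tangential oscillation of the process.\<close>

theorem fourier_determines:
  fixes \<phi>1 :: "'w \<Rightarrow> 'a::euclidean_space" and c1 :: "'w \<Rightarrow> complex"
    and \<phi>2 :: "'v \<Rightarrow> 'a" and c2 :: "'v \<Rightarrow> complex" and g :: "'a \<Rightarrow> complex"
  assumes N1: "sigma_finite_measure N1" "integrable N1 c1" "\<phi>1 \<in> borel_measurable N1"
    and N2: "sigma_finite_measure N2" "integrable N2 c2" "\<phi>2 \<in> borel_measurable N2"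
    and eq: "\<And>z. (LINT \<omega>|N1. c1 \<omega> * iexp (z \<bullet> \<phi>1 \<omega>)) = (LINT \<omega>|N2. c2 \<omega> * iexp (z \<bullet> \<phi>2 \<omega>))"
    and g: "continuous_on UNIV g" and B: "\<And>x. norm (g x) \<le> B"
  shows "(LINT \<omega>|N1. c1 \<omega> * g (\<phi>1 \<omega>)) = (LINT \<omega>|N2. c2 \<omega> * g (\<phi>2 \<omega>))"
proof -
  have "of_real (sqrt (2 * pi) ^ DIM('a)) * (LINT \<omega>|N1. c1 \<omega> * of_real (exp (- (norm (n *\<^sub>R (y - \<phi>1 \<omega>)))\<^sup>2 / 2)))
      = of_real (sqrt (2 * pi) ^ DIM('a)) * (LINT \<omega>|N2. c2 \<omega> * of_real (exp (- (norm (n *\<^sub>R (y - \<phi>2 \<omega>)))\<^sup>2 / 2)))" for n y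
    unfolding fourier_smoothing[OF N1] fourier_smoothing[OF N2] eq ..
  hence *: "(LINT \<omega>|N1. c1 \<omega> * of_real (exp (- (norm (n *\<^sub>R (y - \<phi>1 \<omega>)))\<^sup>2 / 2)))
      = (LINT \<omega>|N2. c2 \<omega> * of_real (exp (- (norm (n *\<^sub>R (y - \<phi>2 \<omega>)))\<^sup>2 / 2)))" for n y
    by simp
  have "of_real (sqrt (2 * pi) ^ DIM('a)) * (LINT \<omega>|N1. c1 \<omega> * g (\<phi>1 \<omega>))
      = of_real (sqrt (2 * pi) ^ DIM('a)) * (LINT \<omega>|N2. c2 \<omega> * g (\<phi>2 \<omega>))"
    using LIMSEQ_unique[OF fourier_test_limit[OF N1 g B] fourier_test_limit[OF N2 g B, folded *]] .
  thus ?thesis by simp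
qed

section \<open>Gamma, Beta and inverse Gaussian integrals\<close>

text \<open>Both sides are compared with absolute integrability over a set, where the change of
  variables is an equivalence. The equivalence form transports integrability in either direction, so
  a computation can start from whichever side is known.\<close>

lemma has_bochner_integral_substitution:
  fixes f g g' :: "real \<Rightarrow> real"
  assumes S: "S \<in> sets borel" and g: "\<And>x. x \<in> S \<Longrightarrow> (g has_real_derivative g' x) (at x)" and inj: "inj_on g S"
    and T: "g ` S = T" "T \<in> sets borel"
    and [measurable]: "f \<in> borel_measurable borel" "(\<lambda>x. indicator S x * (\<bar>g' x\<bar> * f (g x))) \<in> borel_measurable borel"
  shows "has_bochner_integral lborel (\<lambda>x. indicator S x * (\<bar>g' x\<bar> * f (g x))) b
    \<longleftrightarrow> has_bochner_integral lborel (\<lambda>x. indicator T x * f x) b"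
proof -
  have [measurable]: "T \<in> sets borel" by fact
  have *: "has_bochner_integral lborel (\<lambda>x. indicator A x * h x) b \<longleftrightarrow> h absolutely_integrable_on A \<and> integral A h = b"
    if "A \<in> sets borel" "(\<lambda>x. indicator A x * h x) \<in> borel_measurable borel" for A and h :: "real \<Rightarrow> real"
  proof -
    have 1: "integrable lborel (\<lambda>x. indicator A x * h x) \<longleftrightarrow> h absolutely_integrable_on A"
      unfolding set_integrable_def real_scaleR_def using that(2) by (subst integrable_completion) auto
    have 2: "integral\<^sup>L lborel (\<lambda>x. indicator A x * h x) = integral A h" if "h absolutely_integrable_on A"
      using set_lebesgue_integral_eq_integral(2)[OF that] \<open>(\<lambda>x. indicator A x * h x) \<in> borel_measurable borel\<close>
      unfolding set_lebesgue_integral_def real_scaleR_def by (subst (asm) integral_completion) auto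
    show ?thesis using 1 2 by (auto simp: has_bochner_integral_iff)
  qed
  have "has_bochner_integral lborel (\<lambda>x. indicator S x * (\<bar>g' x\<bar> * f (g x))) b \<longleftrightarrow>
      (\<lambda>x. \<bar>g' x\<bar> * f (g x)) absolutely_integrable_on S \<and> integral S (\<lambda>x. \<bar>g' x\<bar> * f (g x)) = b"
    by (rule *) (use S in auto)
  also have "\<dots> \<longleftrightarrow> f absolutely_integrable_on (g ` S) \<and> integral (g ` S) f = b"
    by (rule has_absolute_integral_change_of_variables_1')
       (use S g inj in \<open>auto intro: has_field_derivative_at_within\<close>)
  also have "\<dots> \<longleftrightarrow> has_bochner_integral lborel (\<lambda>x. indicator T x * f x) b"
    unfolding T by (rule *[symmetric]) (use T in auto)
  finally show ?thesis .
qed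

text \<open>The substitution \<open>t \<mapsto> q / (p t)\<close> exchanges the contributions of the two summands of the derivative of
  \<open>p t - q / t\<close>.\<close>

lemma cauchy_schloemilch:
  fixes p q :: real
  assumes "p > 0" "q > 0"
  shows "has_bochner_integral lborel (\<lambda>t. indicator {0<..} t * exp (- (p * t - q / t)\<^sup>2)) (sqrt pi / (2 * p))"
proof -
  have 1: "has_bochner_integral lborel (\<lambda>x. indicator UNIV x * exp (- x\<^sup>2)) (sqrt pi)"
  proof -
    have "has_bochner_integral lborel (\<lambda>x. (2 * 1 * sqrt pi) * (normal_density 0 (1 / sqrt 2) x / 2)) (2 * 1 * sqrt pi * (1 / 2))"
      by (intro has_bochner_integral_mult_right has_bochner_integral_divide)
         (simp add: has_bochner_integral_iff integrable_normal_density integral_normal_density)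
    also have "(\<lambda>x. (2 * 1 * sqrt pi) * (normal_density 0 (1 / sqrt 2) x / 2)) = (\<lambda>x. indicator UNIV x * exp (- x\<^sup>2))"
      by (auto simp: normal_density_def power_divide)
    finally show ?thesis by simp
  qed
  let ?f = "\<lambda>t::real. exp (- (p * t - q / t)\<^sup>2)"
  have img1: "(\<lambda>t. p * t - q / t) ` {0<..} = UNIV"
  proof -
    have "y \<in> (\<lambda>t. p * t - q / t) ` {0<..}" for y
    proof
      \<comment> \<open>The positive root of p t^2 - y t - q = 0, which is the equation y = p t -
        q/t multiplied by t.\<close>
      let ?t = "(y + sqrt (y\<^sup>2 + 4 * p * q)) / (2 * p)"
      have "sqrt (y\<^sup>2 + 4 * p * q) > \<bar>y\<bar>" using assms real_less_rsqrt[of "\<bar>y\<bar>"] by simp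
      hence pos: "y + sqrt (y\<^sup>2 + 4 * p * q) > 0" by linarith
      thus "?t \<in> {0<..}" using assms by simp
      have "p * ?t * ?t - y * ?t - q = 0"
      proof -
        have "(sqrt (y\<^sup>2 + 4 * p * q))\<^sup>2 = y\<^sup>2 + 4 * p * q" using assms by simp
        thus ?thesis using assms by (simp add: field_simps power2_eq_square)
      qed
      moreover have "?t > 0" using pos assms by simp
      moreover have "y = p * t - q / t" if "p * t * t - y * t - q = 0" "t > 0" for t
      proof -
        have "(p * t - y) * t = q" using that by (simp add: algebra_simps)
        hence "p * t - y = q / t" using that(2) by (simp add: eq_divide_eq)
        thus ?thesis by simp
      qed
      ultimately show "y = p * ?t - q / ?t" by blast
    qed
    thus ?thesis by blast
  qed
  have inj1: "inj_on (\<lambda>t. p * t - q / t) {0<..}"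
  proof (rule strict_mono_on_imp_inj_on, rule strict_mono_onI)
    fix r s :: real assume "r \<in> {0<..}" "s \<in> {0<..}" "r < s"
    moreover from this assms have "q / s < q / r" "p * r < p * s" by (auto intro!: divide_strict_left_mono)
    ultimately show "p * r - q / r < p * s - q / s" by linarith
  qed
  have 2: "has_bochner_integral lborel (\<lambda>t. indicator {0<..} t * (\<bar>p + q / t\<^sup>2\<bar> * ?f t)) (sqrt pi)"
    by (subst has_bochner_integral_substitution[where g="\<lambda>t. p * t - q / t" and T=UNIV and f="\<lambda>x. exp (- x\<^sup>2)"])
      (use 1 in \<open>auto intro!: derivative_eq_intros inj1 simp: img1 power2_eq_square\<close>)
  have int: "integrable lborel (\<lambda>t. indicator {0<..} t * (p * ?f t))"
    by (rule Bochner_Integration.integrable_bound[OF integrable.intros[OF 2]])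
       (use assms in \<open>auto split: split_indicator intro!: AE_I2 mult_right_mono\<close>)
  define J where "J = (LINT t|lborel. indicator {0<..} t * (p * ?f t))"
  have J: "has_bochner_integral lborel (\<lambda>t. indicator {0<..} t * (p * ?f t)) J"
    using int by (simp add: has_bochner_integral_iff J_def)
  have img2: "(\<lambda>t. q / (p * t)) ` {0<..} = {0<..}"
  proof -
    have "y \<in> (\<lambda>t. q / (p * t)) ` {0<..}" if "y > 0" for y
      by (rule image_eqI[of _ _ "q / (p * y)"]) (use that assms in auto)
    thus ?thesis using assms by auto
  qed
  have inj2: "inj_on (\<lambda>t. q / (p * t)) {0<..}"
    using assms by (auto simp: inj_on_def field_simps)
  have 3: "has_bochner_integral lborel (\<lambda>t. indicator {0<..} t * (\<bar>- q / (p * t\<^sup>2)\<bar> * (p * ?f (q / (p * t))))) J"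
  proof -
    have "((\<lambda>t. q / (p * t)) has_real_derivative (- q / (p * t\<^sup>2))) (at t)" if "t \<in> {0<..}" for t
      by (rule derivative_eq_intros refl | use that assms in \<open>simp add: field_simps power2_eq_square\<close>)+
    from has_bochner_integral_substitution[where T="{0<..}" and f="\<lambda>t. p * ?f t" and g="\<lambda>t. q / (p * t)" and S="{0<..}",
      OF _ this inj2 img2, THEN iffD2, OF _ _ _ _ _ J]
    show ?thesis by simp
  qed
  have "(p * (q / (p * t)) - q / (q / (p * t)))\<^sup>2 = (p * t - q / t)\<^sup>2" if "t > 0" for t
    using that assms by (simp add: field_simps power2_eq_square)
  hence "(\<lambda>t. indicator {0<..} t * (\<bar>- q / (p * t\<^sup>2)\<bar> * (p * ?f (q / (p * t)))))
    = (\<lambda>t. indicator {0<..} t * (q / t\<^sup>2 * ?f t))"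
    using assms by (auto simp: fun_eq_iff split: split_indicator)
  with 3 have "has_bochner_integral lborel (\<lambda>t. indicator {0<..} t * (q / t\<^sup>2 * ?f t)) J" by simp
  from has_bochner_integral_add[OF J this]
  have "has_bochner_integral lborel (\<lambda>t. indicator {0<..} t * (\<bar>p + q / t\<^sup>2\<bar> * ?f t)) (J + J)"
    by (rule has_bochner_integral_cong[THEN iffD1, rotated 3]) (use assms in \<open>auto simp: algebra_simps split: split_indicator\<close>)
  hence "J + J = sqrt pi" using 2 has_bochner_integral_eq by blast
  hence "J / p = sqrt pi / (2 * p)" using assms by (simp add: field_simps)
  moreover have "has_bochner_integral lborel (\<lambda>t. indicator {0<..} t * (p * ?f t) / p) (J / p)"
    by (rule has_bochner_integral_divide[OF J])
  ultimately show ?thesis using assms by simp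
qed

text \<open>The substitution v = 1/t^2 turns v^(-3/2) dv into 2 dt, and completing the square, A/t^2
  + B t^2 = (sqrt B t - sqrt A / t)^2 + 2 sqrt (A B), leaves a Cauchy-Schloemilch integral. Here a
  Bessel function of order 1/2 collapses to an exponential.\<close>

lemma inverse_gaussian_integral:
  fixes A B :: real
  assumes "A > 0" "B > 0"
  shows "has_bochner_integral lborel (\<lambda>v. indicator {0<..} v * (v powr (-3/2) * exp (- A * v - B / v)))
      (sqrt (pi / B) * exp (- 2 * sqrt (A * B)))"
proof -
  let ?f = "\<lambda>v::real. v powr (-3/2) * exp (- A * v - B / v)"
  let ?p = "sqrt B" and ?q = "sqrt A"
  have img: "(\<lambda>t. 1 / t\<^sup>2) ` {0<..} = {0::real<..}"
  proof -
    have "y \<in> (\<lambda>t. 1 / t\<^sup>2) ` {0<..}" if "y > 0" for y :: real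
      by (rule image_eqI[of _ _ "1 / sqrt y"]) (use that in \<open>auto simp: power_divide\<close>)
    thus ?thesis by auto
  qed
  have inj: "inj_on (\<lambda>t. 1 / t\<^sup>2) {0::real<..}"
    by (auto simp: inj_on_def)
  have "has_bochner_integral lborel (\<lambda>t. (2 * exp (- 2 * sqrt (A * B))) * (indicator {0<..} t * exp (- (?p * t - ?q / t)\<^sup>2)))
     ((2 * exp (- 2 * sqrt (A * B))) * (sqrt pi / (2 * ?p)))"
    using assms by (intro has_bochner_integral_mult_right cauchy_schloemilch) auto
  also have "(2 * exp (- 2 * sqrt (A * B))) * (sqrt pi / (2 * ?p)) = sqrt (pi / B) * exp (- 2 * sqrt (A * B))"
    by (simp add: real_sqrt_divide)
  also have "(\<lambda>t. (2 * exp (- 2 * sqrt (A * B))) * (indicator {0<..} t * exp (- (?p * t - ?q / t)\<^sup>2)))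
    = (\<lambda>t. indicator {0<..} t * (\<bar>- 2 / t ^ 3\<bar> * ?f (1 / t\<^sup>2)))"
  proof
    fix t :: real
    show "(2 * exp (- 2 * sqrt (A * B))) * (indicator {0<..} t * exp (- (?p * t - ?q / t)\<^sup>2)) = indicator {0<..} t * (\<bar>- 2 / t ^ 3\<bar> * ?f (1 / t\<^sup>2))"
    proof (cases "t > 0")
      case True
      have "(1 / t\<^sup>2) powr (-3/2) = t ^ 3"
        using True by (simp add: powr_divide powr_minus powr_powr powr_realpow[symmetric] field_simps flip: powr_numeral)
      moreover have "exp (- A * (1 / t\<^sup>2) - B / (1 / t\<^sup>2)) = exp (- 2 * sqrt (A * B)) * exp (- (?p * t - ?q / t)\<^sup>2)"
        using assms True by (simp add: exp_add[symmetric] power2_diff power_divide power_mult_distrib real_sqrt_mult)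
      ultimately show ?thesis using True by simp
    qed simp
  qed
  finally have *: "has_bochner_integral lborel (\<lambda>t. indicator {0<..} t * (\<bar>- 2 / t ^ 3\<bar> * ?f (1 / t\<^sup>2)))
    (sqrt (pi / B) * exp (- 2 * sqrt (A * B)))" .
  have "((\<lambda>t. 1 / t\<^sup>2) has_real_derivative (- 2 / t ^ 3)) (at t)" if "t \<in> {0<..}" for t :: real
    by (rule derivative_eq_intros refl | use that in \<open>simp add: field_simps power2_eq_square power3_eq_cube\<close>)+
  from has_bochner_integral_substitution[where T="{0<..}" and f="?f" and g="\<lambda>t. 1 / t\<^sup>2" and S="{0<..}", OF _ this inj img, THEN iffD1, OF _ _ _ _ _ *]
  show ?thesis by simp
qed

section \<open>Laplace transforms of powers at complex arguments\<close>

lemma gamma_integral_scaled: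
  fixes a w :: real
  assumes a: "a > 0" and w: "w > 0"
  shows "has_bochner_integral lborel (\<lambda>s. indicator {0<..} s * s powr (a - 1) * exp (- w * s)) (Gamma a * w powr (- a))"
proof -
  have 0: "has_bochner_integral lborel (\<lambda>s. indicator {0<..} s * s powr (a - 1) * exp (- s)) (Gamma a)"
  proof (rule has_bochner_integral_nn_integral)
    have "ennreal (Gamma a) = (\<integral>\<^sup>+t. ennreal (indicator {0..} t * t powr (a - 1) / exp t) \<partial>lborel)"
      by (rule Gamma_conv_nn_integral_real) fact
    \<comment> \<open>Since \<open>0 powr (a - 1)\<close> is \<open>0\<close>, removing the end
      point changes nothing even pointwise.\<close>
    also have "\<dots> = (\<integral>\<^sup>+t. ennreal (indicator {0<..} t * t powr (a - 1) * exp (- t)) \<partial>lborel)"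
      by (intro nn_integral_cong arg_cong[where f=ennreal]) (auto split: split_indicator simp: exp_minus field_simps)
    finally show "(\<integral>\<^sup>+t. ennreal (indicator {0<..} t * t powr (a - 1) * exp (- t)) \<partial>lborel) = ennreal (Gamma a)" ..
  qed (use a in \<open>auto intro!: AE_I2 less_imp_le[OF Gamma_real_pos]\<close>)
  have "has_bochner_integral lborel (\<lambda>s. indicator {0<..} (0 + w * s) * (0 + w * s) powr (a - 1) * exp (- (0 + w * s))) (Gamma a /\<^sub>R \<bar>w\<bar>)"
    using 0 w by (subst lborel_has_bochner_integral_real_affine_iff[symmetric]) auto
  from has_bochner_integral_mult_right[OF this, of "w powr (1 - a)"]
  have 1: "has_bochner_integral lborel (\<lambda>s. w powr (1 - a) * (indicator {0<..} (0 + w * s) * (0 + w * s) powr (a - 1) * exp (- (0 + w * s))))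
     (w powr (1 - a) * (Gamma a /\<^sub>R \<bar>w\<bar>))" by simp
  have "w powr (1 - a) * (Gamma a /\<^sub>R \<bar>w\<bar>) = Gamma a * w powr (- a)"
    using w by (simp add: powr_diff powr_minus field_simps)
  moreover have "w powr (1 - a) * (indicator {0<..} (0 + w * s) * (0 + w * s) powr (a - 1) * exp (- (0 + w * s)))
    = indicator {0<..} s * s powr (a - 1) * exp (- w * s)" for s
  proof (cases "s > 0")
    case True
    hence "w powr (1 - a) * (w * s) powr (a - 1) = s powr (a - 1)"
      using w by (simp add: powr_mult mult.assoc[symmetric] powr_add[symmetric])
    thus ?thesis using True w by (simp add: mult.assoc[symmetric])
  qed (use w in \<open>auto simp: mult_less_0_iff zero_less_mult_iff split: split_indicator\<close>)
  ultimately show ?thesis using 1 by (simp only:)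
qed

text \<open>This is Gamma(a) p^(-a), as \<open>laplace_powr_eq\<close> shows for
  \<open>Re p > 0\<close>. It is kept as an integral because it mostly occurs as the transform of a
  gamma kernel in a convolution.\<close>

definition laplace_powr :: "real \<Rightarrow> complex \<Rightarrow> complex" where
  "laplace_powr a p = (LINT s|lborel. of_real (indicator {0<..} s * s powr (a - 1)) * exp (- p * of_real s))"

lemma integrable_laplace_powr:
  assumes "a > 0" "Re p > 0"
  shows "integrable lborel (\<lambda>s. complex_of_real (indicator {0<..} s * s powr (a - 1)) * exp (- p * of_real s))"
  using integrable.intros[OF gamma_integral_scaled[OF assms]]
  by (rule Bochner_Integration.integrable_bound) (auto simp: norm_mult split: split_indicator)

lemma iexp_diff_bound: "cmod (exp (\<i> * of_real a) - exp (\<i> * of_real b)) \<le> \<bar>a - b\<bar>"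
proof -
  have "exp (\<i> * of_real a) - exp (\<i> * of_real b) = exp (\<i> * of_real b) * (iexp (a - b) - 1)"
    by (simp add: algebra_simps exp_add[symmetric])
  hence "cmod (exp (\<i> * of_real a) - exp (\<i> * of_real b)) = cmod (iexp (a - b) - 1)"
    by (simp only: norm_mult norm_exp_i_times mult_1)
  also have "\<dots> \<le> \<bar>a - b\<bar>" using iexp_approx1[of "a - b" 0] by simp
  finally show ?thesis .
qed

text \<open>Reduces differentiability in a real parameter to limits of difference quotients, hence
  to sequences, where dominated convergence applies.\<close>

lemma has_vector_derivative_at_iff_tendsto:
  "(f has_vector_derivative D) (at x) \<longleftrightarrow> ((\<lambda>y. (f y - f x) /\<^sub>R (y - x)) \<longlongrightarrow> D) (at x)"
proof -
  have "norm ((f y - f x) - (y - x) *\<^sub>R D) / norm (y - x) = norm ((f y - f x) /\<^sub>R (y - x) - D)" if "y \<noteq> x" for y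
  proof -
    have "(f y - f x) - (y - x) *\<^sub>R D = (y - x) *\<^sub>R ((f y - f x) /\<^sub>R (y - x) - D)"
      using that by (simp add: scaleR_diff_right)
    thus ?thesis using that by simp
  qed
  hence "((\<lambda>y. norm ((f y - f x) - (y - x) *\<^sub>R D) / norm (y - x)) \<longlongrightarrow> 0) (at x)
     \<longleftrightarrow> ((\<lambda>y. norm ((f y - f x) /\<^sub>R (y - x) - D)) \<longlongrightarrow> 0) (at x)"
    by (intro filterlim_cong refl) (auto simp: eventually_at_filter)
  thus ?thesis
    unfolding has_vector_derivative_def has_derivative_iff_norm tendsto_norm_zero_iff LIM_zero_iff
    by (simp add: bounded_linear_scaleR_left)
qed

text \<open>Differentiation under the integral along the vertical line with real part
  \<open>w\<close>. Since |e^(ia) - e^(ib)| \<le> |a - b|, each difference quotient is dominated by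
  the gamma integrand of order \<open>a + 1\<close>.\<close>

lemma laplace_powr_has_vector_derivative:
  assumes a: "a > 0" and w: "w > 0"
  shows "((\<lambda>\<xi>. laplace_powr a (Complex w (- \<xi>))) has_vector_derivative \<i> * laplace_powr (a + 1) (Complex w (- \<xi>))) (at \<xi>)"
proof -
  let ?f = "\<lambda>\<xi> s. complex_of_real (indicator {0<..} s * s powr (a - 1)) * exp (- (Complex w (- \<xi>)) * of_real s)"
  let ?f1 = "\<lambda>\<xi> s. complex_of_real (indicator {0<..} s * s powr (a + 1 - 1)) * exp (- (Complex w (- \<xi>)) * of_real s)"
  have exp_eq: "exp (- (Complex w (- \<xi>)) * of_real s) = of_real (exp (- w * s)) * iexp (\<xi> * s)" for \<xi> s
  proof -
    have "- (Complex w (- \<xi>)) * of_real s = of_real (- w * s) + \<i> * of_real (\<xi> * s)"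
      by (simp add: complex_eq_iff)
    thus ?thesis by (simp only: exp_add exp_of_real)
  qed
  have int: "integrable lborel (?f \<xi>)" for \<xi> using integrable_laplace_powr[OF a, of "Complex w (-\<xi>)"] w by simp
  have "(\<lambda>n. (laplace_powr a (Complex w (- X n)) - laplace_powr a (Complex w (- \<xi>))) /\<^sub>R (X n - \<xi>))
     \<longlonglongrightarrow> \<i> * laplace_powr (a + 1) (Complex w (- \<xi>))" if X: "\<And>n. X n \<noteq> \<xi>" "X \<longlonglongrightarrow> \<xi>" for X
  proof -
    have "(\<lambda>n. LINT s|lborel. (?f (X n) s - ?f \<xi> s) /\<^sub>R (X n - \<xi>)) \<longlonglongrightarrow> (LINT s|lborel. \<i> * ?f1 \<xi> s)"
    proof (rule integral_dominated_convergence)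
      show "integrable lborel (\<lambda>s. indicator {0<..} s * s powr (a + 1 - 1) * exp (- w * s))"
        using gamma_integral_scaled[of "a + 1" w] a w by (auto intro: integrable.intros)
      show "AE s in lborel. (\<lambda>n. (?f (X n) s - ?f \<xi> s) /\<^sub>R (X n - \<xi>)) \<longlonglongrightarrow> \<i> * ?f1 \<xi> s"
      proof (rule AE_I2)
        fix s :: real
        have "((\<lambda>\<xi>. ?f \<xi> s) has_vector_derivative (\<i> * ?f1 \<xi> s)) (at \<xi>)"
        proof (cases "s > 0")
          case True
          have "((\<lambda>\<xi>. ?f \<xi> s) has_vector_derivative (complex_of_real (indicator {0<..} s * s powr (a - 1)) *
            (of_real (exp (- w * s)) * (\<i> * of_real s * iexp (\<xi> * s))))) (at \<xi>)"
          proof -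
            have "((\<lambda>x. exp (\<i> * of_real s * of_real x)) has_vector_derivative (\<i> * of_real s * exp (\<i> * of_real s * of_real \<xi>))) (at \<xi>)"
              by (rule has_vector_derivative_real_field) (auto intro!: derivative_eq_intros)
            hence "((\<lambda>x. iexp (x * s)) has_vector_derivative (\<i> * of_real s * iexp (\<xi> * s))) (at \<xi>)"
              by (simp add: mult_ac)
            thus ?thesis unfolding exp_eq by (intro has_vector_derivative_mult_right)
          qed
          moreover have "s powr a = s powr (a - 1) * s" using True by (simp add: powr_diff)
          ultimately show ?thesis unfolding exp_eq using True by (simp add: algebra_simps)
        qed simp
        hence "((\<lambda>y. (?f y s - ?f \<xi> s) /\<^sub>R (y - \<xi>)) \<longlongrightarrow> \<i> * ?f1 \<xi> s) (at \<xi>)"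
          unfolding has_vector_derivative_at_iff_tendsto .
        thus "(\<lambda>n. (?f (X n) s - ?f \<xi> s) /\<^sub>R (X n - \<xi>)) \<longlonglongrightarrow> \<i> * ?f1 \<xi> s"
          using X by (auto simp: tendsto_at_iff_sequentially comp_def)
      qed
      show "AE s in lborel. norm ((?f (X n) s - ?f \<xi> s) /\<^sub>R (X n - \<xi>)) \<le> indicator {0<..} s * s powr (a + 1 - 1) * exp (- w * s)" for n
      proof (rule AE_I2)
        fix s :: real
        show "norm ((?f (X n) s - ?f \<xi> s) /\<^sub>R (X n - \<xi>)) \<le> indicator {0<..} s * s powr (a + 1 - 1) * exp (- w * s)"
        proof (cases "s > 0")
          case True
          have "?f (X n) s - ?f \<xi> s = of_real (s powr (a - 1) * exp (- w * s)) * (iexp (X n * s) - iexp (\<xi> * s))"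
            using True unfolding exp_eq by (simp add: algebra_simps)
          hence "norm (?f (X n) s - ?f \<xi> s) \<le> s powr (a - 1) * exp (- w * s) * \<bar>X n * s - \<xi> * s\<bar>"
            using iexp_diff_bound[of "X n * s" "\<xi> * s"] by (simp only: norm_mult norm_of_real) (auto intro!: mult_left_mono)
          also have "\<dots> = s powr a * exp (- w * s) * \<bar>X n - \<xi>\<bar>"
            using True by (simp add: left_diff_distrib[symmetric] abs_mult powr_diff)
          finally have "norm (?f (X n) s - ?f \<xi> s) \<le> s powr a * exp (- w * s) * \<bar>X n - \<xi>\<bar>" .
          moreover have "norm (z /\<^sub>R r) \<le> C" if "norm z \<le> C * \<bar>r\<bar>" "r \<noteq> 0" for z :: complex and r C :: real
            using that by (simp add: field_simps)
          ultimately show ?thesis using True X(1)[of n] by simp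
        qed simp
      qed
    qed auto
    moreover have "(LINT s|lborel. (?f (X n) s - ?f \<xi> s) /\<^sub>R (X n - \<xi>)) =
      (laplace_powr a (Complex w (- X n)) - laplace_powr a (Complex w (- \<xi>))) /\<^sub>R (X n - \<xi>)" for n
      unfolding laplace_powr_def Bochner_Integration.integral_scaleR_right Bochner_Integration.integral_diff[OF int int] ..
    ultimately show ?thesis unfolding integral_mult_right_zero laplace_powr_def by (simp only:)
  qed
  thus ?thesis
    by (auto simp: has_vector_derivative_at_iff_tendsto tendsto_at_iff_sequentially comp_def)
qed

text \<open>The derivative of s^a exp(-p s) integrates to zero over the half-line because its
  boundary values vanish at 0 (as a > 0) and at infinity (as Re p > 0).\<close>

lemma laplace_powr_parts:
  assumes a: "a > 0" and p: "Re p > 0"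
  shows "p * laplace_powr (a + 1) p = of_real a * laplace_powr a p"
proof -
  let ?F = "\<lambda>s::real. complex_of_real (s powr a) * exp (- p * of_real s)"
  let ?f = "\<lambda>s::real. of_real a * (complex_of_real (s powr (a - 1)) * exp (- p * of_real s)) - p * (complex_of_real (s powr a) * exp (- p * of_real s))"
  have i1: "integrable lborel (\<lambda>s. complex_of_real (indicator {0<..} s * s powr (a - 1)) * exp (- p * of_real s))"
    using integrable_laplace_powr[OF a p] .
  have i2: "integrable lborel (\<lambda>s. complex_of_real (indicator {0<..} s * s powr a) * exp (- p * of_real s))"
    using integrable_laplace_powr[of "a + 1", OF _ p] a by simp
  have eq: "indicator {0<..} s *\<^sub>R ?f s = of_real a * (complex_of_real (indicator {0<..} s * s powr (a - 1)) * exp (- p * of_real s))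
     - p * (complex_of_real (indicator {0<..} s * s powr a) * exp (- p * of_real s))" for s
    by (auto split: split_indicator)
  have ein: "einterval 0 \<infinity> = {0<..}" by (auto simp: einterval_def zero_ereal_def)
  have "(LBINT x=ereal 0..\<infinity>. ?f x) = 0 - 0"
  proof (rule interval_integral_FTC_integrable)
    fix x assume "ereal 0 < ereal x" "ereal x < \<infinity>"
    hence x: "x > 0" by simp
    show "(?F has_vector_derivative ?f x) (at x)"
    proof -
      have 1: "((\<lambda>s. complex_of_real (s powr a)) has_vector_derivative of_real (a * x powr (a - 1))) (at x)"
        by (rule has_vector_derivative_of_real)
           (use x in \<open>auto simp: has_real_derivative_iff_has_vector_derivative[symmetric] intro!: derivative_eq_intros\<close>)
      have 2: "((\<lambda>s. exp (- p * complex_of_real s)) has_vector_derivative (- p * exp (- p * of_real x))) (at x)"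
        by (rule has_vector_derivative_real_field) (auto intro!: derivative_eq_intros)
      show ?thesis
        by (rule has_vector_derivative_eq_rhs[OF has_vector_derivative_mult[OF 1 2]]) (simp add: algebra_simps)
    qed
    show "isCont ?f x" using x by (intro continuous_intros) auto
  next
    show "set_integrable lborel (einterval (ereal 0) \<infinity>) ?f"
      unfolding set_integrable_def zero_ereal_def[symmetric] ein eq using i1 i2 by auto
    have norm: "norm (?F s) = s powr a * exp (- Re p * s)" for s by (simp add: norm_mult)
    have "((\<lambda>s. s powr a * exp (- Re p * s)) \<longlongrightarrow> 0) (at_right 0)"
      using a p by real_asymp
    hence "(?F \<longlongrightarrow> 0) (at_right 0)" by (subst tendsto_norm_zero_iff[symmetric], subst norm)
    thus "((?F \<circ> real_of_ereal) \<longlongrightarrow> 0) (at_right (ereal 0))"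
      by (simp add: ereal_tendsto_simps)
    have "((\<lambda>s. s powr a * exp (- Re p * s)) \<longlongrightarrow> 0) at_top"
      using a p by real_asymp
    hence "(?F \<longlongrightarrow> 0) at_top" by (subst tendsto_norm_zero_iff[symmetric], subst norm)
    thus "((?F \<circ> real_of_ereal) \<longlongrightarrow> 0) (at_left \<infinity>)"
      by (simp add: ereal_tendsto_simps)
  qed simp
  hence "0 = (LINT s|lborel. indicator {0<..} s *\<^sub>R ?f s)"
    by (simp add: interval_integral_to_infinity_eq set_lebesgue_integral_def)
  also have "\<dots> = of_real a * laplace_powr a p - p * laplace_powr (a + 1) p"
    unfolding eq laplace_powr_def
    by (subst Bochner_Integration.integral_diff) (use i1 i2 in \<open>auto\<close>)
  finally show ?thesis by simp
qed

text \<open>Along the vertical line through \<open>p\<close> the product on the left has derivative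
  zero: differentiation raises the order by one and integration by parts lowers it again. The
  constant is read off at the real point of that line, where the integral is the scaled Gamma
  integral.\<close>

lemma laplace_powr_eq:
  assumes a: "a > 0" and p: "Re p > 0"
  shows "laplace_powr a p * p powr of_real a = Gamma a"
proof -
  define w where "w = Re p"
  let ?P = "\<lambda>\<xi>. (Complex w (-\<xi>)) powr of_real a"
  have w: "w > 0" using p by (simp add: w_def)
  have "((\<lambda>\<xi>. laplace_powr a (Complex w (- \<xi>)) * ?P \<xi>) has_vector_derivative 0) (at \<xi> within UNIV)" for \<xi>
  proof -
    let ?q = "Complex w (- \<xi>)"
    have nz: "?q \<notin> \<real>\<^sub>\<le>\<^sub>0" using w by (auto simp: complex_nonpos_Reals_iff)
    have q0: "?q \<noteq> 0" using w by (auto simp: complex_eq_iff)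
    have "((\<lambda>\<xi>. Complex w (-\<xi>)) has_vector_derivative (- \<i>)) (at \<xi>)"
      unfolding Complex_eq by (auto intro!: derivative_eq_intros)
    hence P: "(?P has_vector_derivative (- \<i> * (of_real a * ?q powr (of_real a - 1)))) (at \<xi>)"
      by (rule field_vector_diff_chain_at[where g="\<lambda>z. z powr of_real a", unfolded comp_def])
         (use has_field_derivative_powr[OF nz, of "of_real a"] in simp)
    have "?q powr of_real a = ?q * ?q powr (of_real a - 1)" using q0 by (simp add: powr_diff)
    moreover have "?q * laplace_powr (a + 1) ?q = of_real a * laplace_powr a ?q"
      using laplace_powr_parts[OF a, of ?q] w by simp
    ultimately have "laplace_powr a ?q * (- \<i> * (of_real a * ?q powr (of_real a - 1))) + \<i> * laplace_powr (a + 1) ?q * ?q powr of_real a = 0"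
      by (simp add: algebra_simps)
    thus ?thesis
      using has_vector_derivative_mult[OF laplace_powr_has_vector_derivative[OF a w, of \<xi>] P] by (simp only:)
  qed
  then obtain c where c: "\<And>\<xi>. laplace_powr a (Complex w (- \<xi>)) * ?P \<xi> = c"
    using has_vector_derivative_zero_constant[of UNIV "\<lambda>\<xi>. laplace_powr a (Complex w (- \<xi>)) * ?P \<xi>"] by auto
  have "laplace_powr a (of_real w) = of_real (Gamma a * w powr (- a))"
  proof -
    have "laplace_powr a (of_real w) = (LINT s|lborel. complex_of_real (indicator {0<..} s * s powr (a - 1) * exp (- w * s)))"
      unfolding laplace_powr_def by (simp add: exp_of_real flip: of_real_mult of_real_minus)
    also have "\<dots> = of_real (Gamma a * w powr (- a))"
      using has_bochner_integral_integral_eq[OF gamma_integral_scaled[OF a w]] by (simp only: integral_complex_of_real)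
    finally show ?thesis .
  qed
  moreover have "Complex w (- 0) = of_real w" by (simp add: complex_eq_iff)
  moreover have "(of_real w :: complex) powr of_real a = of_real (w powr a)"
    using w by (simp add: powr_of_real)
  ultimately have "c = of_real (Gamma a)"
    using c[of 0] w powr_gt_zero[of w a] by (simp add: powr_minus flip: of_real_mult) (simp add: field_simps)
  moreover have "p = Complex w (- (- Im p))" by (simp add: w_def)
  ultimately show ?thesis using c[of "- Im p"] by simp
qed

section \<open>Convolutions of power functions\<close>

lemma integral_convolution:
  fixes f h k :: "real \<Rightarrow> complex"
  assumes f: "integrable lborel f" and h: "integrable lborel h"
    and k [measurable]: "k \<in> borel_measurable borel" and B: "\<And>x. norm (k x) \<le> B"
  shows "(LINT r|lborel. f r * (LINT q|lborel. h q * k (r + q))) = (LINT p|lborel. k p * (LINT r|lborel. f r * h (p - r)))"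
proof -
  have [measurable]: "f \<in> borel_measurable borel" "h \<in> borel_measurable borel" using f h by auto
  let ?F = "\<lambda>r p. f r * (h (p - r) * k p)"
  have bd: "norm (h q * k s) \<le> B * norm (h q)" for q s
    by (metis B mult.commute mult_left_mono norm_ge_zero norm_mult)
  have hk: "integrable lborel (\<lambda>q. h q * k (r + q))" for r
    by (rule Bochner_Integration.integrable_bound[OF integrable_mult_right[OF integrable_norm[OF h], of B]])
       (use bd in \<open>auto intro!: AE_I2 order_trans[OF _ abs_ge_self]\<close>)
  have hk': "integrable lborel (\<lambda>p. h (p - r) * k p)" for r
    using lborel_integrable_real_affine[OF hk[of r], of 1 "- r"] by (simp add: algebra_simps)
  have int: "integrable (lborel \<Otimes>\<^sub>M lborel) (\<lambda>(r, p). ?F r p)"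
  proof (rule lborel_pair.Fubini_integrable)
    have "(LINT p|lborel. norm (?F r p)) \<le> norm (f r) * (B * (LINT q|lborel. norm (h q)))" for r
    proof -
      have "(LINT p|lborel. norm (h (p - r) * k p)) \<le> (LINT p|lborel. B * norm (h (p - r)))"
      proof (rule Bochner_Integration.integral_mono[OF integrable_norm[OF hk'] integrable_mult_right])
        show "integrable lborel (\<lambda>p. norm (h (p - r)))"
          using lborel_integrable_real_affine[OF integrable_norm[OF h], of 1 "- r"] by simp
      qed (rule bd)
      also have "\<dots> = B * (LINT q|lborel. norm (h q))"
        using lborel_integral_real_affine[of 1 "\<lambda>p. norm (h p)" "- r"] by simp
      finally show ?thesis by (simp add: norm_mult[of "f r"] mult_left_mono)
    qed
    thus "integrable lborel (\<lambda>r. LINT p|lborel. norm (case (r, p) of (r, p) \<Rightarrow> ?F r p))"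
      by (intro Bochner_Integration.integrable_bound[OF integrable_mult_left[OF integrable_norm[OF f], of "B * (LINT q|lborel. norm (h q))"]])
         (auto intro: order_trans[OF _ abs_ge_self])
    show "AE r in lborel. integrable lborel (\<lambda>p. case (r, p) of (r, p) \<Rightarrow> ?F r p)"
      using hk' by auto
  qed measurable
  have "(LINT q|lborel. h q * k (r + q)) = (LINT p|lborel. h (p - r) * k p)" for r
    using lborel_integral_real_affine[of 1 "\<lambda>q. h q * k (r + q)" "- r"] by simp
  hence "(LINT r|lborel. f r * (LINT q|lborel. h q * k (r + q))) = (LINT r|lborel. LINT p|lborel. ?F r p)"
    by simp
  also have "\<dots> = (LINT p|lborel. LINT r|lborel. ?F r p)"
    using lborel_pair.Fubini_integral[OF int] by simp
  also have "\<dots> = (LINT p|lborel. k p * (LINT r|lborel. f r * h (p - r)))"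
    by (intro Bochner_Integration.integral_cong refl, subst integral_mult_right_zero[symmetric]) (simp only: mult_ac)
  finally show ?thesis .
qed

lemma Gamma_reflection_real: "Gamma b * Gamma (1 - b) = pi / sin (pi * b)" for b :: real
proof -
  have "complex_of_real (Gamma b * Gamma (1 - b)) = Gamma (of_real b) * Gamma (1 - of_real b)"
    by (simp only: of_real_mult Gamma_complex_of_real[symmetric] of_real_diff of_real_1)
  also have "\<dots> = of_real pi / sin (of_real (pi * b))"
    by (simp only: Gamma_reflection_complex of_real_mult)
  also have "\<dots> = complex_of_real (pi / sin (pi * b))"
    by (simp only: sin_of_real of_real_divide)
  finally have "complex_of_real (Gamma b * Gamma (1 - b)) = complex_of_real (pi / sin (pi * b))" .
  thus ?thesis unfolding of_real_eq_iff .
qed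

lemma has_bochner_integral_Beta:
  fixes b :: real
  assumes b: "0 < b" "b < 1"
  shows "has_bochner_integral lborel (\<lambda>t. indicator {0<..<1} t * (t powr (- b) * (1 - t) powr (b - 1))) (Gamma b * Gamma (1 - b))"
proof (rule has_bochner_integral_nn_integral)
  have "((\<lambda>t. t powr (1 - b - 1) * (1 - t) powr (b - 1)) has_integral Beta (1 - b) b) {0..1}"
    by (rule has_integral_Beta_real) (use b in auto)
  from nn_integral_has_integral_lebesgue[OF _ this]
  have "(\<integral>\<^sup>+t. ennreal (indicator {0..1} t * (t powr (- b) * (1 - t) powr (b - 1))) \<partial>lborel) = ennreal (Beta (1 - b) b)"
    by simp
  also have "Beta (1 - b) b = Gamma b * Gamma (1 - b)" by (simp add: Beta_def)
  \<comment> \<open>At both end points one of the powers is \<open>0 powr _\<close>, that is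
    \<open>0\<close>, so the closed and the open interval give the same integrand.\<close>
  also have "(\<integral>\<^sup>+t. ennreal (indicator {0..1} t * (t powr (- b) * (1 - t) powr (b - 1))) \<partial>lborel)
      = (\<integral>\<^sup>+t. ennreal (indicator {0<..<1} t * (t powr (- b) * (1 - t) powr (b - 1))) \<partial>lborel)"
  proof (intro nn_integral_cong arg_cong[where f=ennreal])
    fix t :: real
    show "indicator {0..1} t * (t powr (- b) * (1 - t) powr (b - 1)) = indicator {0<..<1} t * (t powr (- b) * (1 - t) powr (b - 1))"
      by (cases "t = 0"; cases "t = 1") (auto split: split_indicator)
  qed
  finally show "(\<integral>\<^sup>+t. ennreal (indicator {0<..<1} t * (t powr (- b) * (1 - t) powr (b - 1))) \<partial>lborel) = ennreal (Gamma b * Gamma (1 - b))" .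
qed (use b in \<open>auto intro!: AE_I2 mult_nonneg_nonneg less_imp_le[OF Gamma_real_pos]\<close>)

text \<open>The substitution r = p (1 - t) reduces to the Beta integral; the powers of p cancel
  because the exponents b - 1 and -b add up to -1. Independence of p says that fractional integrals
  of orders b and 1 - b compose to ordinary integration.\<close>

lemma powr_convolution:
  fixes b p :: real
  assumes b: "0 < b" "b < 1" and p: "p > 0"
  shows "has_bochner_integral lborel (\<lambda>r. indicator {0<..<p} r * (r powr (b - 1) * (p - r) powr (- b))) (Gamma b * Gamma (1 - b))"
proof -
  let ?g = "\<lambda>t::real. p * (1 - t)" and ?f = "\<lambda>r::real. r powr (b - 1) * (p - r) powr (- b)"
  have der: "(?g has_real_derivative (- p)) (at t)" for t
    by (rule derivative_eq_intros refl | simp)+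
  have inj: "inj_on ?g {0<..<1}" using p by (auto simp: inj_on_def)
  have img: "?g ` {0<..<1} = {0<..<p}"
  proof -
    have "y \<in> ?g ` {0<..<1}" if "0 < y" "y < p" for y
      by (rule image_eqI[of _ _ "1 - y / p"]) (use that p in auto)
    thus ?thesis using p by auto
  qed
  have "(\<lambda>t. indicator {0<..<1} t * (t powr (- b) * (1 - t) powr (b - 1))) = (\<lambda>t. indicator {0<..<1} t * (\<bar>- p\<bar> * ?f (?g t)))"
  proof
    fix t :: real
    have "p * ((p * (1 - t)) powr (b - 1) * (p - p * (1 - t)) powr (- b)) = t powr (- b) * (1 - t) powr (b - 1)" if "0 < t" "t < 1"
    proof -
      have "p - p * (1 - t) = p * t" by (simp add: algebra_simps)
      hence "p * ((p * (1 - t)) powr (b - 1) * (p - p * (1 - t)) powr (- b)) = (p * (p powr (b - 1) * p powr (- b))) * (t powr (- b) * (1 - t) powr (b - 1))"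
        using that p by (simp add: powr_mult)
      also have "p * (p powr (b - 1) * p powr (- b)) = 1" using p by (simp add: powr_diff powr_minus)
      finally show ?thesis by simp
    qed
    thus "indicator {0<..<1} t * (t powr (- b) * (1 - t) powr (b - 1)) = indicator {0<..<1} t * (\<bar>- p\<bar> * ?f (?g t))"
      using p by (auto split: split_indicator)
  qed
  with has_bochner_integral_Beta[OF b]
  have "has_bochner_integral lborel (\<lambda>t. indicator {0<..<1} t * (\<bar>- p\<bar> * ?f (?g t))) (Gamma b * Gamma (1 - b))"
    by (simp only:)
  from has_bochner_integral_substitution[where f="?f" and S="{0<..<1}" and g="?g", OF _ der inj img, THEN iffD1, OF _ _ _ _ this]
  show ?thesis by simp
qed

text \<open>The Moebius substitution \<open>v = t x a / (x + t - t a)\<close> reduces this to the Beta integral.\<close>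

lemma powr_convolution_pole:
  fixes b t x :: real
  assumes b: "0 < b" "b < 1" and t: "t > 0" and x: "x > 0"
  shows "has_bochner_integral lborel (\<lambda>v. indicator {0<..<t} v * ((t - v) powr (b - 1) * (v powr (- b) * x powr b / (x + v))))
     (Gamma b * Gamma (1 - b) * (x + t) powr (b - 1))"
proof -
  let ?D = "\<lambda>a::real. x + t - t * a"
  let ?g = "\<lambda>a::real. t * x * a / ?D a" and ?g' = "\<lambda>a::real. t * x * (x + t) / (?D a)\<^sup>2"
  let ?f = "\<lambda>v::real. (t - v) powr (b - 1) * (v powr (- b) * x powr b / (x + v))"
  have D: "?D a > 0" if "a < 1" for a
  proof -
    have "t * a < t * 1" using that t by (intro mult_strict_left_mono) auto
    thus ?thesis using x by simp
  qed
  have der: "(?g has_real_derivative (?g' a)) (at a)" if "a \<in> {0<..<1}" for a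
    using D[of a] that by (auto intro!: derivative_eq_intros simp: field_simps power2_eq_square)
  have tg: "t - ?g a = t * (x + t) * (1 - a) / ?D a" and xg: "x + ?g a = x * (x + t) / ?D a" if "a < 1" for a
    using D[OF that] by (simp_all add: field_simps)
  have inj: "inj_on ?g {0<..<1}"
  proof (rule inj_onI)
    fix a c :: real assume ac: "a \<in> {0<..<1}" "c \<in> {0<..<1}" and eq: "?g a = ?g c"
    have xa: "x + ?g a = x * (x + t) / ?D a" using xg[of a] ac by auto
    have xc: "x + ?g c = x * (x + t) / ?D c" using xg[of c] ac by auto
    have "x * (x + t) / ?D a = x * (x + t) / ?D c"
      using xa[unfolded eq xc] by (rule sym)
    moreover have "x * (x + t) \<noteq> 0" using x t by auto
    ultimately have "?D a = ?D c" by (simp only: divide_cancel_left) simp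
    thus "a = c" using t by simp
  qed
  have img: "?g ` {0<..<1} = {0<..<t}"
  proof (intro equalityI subsetI)
    fix v assume "v \<in> ?g ` {0<..<1}"
    then obtain a where a: "0 < a" "a < 1" "v = ?g a" by auto
    have "?g a > 0" using a D[of a] t x by simp
    moreover have "t - ?g a > 0" using a D[of a] t x by (subst tg) auto
    ultimately show "v \<in> {0<..<t}" using a by simp
  next
    fix v assume v: "v \<in> {0<..<t}"
    \<comment> \<open>The inverse of the Moebius map, obtained by solving v (x + t - t a) = t x a
      for a.\<close>
    let ?a = "v * (x + t) / (t * (x + v))"
    have a0: "?a > 0" using v x t by simp
    have "v * x + v * t < t * x + t * v" using v x by (simp add: mult.commute mult_strict_right_mono)
    hence a1: "?a < 1" using v x t by (subst divide_less_eq_1_pos) (auto simp: algebra_simps intro!: add_pos_pos)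
    have va: "v = ?g ?a"
    proof -
      have nz: "x + v \<noteq> 0" "x + t \<noteq> 0" using v x t by auto
      have ta: "t * ?a = v * (x + t) / (x + v)" using t by simp
      have "(x + t) - v * (x + t) / (x + v) = x * (x + t) / (x + v)"
        using nz(1) by (simp add: field_simps)
      hence D': "?D ?a = x * (x + t) / (x + v)" unfolding ta .
      have N': "t * x * ?a = x * (v * (x + t) / (x + v))" using t by simp
      have "?g ?a = x * (v * (x + t) / (x + v)) / (x * (x + t) / (x + v))" by (simp only: D' N')
      thus ?thesis using nz x by simp
    qed
    show "v \<in> ?g ` {0<..<1}" by (rule image_eqI[where f="?g", OF va]) (simp only: greaterThanLessThan_iff a0 a1)
  qed
  have "(\<lambda>a. (x + t) powr (b - 1) * (indicator {0<..<1} a * (a powr (- b) * (1 - a) powr (b - 1)))) = (\<lambda>a. indicator {0<..<1} a * (\<bar>?g' a\<bar> * ?f (?g a)))"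
  proof
    fix a :: real
    have "?g' a * ?f (?g a) = (x + t) powr (b - 1) * (a powr (- b) * (1 - a) powr (b - 1))" if a: "0 < a" "a < 1"
    proof -
      let ?d = "?D a"
      have d: "?d > 0" using D a by simp
      have e0: "t - ?g a = t * (x + t) * (1 - a) / ?d" "x + ?g a = x * (x + t) / ?d"
        using tg[of a] xg[of a] a by auto
      have e1: "(t * (x + t) * (1 - a) / ?d) powr (b - 1) = (t powr b / t) * (x + t) powr (b - 1) * (1 - a) powr (b - 1) * (?d / ?d powr b)"
        using d t x a by (simp add: powr_mult powr_divide powr_diff)
      have e2: "(t * x * a / ?d) powr (- b) = ?d powr b / (t powr b * x powr b) * a powr (- b)"
        using d t x a by (simp add: powr_mult powr_divide powr_minus field_simps)
      \<comment> \<open>The powers are abstracted to nonzero reals. Powers of \<open>?D a\<close>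
        occur with exponents 1 - b, b and 1, which leaves the square that the derivative
        \<open>?g' a\<close> cancels.\<close>
      have alg: "P / t * C * A * (d / R) * (R / (P * Q) * F * Q / (x * y / d)) = C * (F * A) * (d\<^sup>2 / (t * x * y))"
        if "P \<noteq> 0" "Q \<noteq> 0" "R \<noteq> 0" "t \<noteq> 0" "d \<noteq> 0" "x \<noteq> 0" "y \<noteq> 0" for P Q R A C F t d x y :: real
        using that by (simp add: field_simps power2_eq_square)
      have "?f (?g a) = (x + t) powr (b - 1) * (a powr (- b) * (1 - a) powr (b - 1)) * (?d\<^sup>2 / (t * x * (x + t)))"
        unfolding e0 e1 e2 by (rule alg) (use d t x in auto)
      thus ?thesis using d t x by simp
    qed
    thus "(x + t) powr (b - 1) * (indicator {0<..<1} a * (a powr (- b) * (1 - a) powr (b - 1))) = indicator {0<..<1} a * (\<bar>?g' a\<bar> * ?f (?g a))"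
      using t x D by (auto split: split_indicator)
  qed
  with has_bochner_integral_mult_right[OF has_bochner_integral_Beta[OF b], of "(x + t) powr (b - 1)"]
  have "has_bochner_integral lborel (\<lambda>a. indicator {0<..<1} a * (\<bar>?g' a\<bar> * ?f (?g a))) ((x + t) powr (b - 1) * (Gamma b * Gamma (1 - b)))"
    by (simp only:)
  from has_bochner_integral_substitution[where f="?f" and S="{0<..<1}" and g="?g", OF _ der inj img, THEN iffD1, OF _ _ _ _ _ this]
  show ?thesis by (simp add: mult.commute)
qed

section \<open>The tangential transform of the kernel\<close>

text \<open>The Fourier transform of the Poisson kernel in the tangential variables, up to a phase:
  \<open>x\<close> is the height of the starting point, \<open>v\<close> the depth of the end point
  below the hyperplane, \<open>b\<close> is \<alpha>/2 and \<open>w\<close> the square root of |z|^2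
  + m^(2/\<alpha>) at tangential frequency z.\<close>

definition poisson_profile :: "real \<Rightarrow> real \<Rightarrow> real \<Rightarrow> real \<Rightarrow> real" where
  "poisson_profile b w x v = indicator {0<..} v * (sin (pi * b) / pi * (x / v) powr b * (exp (- w * (x + v)) / (x + v)))"

lemma measurable_poisson_profile [measurable]: "poisson_profile b w x \<in> borel_measurable borel"
  unfolding poisson_profile_def by measurable

lemma poisson_profile_nonneg: "0 < b \<Longrightarrow> b < 1 \<Longrightarrow> x > 0 \<Longrightarrow> poisson_profile b w x v \<ge> 0"
  unfolding poisson_profile_def by (auto split: split_indicator intro!: mult_nonneg_nonneg divide_nonneg_nonneg sin_ge_zero)

text \<open>For fixed x > 0 the factor 1/(x + v) is at most 1/x, which leaves v^(-b) exp(-w v); the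
  singularity at 0 is integrable since b < 1.\<close>

lemma integrable_poisson_profile:
  assumes b: "0 < b" "b < 1" and w: "w > 0" and x: "x > 0"
  shows "integrable lborel (poisson_profile b w x)"
proof -
  have "integrable lborel (\<lambda>v. (x powr b / x) * (indicator {0<..} v * v powr ((1 - b) - 1) * exp (- w * v)))"
    using gamma_integral_scaled[of "1 - b" w] b w by (intro integrable_mult_right) (auto intro: integrable.intros)
  thus ?thesis
  proof (rule Bochner_Integration.integrable_bound)
    show "AE v in lborel. norm (poisson_profile b w x v) \<le> norm ((x powr b / x) * (indicator {0<..} v * v powr ((1 - b) - 1) * exp (- w * v)))"
    proof (rule AE_I2)
      fix v :: real
      have "sin (pi * b) / pi * (x / v) powr b * (exp (- w * (x + v)) / (x + v)) \<le> (x powr b / x) * (v powr (- b) * exp (- w * v))" if "v > 0"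
      proof -
        have "sin (pi * b) / pi \<le> 1"
        proof -
          have "sin (pi * b) \<le> pi" using sin_le_one[of "pi * b"] pi_gt3 by linarith
          thus ?thesis by simp
        qed
        hence "sin (pi * b) / pi * (x / v) powr b \<le> 1 * (x / v) powr b" by (intro mult_right_mono) auto
        also have "\<dots> = x powr b * v powr (- b)" using that x by (simp add: powr_divide powr_minus_divide)
        finally have 1: "sin (pi * b) / pi * (x / v) powr b \<le> x powr b * v powr (- b)" .
        have 2: "exp (- w * (x + v)) / (x + v) \<le> exp (- w * v) / x"
          using that x w by (intro frac_le) auto
        have "sin (pi * b) / pi * (x / v) powr b * (exp (- w * (x + v)) / (x + v)) \<le> (x powr b * v powr (- b)) * (exp (- w * v) / x)"
          by (rule mult_mono[OF 1 2]) (use that x in auto)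
        thus ?thesis by simp
      qed
      thus "norm (poisson_profile b w x v) \<le> norm ((x powr b / x) * (indicator {0<..} v * v powr ((1 - b) - 1) * exp (- w * v)))"
        using poisson_profile_nonneg[OF b x, of w v] x unfolding poisson_profile_def by (auto split: split_indicator)
    qed
  qed measurable
qed

text \<open>In the language of fluctuation theory: convolving the profile with the descending ladder potential gives the
  overshoot part of that potential.\<close>

lemma laplace_poisson_profile:
  fixes \<mu> :: complex
  assumes b: "0 < b" "b < 1" and w: "w > 0" and x: "x > 0" and l: "Re \<mu> \<ge> 0"
  shows "laplace_powr b (w + \<mu>) * (LINT v|lborel. of_real (poisson_profile b w x v) * exp (- \<mu> * of_real v))
    = exp (\<mu> * x) * (LINT s|lborel. of_real (indicator {x<..} s * s powr (b - 1)) * exp (- (w + \<mu>) * of_real s))"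
proof -
  let ?f = "\<lambda>r. complex_of_real (indicator {0<..} r * r powr (b - 1)) * exp (- (w + \<mu>) * of_real r)"
  let ?h = "\<lambda>v. complex_of_real (poisson_profile b w x v) * exp (- \<mu> * of_real v)"
  have f: "integrable lborel ?f" by (rule integrable_laplace_powr) (use b w l in auto)
  have h: "integrable lborel ?h"
  proof (rule Bochner_Integration.integrable_bound[OF integrable_poisson_profile[OF b w x]])
    show "AE v in lborel. norm (?h v) \<le> norm (poisson_profile b w x v)"
    proof (rule AE_I2)
      fix v :: real
      show "norm (?h v) \<le> norm (poisson_profile b w x v)"
      proof (cases "v > 0")
        case True
        hence "norm (exp (- \<mu> * complex_of_real v)) \<le> 1" using l by simp
        thus ?thesis unfolding norm_mult norm_of_real real_norm_def by (intro mult_left_le) auto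
      qed (simp add: poisson_profile_def)
    qed
  qed measurable
  \<comment> \<open>With the constant test function 1, a product of two transforms becomes the
    integral of a convolution, which is then computed pointwise.\<close>
  have "laplace_powr b (w + \<mu>) * (LINT v|lborel. ?h v) = (LINT r|lborel. ?f r * (LINT q|lborel. ?h q * 1))"
    unfolding laplace_powr_def by simp
  also have "\<dots> = (LINT p|lborel. 1 * (LINT r|lborel. ?f r * ?h (p - r)))"
    by (rule integral_convolution[OF f h, where B=1]) auto
  also have "\<dots> = (LINT p|lborel. of_real (indicator {0<..} p * (x + p) powr (b - 1)) * exp (- w * (x + p) - \<mu> * of_real p))"
  proof (intro Bochner_Integration.integral_cong refl)
    fix p :: real
    show "1 * (LINT r|lborel. ?f r * ?h (p - r)) = of_real (indicator {0<..} p * (x + p) powr (b - 1)) * exp (- w * (x + p) - \<mu> * of_real p)"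
    proof (cases "p > 0")
      case False
      hence zero: "?f r * ?h (p - r) = 0" for r by (cases "r > 0") (auto simp: poisson_profile_def)
      show ?thesis unfolding zero using False by simp
    next
      case True
      let ?g = "\<lambda>v. indicator {0<..<p} v * ((p - v) powr (b - 1) * (v powr (- b) * x powr b / (x + v)))"
      have "?f r * ?h (p - r) = exp (- w * (x + p) - \<mu> * of_real p) * of_real (sin (pi * b) / pi * ?g (p - r))" for r
      proof (cases "0 < r \<and> r < p")
        case r: True
        \<comment> \<open>The combined exponent does not depend on r, so it leaves the convolution
          integral, and only powers and the pole at -x remain.\<close>
        have e: "exp (- (w + \<mu>) * of_real r) * (of_real (exp (- w * (x + (p - r)))) * exp (- \<mu> * of_real (p - r))) = exp (- w * (x + p) - \<mu> * of_real p)"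
          unfolding exp_of_real[symmetric] exp_add[symmetric] by (rule arg_cong[where f=exp]) (simp add: algebra_simps)
        have "?f r * ?h (p - r) = of_real (sin (pi * b) / pi * (r powr (b - 1) * ((x / (p - r)) powr b / (x + (p - r))))) *
           (exp (- (w + \<mu>) * of_real r) * (of_real (exp (- w * (x + (p - r)))) * exp (- \<mu> * of_real (p - r))))"
          using r by (simp add: poisson_profile_def)
        also have "(x / (p - r)) powr b = (p - r) powr (- b) * x powr b"
          using r x by (simp add: powr_divide powr_minus_divide)
        finally show ?thesis unfolding e using r by (simp add: mult_ac)
      next
        case False
        thus ?thesis by (auto simp: poisson_profile_def split: split_indicator)
      qed
      hence "(LINT r|lborel. ?f r * ?h (p - r)) = exp (- w * (x + p) - \<mu> * of_real p) * of_real (sin (pi * b) / pi * (LINT r|lborel. ?g (p - r)))"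
        by (simp only: integral_mult_right_zero integral_complex_of_real)
      also have "(LINT r|lborel. ?g (p - r)) = (LINT v|lborel. ?g v)"
        using lborel_integral_real_affine[of "-1" ?g p] by simp
      also have "\<dots> = Gamma b * Gamma (1 - b) * (x + p) powr (b - 1)"
        by (rule has_bochner_integral_integral_eq[OF powr_convolution_pole[OF b True x]])
      \<comment> \<open>The normalisation of the profile cancels the Beta constant by the reflection
        formula.\<close>
      also have "sin (pi * b) / pi * (Gamma b * Gamma (1 - b) * (x + p) powr (b - 1)) = (x + p) powr (b - 1)"
      proof -
        have "sin (pi * b) > 0" using b by (intro sin_gt_zero) auto
        thus ?thesis unfolding Gamma_reflection_real by simp
      qed
      finally show ?thesis using True by simp
    qed
  qed
  also have "\<dots> = (LINT p|lborel. exp (\<mu> * x) * (of_real (indicator {x<..} (x + 1 * p) * (x + 1 * p) powr (b - 1)) * exp (- (w + \<mu>) * of_real (x + 1 * p))))"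
  proof (intro Bochner_Integration.integral_cong refl)
    fix p :: real
    have "exp (- w * (x + p) - \<mu> * of_real p) = exp (\<mu> * x) * exp (- (w + \<mu>) * of_real (x + 1 * p))"
      unfolding exp_add[symmetric] by (rule arg_cong[where f=exp]) (simp add: algebra_simps)
    thus "of_real (indicator {0<..} p * (x + p) powr (b - 1)) * exp (- w * (x + p) - \<mu> * of_real p)
       = exp (\<mu> * x) * (of_real (indicator {x<..} (x + 1 * p) * (x + 1 * p) powr (b - 1)) * exp (- (w + \<mu>) * of_real (x + 1 * p)))"
      by (auto split: split_indicator)
  qed
  also have "\<dots> = exp (\<mu> * x) * (LINT s|lborel. of_real (indicator {x<..} s * s powr (b - 1)) * exp (- (w + \<mu>) * of_real s))"
    unfolding integral_mult_right_zero
    using lborel_integral_real_affine[of 1 "\<lambda>s. of_real (indicator {x<..} s * s powr (b - 1)) * exp (- (w + \<mu>) * of_real s)" x] by simp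
  finally show ?thesis .
qed

text \<open>Multiplying both kernels by exp(-w _) is compatible with convolution, so the orders b
  and 1 - b still add up to one. Applied to \<open>wh_test\<close>, the upward gamma kernel thus
  leaves an elementary integral.\<close>

lemma powr_semigroup_integral:
  fixes H :: "real \<Rightarrow> complex"
  assumes b: "0 < b" "b < 1" and w: "w > 0" and [measurable]: "H \<in> borel_measurable borel" and B: "\<And>x. norm (H x) \<le> B"
  shows "(LINT r|lborel. of_real (indicator {0<..} r * r powr (b - 1) * exp (- w * r)) *
      (LINT q|lborel. of_real (indicator {0<..} q * q powr (- b) * exp (- w * q)) * H (u + (r + q))))
    = of_real (Gamma b * Gamma (1 - b)) * (LINT p|lborel. of_real (indicator {0<..} p * exp (- w * p)) * H (u + p))"
proof -
  let ?f = "\<lambda>r. complex_of_real (indicator {0<..} r * r powr (b - 1) * exp (- w * r))"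
  let ?h = "\<lambda>q. complex_of_real (indicator {0<..} q * q powr (- b) * exp (- w * q))"
  have f: "integrable lborel ?f" and h: "integrable lborel ?h"
    using gamma_integral_scaled[OF b(1) w] gamma_integral_scaled[of "1 - b" w] b w
    by (auto intro!: integrable_of_real simp del: of_real_mult intro: integrable.intros)
  have "(LINT r|lborel. ?f r * (LINT q|lborel. ?h q * H (u + (r + q)))) = (LINT p|lborel. H (u + p) * (LINT r|lborel. ?f r * ?h (p - r)))"
    by (rule integral_convolution[OF f h, where B=B]) (use B in auto)
  also have "\<dots> = (LINT p|lborel. of_real (Gamma b * Gamma (1 - b)) * (of_real (indicator {0<..} p * exp (- w * p)) * H (u + p)))"
  proof (intro Bochner_Integration.integral_cong refl)
    fix p :: real
    have eq: "?f r * ?h (p - r) = of_real (exp (- w * p) * (indicator {0<..<p} r * (r powr (b - 1) * (p - r) powr (- b))))" for r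
    proof (cases "0 < r \<and> r < p")
      case True
      have "exp (- w * r) * exp (- w * (p - r)) = exp (- w * p)" by (simp add: exp_add[symmetric] algebra_simps)
      with True show ?thesis by (simp add: mult_ac flip: of_real_mult)
    qed (auto split: split_indicator)
    have "(LINT r|lborel. ?f r * ?h (p - r)) = of_real (indicator {0<..} p * exp (- w * p) * (Gamma b * Gamma (1 - b)))"
    proof (cases "p > 0")
      case True
      show ?thesis unfolding eq integral_complex_of_real integral_mult_right_zero
        has_bochner_integral_integral_eq[OF powr_convolution[OF b True]] using True by simp
    qed (unfold eq, simp)
    thus "H (u + p) * (LINT r|lborel. ?f r * ?h (p - r)) = of_real (Gamma b * Gamma (1 - b)) * (of_real (indicator {0<..} p * exp (- w * p)) * H (u + p))"
      by (simp add: mult_ac)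
  qed
  finally show ?thesis by simp
qed

section \<open>Levy processes with right-continuous paths\<close>

text \<open>The left end point of the mesh cell that contains \<open>t\<close>. Limits use the right
  end point \<open>grid h t + h\<close>, because paths are continuous only from the right.\<close>

definition grid :: "real \<Rightarrow> real \<Rightarrow> real" where
  "grid h t = real_of_int \<lfloor>t / h\<rfloor> * h"

lemma grid_bounds: "h > 0 \<Longrightarrow> grid h t \<le> t \<and> t < grid h t + h"
  using floor_divide_lower[of h t] floor_divide_upper[of h t] unfolding grid_def by (simp add: algebra_simps)

lemma measurable_grid [measurable]: "grid h \<in> borel_measurable borel"
  unfolding grid_def by measurable

lemma grid_upper_ge: "t \<le> grid (1 / real (Suc n)) t + 1 / real (Suc n)"
  using grid_bounds[of "1 / real (Suc n)" t] by simp

lemma grid_upper_tendsto: "(\<lambda>n. grid (1 / real (Suc n)) t + 1 / real (Suc n)) \<longlonglongrightarrow> t"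
proof (rule tendsto_sandwich)
  show "\<forall>\<^sub>F n in sequentially. t \<le> grid (1 / real (Suc n)) t + 1 / real (Suc n)"
    using grid_upper_ge by auto
  have "grid (1 / real (Suc n)) t + 1 / real (Suc n) \<le> t + 1 / real (Suc n)" for n
    using grid_bounds[of "1 / real (Suc n)" t] by simp
  thus "\<forall>\<^sub>F n in sequentially. grid (1 / real (Suc n)) t + 1 / real (Suc n) \<le> t + 1 / real (Suc n)"
    by auto
  show "(\<lambda>n. t + 1 / real (Suc n)) \<longlonglongrightarrow> t"
    using tendsto_add[OF tendsto_const[of t] LIMSEQ_inverse_real_of_nat] by (simp add: inverse_eq_divide)
qed simp

text \<open>Paths are extended by \<open>0\<close> to negative times, so that they are right-continuous at all real times.\<close>

locale regular_levy = prob_space M for M :: "'w measure" +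
  fixes Z :: "real \<Rightarrow> 'w \<Rightarrow> 'a :: euclidean_space"
  assumes levy: "levy_process M Z"
    and Z_meas [measurable]: "\<And>t. Z t \<in> borel_measurable M"
    and Z_nonpos: "\<And>t \<omega>. t \<le> 0 \<Longrightarrow> Z t \<omega> = 0"
    and Z_right: "\<And>t \<omega>. ((\<lambda>s. Z s \<omega>) \<longlongrightarrow> Z t \<omega>) (at_right t)"
begin

lemma Z_tendsto:
  assumes "\<And>n. s n \<ge> t" "s \<longlonglongrightarrow> t"
  shows "(\<lambda>n. Z (s n) \<omega>) \<longlonglongrightarrow> Z t \<omega>"
proof -
  have "continuous (at t within {t..}) (\<lambda>s. Z s \<omega>)"
    using Z_right[of \<omega> t] unfolding continuous_within at_within_Ici_at_right by simp
  thus ?thesis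
    unfolding continuous_within_sequentially using assms by (auto simp: comp_def)
qed

lemma Z_grid_tendsto: "(\<lambda>n. Z (grid (1 / real (Suc n)) t + 1 / real (Suc n)) \<omega>) \<longlonglongrightarrow> Z t \<omega>"
  by (rule Z_tendsto[OF grid_upper_ge grid_upper_tendsto])

text \<open>Only countably many time points occur, so measurability at fixed times suffices. Joint
  measurability of the process follows by letting the right end points of the cells decrease to
  \<open>t\<close>.\<close>

lemma measurable_Z_grid [measurable]: "(\<lambda>(t, \<omega>). Z (grid h t + c) \<omega>) \<in> borel_measurable (borel \<Otimes>\<^sub>M M)"
proof -
  have "(\<lambda>p. Z (real_of_int i * h + c) (snd p)) \<in> borel_measurable (borel \<Otimes>\<^sub>M M)" for i
    by measurable
  moreover have "(\<lambda>p. \<lfloor>fst p / h\<rfloor>) \<in> measurable (borel \<Otimes>\<^sub>M M) (count_space UNIV)"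
    by measurable
  ultimately have "(\<lambda>p. Z (real_of_int \<lfloor>fst p / h\<rfloor> * h + c) (snd p)) \<in> borel_measurable (borel \<Otimes>\<^sub>M M)"
    by (rule measurable_compose_countable)
  thus ?thesis by (simp add: grid_def split_beta')
qed

lemma measurable_Z_pair [measurable]: "(\<lambda>(t, \<omega>). Z t \<omega>) \<in> borel_measurable (borel \<Otimes>\<^sub>M M)"
proof (rule borel_measurable_LIMSEQ_metric)
  show "(\<lambda>p. case p of (t, \<omega>) \<Rightarrow> Z (grid (1 / real (Suc n)) t + 1 / real (Suc n)) \<omega>) \<in> borel_measurable (borel \<Otimes>\<^sub>M M)" for n
    by measurable
  show "(\<lambda>n. case p of (t, \<omega>) \<Rightarrow> Z (grid (1 / real (Suc n)) t + 1 / real (Suc n)) \<omega>) \<longlonglongrightarrow> (case p of (t, \<omega>) \<Rightarrow> Z t \<omega>)" for p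
    using Z_grid_tendsto by (auto split: prod.split)
qed

abbreviation law :: "real \<Rightarrow> 'a measure" where "law t \<equiv> distr M borel (Z t)"

section \<open>The Markov property at grid times\<close>

text \<open>The first \<open>k\<close> mesh increments carry the history of the walk up to time
  \<open>k h\<close>. The history and the next \<open>Suc j\<close> steps, taken as one increment,
  form an independent pair, and stationarity replaces the long increment by an independent copy of
  \<open>Z (Suc j * h)\<close>.\<close>

lemma increments_indep:
  fixes k j :: nat and G :: "(nat \<Rightarrow> 'a) \<times> 'a \<Rightarrow> complex"
  assumes h: "h > 0" and G [measurable]: "G \<in> borel_measurable (PiM {..<k} (\<lambda>_. borel) \<Otimes>\<^sub>M borel)"
    and B: "\<And>p. norm (G p) \<le> B"
  defines "D \<equiv> \<lambda>\<omega>. \<lambda>i\<in>{..<k}. Z (real (Suc i) * h) \<omega> - Z (real i * h) \<omega>"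
  shows "(LINT \<omega>|M. G (D \<omega>, Z (real (k + Suc j) * h) \<omega> - Z (real k * h) \<omega>))
       = (LINT \<omega>|M. LINT \<omega>'|M. G (D \<omega>, Z (real (Suc j) * h) \<omega>'))"
proof -
  \<comment> \<open>\<open>k\<close> mesh steps followed by a single long one. The form
    \<open>Suc j\<close> keeps the times strictly increasing, as the independence clause of
    \<open>levy_process\<close> demands.\<close>
  define t where "t i = (if i \<le> k then real i * h else real (k + Suc j) * h)" for i
  define X where "X i \<omega> = Z (t (Suc i)) \<omega> - Z (t i) \<omega>" for i \<omega>
  have "0 \<le> t 0 \<and> (\<forall>i<Suc k. t i < t (Suc i))" using h by (auto simp: t_def)
  hence ind: "indep_vars (\<lambda>_. borel) X {..<Suc k}"
    using levy unfolding levy_process_def X_def by blast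
  have "indep_var (PiM {..<k} (\<lambda>_. borel)) (\<lambda>\<omega>. restrict (\<lambda>i. X i \<omega>) {..<k}) (PiM {k} (\<lambda>_. borel)) (\<lambda>\<omega>. restrict (\<lambda>i. X i \<omega>) {k})"
    by (rule indep_var_restrict[OF ind]) auto
  moreover have restr: "(\<lambda>\<omega>. restrict (\<lambda>i. X i \<omega>) {..<k}) = D"
    by (auto simp: D_def X_def t_def fun_eq_iff)
  ultimately have iv: "indep_var (PiM {..<k} (\<lambda>_. borel)) D (PiM {k} (\<lambda>_. borel)) (\<lambda>\<omega>. restrict (\<lambda>i. X i \<omega>) {k})"
    by (simp only:)
  let ?R = "\<lambda>\<omega>. restrict (\<lambda>i. X i \<omega>) {k}"
  have D [measurable]: "D \<in> M \<rightarrow>\<^sub>M PiM {..<k} (\<lambda>_. borel)" and R [measurable]: "?R \<in> M \<rightarrow>\<^sub>M PiM {k} (\<lambda>_. borel)"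
    using iv by (auto dest: indep_var_rv1 indep_var_rv2)
  have Xk_eq: "X k = (\<lambda>\<omega>. Z (real (k + Suc j) * h) \<omega> - Z (real k * h) \<omega>)"
    by (auto simp: X_def t_def)
  have Xk [measurable]: "X k \<in> borel_measurable M" unfolding Xk_eq by measurable
  have "distr M borel (\<lambda>\<omega>. Z (real k * h + real (Suc j) * h) \<omega> - Z (real k * h) \<omega>) = law (real (Suc j) * h)"
    using levy h unfolding levy_process_def by auto
  hence distr_X: "distr M borel (X k) = law (real (Suc j) * h)"
    unfolding Xk_eq by (simp add: algebra_simps)
  interpret D: prob_space "distr M (PiM {..<k} (\<lambda>_. borel)) D" by (rule prob_space_distr) simp
  interpret R: prob_space "distr M (PiM {k} (\<lambda>_. borel)) ?R" by (rule prob_space_distr) simp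
  interpret P: pair_prob_space "distr M (PiM {..<k} (\<lambda>_. borel)) D" "distr M (PiM {k} (\<lambda>_. borel)) ?R" ..
  let ?G = "\<lambda>p. G (fst p, snd p k)"
  have [measurable]: "(\<lambda>u. u k) \<in> borel_measurable (PiM {k} (\<lambda>_. borel))"
    by (rule measurable_component_singleton) simp
  have G' [measurable]: "?G \<in> borel_measurable (PiM {..<k} (\<lambda>_. borel) \<Otimes>\<^sub>M PiM {k} (\<lambda>_. borel))" by measurable
  have "(LINT \<omega>|M. G (D \<omega>, X k \<omega>)) = (LINT p|distr M (PiM {..<k} (\<lambda>_. borel) \<Otimes>\<^sub>M PiM {k} (\<lambda>_. borel)) (\<lambda>\<omega>. (D \<omega>, ?R \<omega>)). ?G p)"
    by (subst integral_distr) auto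
  also have "distr M (PiM {..<k} (\<lambda>_. borel) \<Otimes>\<^sub>M PiM {k} (\<lambda>_. borel)) (\<lambda>\<omega>. (D \<omega>, ?R \<omega>))
      = distr M (PiM {..<k} (\<lambda>_. borel)) D \<Otimes>\<^sub>M distr M (PiM {k} (\<lambda>_. borel)) ?R"
    using iv unfolding indep_var_distribution_eq by auto
  also have "(LINT p|(distr M (PiM {..<k} (\<lambda>_. borel)) D \<Otimes>\<^sub>M distr M (PiM {k} (\<lambda>_. borel)) ?R). ?G p)
     = (LINT v|distr M (PiM {..<k} (\<lambda>_. borel)) D. LINT u|distr M (PiM {k} (\<lambda>_. borel)) ?R. ?G (v, u))"
  proof (rule P.integral_fst'[symmetric])
    show "integrable (distr M (PiM {..<k} (\<lambda>_. borel)) D \<Otimes>\<^sub>M distr M (PiM {k} (\<lambda>_. borel)) ?R) ?G"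
      by (rule P.integrable_const_bound[where B=B]) (use B in \<open>auto simp: split_beta'\<close>)
  qed
  also have "\<dots> = (LINT \<omega>|M. LINT u|distr M (PiM {k} (\<lambda>_. borel)) ?R. ?G (D \<omega>, u))"
    by (subst integral_distr) auto
  also have "\<dots> = (LINT \<omega>|M. LINT d|law (real (Suc j) * h). G (D \<omega>, d))"
  proof (intro Bochner_Integration.integral_cong refl)
    fix \<omega> assume w: "\<omega> \<in> space M"
    have [measurable]: "D \<omega> \<in> space (PiM {..<k} (\<lambda>_. borel))" by (rule measurable_space[OF D w])
    have "(LINT u|distr M (PiM {k} (\<lambda>_. borel)) ?R. ?G (D \<omega>, u)) = (LINT \<omega>'|M. G (D \<omega>, X k \<omega>'))"
      by (subst integral_distr) auto
    also have "\<dots> = (LINT d|distr M borel (X k). G (D \<omega>, d))"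
      by (subst integral_distr) auto
    finally show "(LINT u|distr M (PiM {k} (\<lambda>_. borel)) ?R. ?G (D \<omega>, u)) = (LINT d|law (real (Suc j) * h). G (D \<omega>, d))"
      unfolding distr_X .
  qed
  also have "\<dots> = (LINT \<omega>|M. LINT \<omega>'|M. G (D \<omega>, Z (real (Suc j) * h) \<omega>'))"
  proof (intro Bochner_Integration.integral_cong refl)
    fix \<omega> assume w: "\<omega> \<in> space M"
    have [measurable]: "D \<omega> \<in> space (PiM {..<k} (\<lambda>_. borel))" by (rule measurable_space[OF D w])
    show "(LINT d|law (real (Suc j) * h). G (D \<omega>, d)) = (LINT \<omega>'|M. G (D \<omega>, Z (real (Suc j) * h) \<omega>'))"
      by (subst integral_distr) auto
  qed
  finally show ?thesis unfolding Xk_eq .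
qed

definition transition :: "real \<Rightarrow> ('a \<Rightarrow> complex) \<Rightarrow> 'a \<Rightarrow> complex" where
  "transition t f y = (LINT \<omega>|M. f (y + Z t \<omega>))"

lemma measurable_transition [measurable]:
  assumes [measurable]: "f \<in> borel_measurable borel"
  shows "transition t f \<in> borel_measurable borel"
  unfolding transition_def by measurable

lemma norm_transition:
  assumes "f \<in> borel_measurable borel" "\<And>y. norm (f y) \<le> B"
  shows "norm (transition t f y) \<le> B"
proof -
  have "norm (transition t f y) \<le> (LINT \<omega>|M. norm (f (y + Z t \<omega>)))"
    unfolding transition_def by (rule integral_norm_bound)
  also have "\<dots> \<le> (LINT \<omega>|M. B)"
    by (rule integral_mono_AE) (use assms in \<open>auto intro!: integrable_const_bound[where B=B]\<close>)
  finally show ?thesis by (simp add: prob_space)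
qed

definition first_passage :: "'a \<Rightarrow> 'a \<Rightarrow> real \<Rightarrow> nat \<Rightarrow> 'w \<Rightarrow> bool" where
  "first_passage l x h k \<omega> \<longleftrightarrow> (x + Z (real k * h) \<omega>) \<bullet> l < 0 \<and> (\<forall>i<k. (x + Z (real i * h) \<omega>) \<bullet> l \<ge> 0)"

lemma measurable_first_passage [measurable]: "Measurable.pred M (first_passage l x h k)"
  unfolding first_passage_def by measurable

text \<open>The first passage event at index \<open>k\<close> is determined by the first
  \<open>k\<close> increments, whereas the displacement during the next \<open>j\<close> steps is
  independent of them. For \<open>j = 0\<close> there is no increment to separate, but the
  transition operator is then the identity.\<close>

lemma first_passage_markov:
  fixes f :: "'a \<Rightarrow> complex"
  assumes h: "h > 0" and [measurable]: "f \<in> borel_measurable borel" and B: "\<And>y. norm (f y) \<le> B"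
  shows "(LINT \<omega>|M. indicator {\<omega>. first_passage l x h k \<omega>} \<omega> * f (x + Z (real (k + j) * h) \<omega>))
     = (LINT \<omega>|M. indicator {\<omega>. first_passage l x h k \<omega>} \<omega> * transition (real j * h) f (x + Z (real k * h) \<omega>))"
proof (cases j)
  case 0
  show ?thesis unfolding 0 transition_def by (simp add: Z_nonpos prob_space)
next
  case (Suc j')
  define D where "D = (\<lambda>\<omega>. \<lambda>i\<in>{..<k}. Z (real (Suc i) * h) \<omega> - Z (real i * h) \<omega>)"
  have Z_sum: "Z (real i * h) \<omega> = (\<Sum>r<i. D \<omega> r)" if "i \<le> k" for i \<omega>
    using that
  proof (induction i)
    case 0 show ?case by (simp add: Z_nonpos)
  next
    case (Suc i)
    thus ?case by (simp add: D_def)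
  qed
  \<comment> \<open>The event expressed through partial sums of increments, so that it becomes a
    measurable condition on the product space.\<close>
  define FP where "FP v \<longleftrightarrow> (x + (\<Sum>r<k. v r)) \<bullet> l < 0 \<and> (\<forall>i<k. (x + (\<Sum>r<i. v r)) \<bullet> l \<ge> 0)" for v :: "nat \<Rightarrow> 'a"
  have FP: "first_passage l x h k \<omega> \<longleftrightarrow> FP (D \<omega>)" for \<omega>
    unfolding first_passage_def FP_def using Z_sum by auto
  define G where "G p = of_bool (FP (fst p)) * f (x + (\<Sum>r<k. fst p r) + snd p)" for p :: "(nat \<Rightarrow> 'a) \<times> 'a"
  have comp: "(\<lambda>p::(nat \<Rightarrow> 'a) \<times> 'a. fst p r) \<in> borel_measurable (PiM {..<k} (\<lambda>_. borel) \<Otimes>\<^sub>M borel)" if "r < k" for r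
    by (rule measurable_compose[OF measurable_fst]) (use that in \<open>auto intro: measurable_component_singleton\<close>)
  have sums [measurable]: "(\<lambda>p::(nat \<Rightarrow> 'a) \<times> 'a. \<Sum>r<i. fst p r) \<in> borel_measurable (PiM {..<k} (\<lambda>_. borel) \<Otimes>\<^sub>M borel)" if "i \<le> k" for i
    by (rule borel_measurable_sum[where f="\<lambda>r p. fst p r"]) (use that in \<open>auto intro!: comp\<close>)
  have [measurable]: "Measurable.pred (PiM {..<k} (\<lambda>_. borel) \<Otimes>\<^sub>M borel) (\<lambda>p. FP (fst p))"
  proof -
    have 1: "Measurable.pred (PiM {..<k} (\<lambda>_. borel) \<Otimes>\<^sub>M borel) (\<lambda>p::(nat \<Rightarrow> 'a) \<times> 'a. (x + (\<Sum>r<k. fst p r)) \<bullet> l < 0)"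
      using sums[of k] by measurable
    have 2: "Measurable.pred (PiM {..<k} (\<lambda>_. borel) \<Otimes>\<^sub>M borel) (\<lambda>p::(nat \<Rightarrow> 'a) \<times> 'a. (x + (\<Sum>r<i. fst p r)) \<bullet> l \<ge> 0)" if "i \<in> {..<k}" for i
    proof -
      have "i \<le> k" using that by simp
      from sums[OF this] show ?thesis by measurable
    qed
    have "Measurable.pred (PiM {..<k} (\<lambda>_. borel) \<Otimes>\<^sub>M borel) (\<lambda>p::(nat \<Rightarrow> 'a) \<times> 'a. (x + (\<Sum>r<k. fst p r)) \<bullet> l < 0
        \<and> (\<forall>i\<in>{..<k}. (x + (\<Sum>r<i. fst p r)) \<bullet> l \<ge> 0))"
      using 1 2 by (intro pred_intros_logic pred_intros_finite) auto
    thus ?thesis by (simp add: FP_def Ball_def)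
  qed
  have G: "G \<in> borel_measurable (PiM {..<k} (\<lambda>_. borel) \<Otimes>\<^sub>M borel)"
    unfolding G_def using sums[of k] by measurable
  have "(LINT \<omega>|M. G (D \<omega>, Z (real (k + Suc j') * h) \<omega> - Z (real k * h) \<omega>))
       = (LINT \<omega>|M. LINT \<omega>'|M. G (D \<omega>, Z (real (Suc j') * h) \<omega>'))"
    unfolding D_def using h G
    by (rule increments_indep[where B=B]) (use B order_trans[OF norm_ge_zero B] in \<open>auto simp: G_def norm_mult\<close>)
  also have "(\<lambda>\<omega>. G (D \<omega>, Z (real (k + Suc j') * h) \<omega> - Z (real k * h) \<omega>))
    = (\<lambda>\<omega>. indicator {\<omega>. first_passage l x h k \<omega>} \<omega> * f (x + Z (real (k + j) * h) \<omega>))"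
    unfolding G_def Suc FP using Z_sum[of k] by (auto simp: fun_eq_iff indicator_def)
  also have "(\<lambda>\<omega>. LINT \<omega>'|M. G (D \<omega>, Z (real (Suc j') * h) \<omega>'))
    = (\<lambda>\<omega>. indicator {\<omega>. first_passage l x h k \<omega>} \<omega> * transition (real j * h) f (x + Z (real k * h) \<omega>))"
    unfolding G_def Suc FP transition_def using Z_sum[of k] by (auto simp: fun_eq_iff indicator_def)
  finally show ?thesis .
qed

end

section \<open>Discounted time integrals and potentials\<close>

lemma integrable_exp_decay: "m > 0 \<Longrightarrow> integrable lborel (\<lambda>t::real. indicator {0..} t * exp (- m * t))"
proof -
  assume "m > 0"
  hence "integrable lborel (\<lambda>t::real. indicator {0<..} t * t powr (1 - 1) * exp (- m * t))"
    using gamma_integral_scaled[of 1 m] by (auto intro: integrable.intros)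
  thus ?thesis
    by (rule integrable_cong_AE_imp) (use AE_lborel_singleton[of "0::real"] in \<open>auto split: split_indicator elim!: eventually_mono\<close>)
qed

lemma grid_add: "h > 0 \<Longrightarrow> grid h (real k * h + s) = real k * h + grid h s"
  unfolding grid_def by (simp add: add_divide_distrib algebra_simps)

lemma grid_eq_nat:
  assumes "h > 0" "t \<ge> 0"
  obtains j where "grid h t = real j * h"
  using assms by (intro that[of "nat \<lfloor>t / h\<rfloor>"]) (simp add: grid_def)

text \<open>Rounding down loses at most \<open>h\<close>, which costs a factor
  \<open>exp (m * h)\<close>.\<close>

lemma integrable_exp_grid:
  assumes "m > 0" "h > 0"
  shows "integrable lborel (\<lambda>t. indicator {0..} t * exp (- m * grid h t))"
proof (rule Bochner_Integration.integrable_bound[OF integrable_mult_right[OF integrable_exp_decay[OF assms(1)], of "exp (m * h)"]])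
  show "AE t in lborel. norm (indicator {0..} t * exp (- m * grid h t)) \<le> norm (exp (m * h) * (indicator {0..} t * exp (- m * t)))"
  proof (rule AE_I2)
    fix t :: real
    have "t \<le> grid h t + h" using grid_bounds[OF assms(2), of t] by linarith
    hence "m * t \<le> m * (grid h t + h)" using assms by (intro mult_left_mono) auto
    hence "exp (- m * grid h t) \<le> exp (m * h) * exp (- m * t)"
      by (simp add: exp_add[symmetric] algebra_simps)
    thus "norm (indicator {0..} t * exp (- m * grid h t)) \<le> norm (exp (m * h) * (indicator {0..} t * exp (- m * t)))"
      by (auto split: split_indicator)
  qed
qed measurable

context regular_levy
begin

lemma measurable_Z_grid_compose [measurable (raw)]:
  assumes [measurable]: "g \<in> borel_measurable N" "v \<in> N \<rightarrow>\<^sub>M M"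
  shows "(\<lambda>p. Z (grid h (g p) + c) (v p)) \<in> borel_measurable N"
  using measurable_compose[of "\<lambda>p. (g p, v p)" N, OF _ measurable_Z_grid[of h c]] by simp

lemma measurable_Z_grid_compose0 [measurable (raw)]:
  assumes [measurable]: "g \<in> borel_measurable N" "v \<in> N \<rightarrow>\<^sub>M M"
  shows "(\<lambda>p. Z (grid h (g p)) (v p)) \<in> borel_measurable N"
  using measurable_Z_grid_compose[OF assms, of h 0] by simp

lemma measurable_Z_compose [measurable (raw)]:
  assumes [measurable]: "g \<in> borel_measurable N" "v \<in> N \<rightarrow>\<^sub>M M"
  shows "(\<lambda>p. Z (g p) (v p)) \<in> borel_measurable N"
  using measurable_compose[of "\<lambda>p. (g p, v p)" N, OF _ measurable_Z_pair] by simp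

text \<open>The weight \<open>a\<close> supplies integrability in time and the functional
  \<open>\<Phi>\<close> is only bounded; with a probability measure on the other factor this is
  enough for Fubini.\<close>

lemma
  fixes a :: "real \<Rightarrow> real" and \<Phi> :: "real \<Rightarrow> 'w \<Rightarrow> complex"
  assumes a: "integrable lborel a" and [measurable]: "(\<lambda>(t, \<omega>). \<Phi> t \<omega>) \<in> borel_measurable (borel \<Otimes>\<^sub>M M)"
    and B: "\<And>t \<omega>. norm (\<Phi> t \<omega>) \<le> B"
  shows time_fubini: "(LINT \<omega>|M. LINT t|lborel. of_real (a t) * \<Phi> t \<omega>) = (LINT t|lborel. of_real (a t) * (LINT \<omega>|M. \<Phi> t \<omega>))"
    and time_integrable: "integrable (M \<Otimes>\<^sub>M lborel) (\<lambda>(\<omega>, t). of_real (a t) * \<Phi> t \<omega>)"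
proof -
  interpret P: pair_sigma_finite M "lborel :: real measure" ..
  have [measurable]: "a \<in> borel_measurable borel" using a by auto
  have [measurable]: "(\<lambda>(\<omega>, t). \<Phi> t \<omega>) \<in> borel_measurable (M \<Otimes>\<^sub>M borel)"
  proof -
    have "(\<lambda>p. (case (snd p, fst p) of (t, \<omega>) \<Rightarrow> \<Phi> t \<omega>)) \<in> borel_measurable (M \<Otimes>\<^sub>M borel)"
      by (rule measurable_compose[where f="\<lambda>p. (snd p, fst p)" and N="borel \<Otimes>\<^sub>M M"]) auto
    thus ?thesis by (simp add: split_beta')
  qed
  have B0: "B \<ge> 0" using B[of 0 undefined] norm_ge_zero order_trans by blast
  have at: "integrable lborel (\<lambda>t. of_real (a t) * \<Phi> t \<omega>)" if "\<omega> \<in> space M" for \<omega>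
  proof (rule Bochner_Integration.integrable_bound[OF integrable_mult_left[OF integrable_norm[OF a], of B]])
    have [measurable]: "(\<lambda>t. \<Phi> t \<omega>) \<in> borel_measurable borel"
      using measurable_compose[OF measurable_Pair1'[OF that] \<open>(\<lambda>(\<omega>, t). \<Phi> t \<omega>) \<in> borel_measurable (M \<Otimes>\<^sub>M borel)\<close>] by simp
    show "(\<lambda>t. of_real (a t) * \<Phi> t \<omega>) \<in> borel_measurable lborel" by measurable
    show "AE t in lborel. norm (of_real (a t) * \<Phi> t \<omega>) \<le> norm (norm (a t) * B)"
      using B B0 by (auto simp: norm_mult abs_mult intro!: mult_left_mono)
  qed
  show int: "integrable (M \<Otimes>\<^sub>M lborel) (\<lambda>(\<omega>, t). of_real (a t) * \<Phi> t \<omega>)"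
  proof (rule P.Fubini_integrable)
    have "norm (LINT t|lborel. norm (of_real (a t) * \<Phi> t \<omega>)) \<le> (LINT t|lborel. norm (a t) * B)" if "\<omega> \<in> space M" for \<omega>
    proof -
      have "(LINT t|lborel. norm (of_real (a t) * \<Phi> t \<omega>)) \<le> (LINT t|lborel. norm (a t) * B)"
        by (rule Bochner_Integration.integral_mono[OF integrable_norm[OF at[OF that]] integrable_mult_left[OF integrable_norm[OF a]]])
           (use B in \<open>auto simp: norm_mult intro!: mult_left_mono\<close>)
      thus ?thesis by simp
    qed
    thus "integrable M (\<lambda>\<omega>. LINT t|lborel. norm (case (\<omega>, t) of (\<omega>, t) \<Rightarrow> of_real (a t) * \<Phi> t \<omega>))"
      by (intro integrable_const_bound[where B="LINT t|lborel. norm (a t) * B"]) auto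
    show "AE \<omega> in M. integrable lborel (\<lambda>t. case (\<omega>, t) of (\<omega>, t) \<Rightarrow> of_real (a t) * \<Phi> t \<omega>)"
      using at by auto
  qed measurable
  have "(LINT t|lborel. LINT \<omega>|M. of_real (a t) * \<Phi> t \<omega>) = (LINT \<omega>|M. LINT t|lborel. of_real (a t) * \<Phi> t \<omega>)"
    using P.Fubini_integral[OF int] by simp
  thus "(LINT \<omega>|M. LINT t|lborel. of_real (a t) * \<Phi> t \<omega>) = (LINT t|lborel. of_real (a t) * (LINT \<omega>|M. \<Phi> t \<omega>))"
    by simp
qed

text \<open>For h > 0 this is h times the sum over k of exp(-m k h) P_(kh) f, the potential of the
  walk sampled at mesh \<open>h\<close>. Writing it as an integral over continuous time makes it
  directly comparable with \<open>potential\<close>, the m-resolvent, and lets shifts of time be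
  ordinary substitutions.\<close>

definition grid_potential :: "real \<Rightarrow> real \<Rightarrow> ('a \<Rightarrow> complex) \<Rightarrow> 'a \<Rightarrow> complex" where
  "grid_potential m h f y = (LINT t|lborel. of_real (indicator {0..} t * exp (- m * grid h t)) * transition (grid h t) f y)"

definition potential :: "real \<Rightarrow> ('a \<Rightarrow> complex) \<Rightarrow> 'a \<Rightarrow> complex" where
  "potential m f y = (LINT t|lborel. of_real (indicator {0..} t * exp (- m * t)) * transition t f y)"

lemma measurable_transition_grid [measurable (raw)]:
  assumes [measurable]: "f \<in> borel_measurable borel" "g \<in> borel_measurable N" "y \<in> borel_measurable N"
  shows "(\<lambda>p. transition (grid h (g p)) f (y p)) \<in> borel_measurable N"
  unfolding transition_def by measurable

lemma measurable_grid_potential [measurable]: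
  assumes [measurable]: "f \<in> borel_measurable borel"
  shows "grid_potential m h f \<in> borel_measurable borel"
  unfolding grid_potential_def by measurable

lemma norm_grid_potential:
  assumes [measurable]: "f \<in> borel_measurable borel" and B: "\<And>y. norm (f y) \<le> B" and "m > 0" "h > 0"
  shows "norm (grid_potential m h f y) \<le> B * (LINT t|lborel. indicator {0..} t * exp (- m * grid h t))"
proof -
  have B0: "B \<ge> 0" using B norm_ge_zero order_trans by blast
  have "norm (grid_potential m h f y) \<le> (LINT t|lborel. norm (of_real (indicator {0..} t * exp (- m * grid h t)) * transition (grid h t) f y))"
    unfolding grid_potential_def by (rule integral_norm_bound)
  also have "\<dots> \<le> (LINT t|lborel. B * (indicator {0..} t * exp (- m * grid h t)))"
  proof (rule integral_mono_AE')
    show "integrable lborel (\<lambda>t. B * (indicator {0..} t * exp (- m * grid h t)))"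
      by (intro integrable_mult_right integrable_exp_grid assms)
    show "AE t in lborel. norm (of_real (indicator {0..} t * exp (- m * grid h t)) * transition (grid h t) f y) \<le> B * (indicator {0..} t * exp (- m * grid h t))"
      using norm_transition[OF assms(1) B] by (auto simp: norm_mult split: split_indicator)
  qed (use B0 in auto)
  finally show ?thesis by simp
qed

section \<open>The hitting identity for the sampled walk\<close>

text \<open>On the event of first passage at index \<open>k\<close>, times before \<open>k h\<close>
  contribute nothing since \<open>f\<close> vanishes on the upper half-space. The remaining time
  integral is shifted by \<open>k h\<close>, which produces the discount factor, and evaluated by
  the Markov property.\<close>

lemma grid_first_passage:
  fixes f :: "'a \<Rightarrow> complex"
  assumes h: "h > 0" and m: "m > 0" and f [measurable]: "f \<in> borel_measurable borel" and B: "\<And>y. norm (f y) \<le> B"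
    and f0: "\<And>y. y \<bullet> l \<ge> 0 \<Longrightarrow> f y = 0"
  shows "(LINT \<omega>|M. LINT t|lborel. of_real (indicator {0..} t * exp (- m * grid h t)) * (indicator {\<omega>. first_passage l x h k \<omega>} \<omega> * f (x + Z (grid h t) \<omega>)))
    = (LINT \<omega>|M. indicator {\<omega>. first_passage l x h k \<omega>} \<omega> * (of_real (exp (- m * (real k * h))) * grid_potential m h f (x + Z (real k * h) \<omega>)))"
proof -
  let ?I = "\<lambda>\<omega>. indicator {\<omega>. first_passage l x h k \<omega>} \<omega> :: complex"
  let ?a = "\<lambda>t. indicator {0..} t * exp (- m * grid h t) :: real"
  have a: "integrable lborel ?a" by (rule integrable_exp_grid) fact+
  have [measurable]: "?I \<in> borel_measurable M"
    using measurable_first_passage[of l x h k] by (simp add: indicator_def of_bool_def[symmetric] cong: if_cong) measurable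
  have B0: "B \<ge> 0" using B norm_ge_zero order_trans by blast
  have bd: "norm (?I \<omega> * c) \<le> B" if "norm c \<le> B" for \<omega> c using that B0 by (auto simp: indicator_def)
  have "(LINT \<omega>|M. LINT t|lborel. of_real (?a t) * (?I \<omega> * f (x + Z (grid h t) \<omega>)))
      = (LINT t|lborel. of_real (?a t) * (LINT \<omega>|M. ?I \<omega> * f (x + Z (grid h t) \<omega>)))"
    by (rule time_fubini[OF a _ bd[OF B]]) measurable
  also have "\<dots> = (LINT s|lborel. of_real (?a (real k * h + 1 * s)) * (LINT \<omega>|M. ?I \<omega> * f (x + Z (grid h (real k * h + 1 * s)) \<omega>)))"
    by (subst lborel_integral_real_affine[where c=1 and t="real k * h"]) simp_all
  also have "\<dots> = (LINT s|lborel. of_real (exp (- m * (real k * h))) * (of_real (?a s) * (LINT \<omega>|M. ?I \<omega> * transition (grid h s) f (x + Z (real k * h) \<omega>))))"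
  proof (intro Bochner_Integration.integral_cong refl)
    fix s :: real
    show "of_real (?a (real k * h + 1 * s)) * (LINT \<omega>|M. ?I \<omega> * f (x + Z (grid h (real k * h + 1 * s)) \<omega>))
      = of_real (exp (- m * (real k * h))) * (of_real (?a s) * (LINT \<omega>|M. ?I \<omega> * transition (grid h s) f (x + Z (real k * h) \<omega>)))"
    proof (cases "s \<ge> 0")
      case True
      then obtain j where j: "grid h s = real j * h" using grid_eq_nat[OF h] by metis
      have g: "grid h (real k * h + 1 * s) = real (k + j) * h"
        using grid_add[OF h, of k s] j by (simp add: algebra_simps)
      have "real k * h + 1 * s \<ge> 0" using True h by simp
      hence "?a (real k * h + 1 * s) = exp (- m * (real k * h)) * ?a s"
        using True unfolding g j by (simp add: exp_add[symmetric] algebra_simps)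
      thus ?thesis unfolding g j first_passage_markov[OF h f B] by simp
    next
      case False
      show ?thesis
      proof (cases "real k * h + s \<ge> 0")
        case True
        then obtain i where i: "grid h (real k * h + s) = real i * h" using grid_eq_nat[OF h] by metis
        \<comment> \<open>The shifted time is rounded to a grid time strictly before the passage,
          where the walk has not yet left the zero set of \<open>f\<close>.\<close>
        have "grid h (real k * h + s) < real k * h" using grid_bounds[OF h, of "real k * h + s"] False by linarith
        hence "i < k" using h unfolding i by simp
        hence zero: "?I \<omega> * f (x + Z (real i * h) \<omega>) = 0" for \<omega>
          using f0 by (auto simp: indicator_def first_passage_def)
        have "(LINT \<omega>|M. ?I \<omega> * f (x + Z (grid h (real k * h + 1 * s)) \<omega>)) = 0"
          unfolding mult_1 i zero by simp
        thus ?thesis using False by simp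
      qed (use False in simp)
    qed
  qed
  also have "\<dots> = of_real (exp (- m * (real k * h))) * (LINT s|lborel. of_real (?a s) * (LINT \<omega>|M. ?I \<omega> * transition (grid h s) f (x + Z (real k * h) \<omega>)))"
    by simp
  also have "(LINT s|lborel. of_real (?a s) * (LINT \<omega>|M. ?I \<omega> * transition (grid h s) f (x + Z (real k * h) \<omega>)))
     = (LINT \<omega>|M. LINT s|lborel. of_real (?a s) * (?I \<omega> * transition (grid h s) f (x + Z (real k * h) \<omega>)))"
    by (rule time_fubini[OF a _ bd[OF norm_transition[OF f B]], symmetric]) measurable
  also have "(\<lambda>\<omega>. LINT s|lborel. of_real (?a s) * (?I \<omega> * transition (grid h s) f (x + Z (real k * h) \<omega>)))
     = (\<lambda>\<omega>. ?I \<omega> * grid_potential m h f (x + Z (real k * h) \<omega>))"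
    unfolding grid_potential_def by (subst integral_mult_right_zero[symmetric]) (simp only: mult_ac)
  finally show ?thesis
    unfolding integral_mult_right_zero[symmetric] by (simp only: mult_ac)
qed

text \<open>The first passage events for different \<open>k\<close> are disjoint and exhaust
  \<open>hit\<close>. Summing their contributions gives the strong Markov property without any
  theory of stopping times; a walk that never hits stays where \<open>f\<close> vanishes.\<close>

lemma grid_hit_identity:
  fixes f :: "'a \<Rightarrow> complex" and x l :: 'a
  assumes h: "h > 0" and m: "m > 0" and f [measurable]: "f \<in> borel_measurable borel" and B: "\<And>y. norm (f y) \<le> B"
    and f0: "\<And>y. y \<bullet> l \<ge> 0 \<Longrightarrow> f y = 0"
  defines "hit \<equiv> \<lambda>\<omega>. \<exists>k. (x + Z (real k * h) \<omega>) \<bullet> l < 0"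
  defines "fp \<equiv> \<lambda>\<omega>. LEAST k. (x + Z (real k * h) \<omega>) \<bullet> l < 0"
  shows "grid_potential m h f x = (LINT \<omega>|M. of_bool (hit \<omega>) * (of_real (exp (- m * (real (fp \<omega>) * h))) * grid_potential m h f (x + Z (real (fp \<omega>) * h) \<omega>)))"
proof -
  let ?a = "\<lambda>t. indicator {0..} t * exp (- m * grid h t) :: real"
  let ?A = "LINT t|lborel. ?a t"
  \<comment> \<open>\<open>G\<close> is the discounted integral of \<open>f\<close> along one
    sampled path; \<open>W\<close> is the potential restarted at the first passage. They have equal
    means on every first passage event.\<close>
  define G where "G \<omega> = (LINT t|lborel. of_real (?a t) * f (x + Z (grid h t) \<omega>))" for \<omega>
  define W where "W \<omega> = of_real (exp (- m * (real (fp \<omega>) * h))) * grid_potential m h f (x + Z (real (fp \<omega>) * h) \<omega>)" for \<omega>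
  have a: "integrable lborel ?a" by (rule integrable_exp_grid) fact+
  have A0: "?A \<ge> 0" by (intro Bochner_Integration.integral_nonneg) auto
  have B0: "B \<ge> 0" using B norm_ge_zero order_trans by blast
  have hit_meas [measurable]: "Measurable.pred M hit" unfolding hit_def by measurable
  have fp_meas [measurable]: "fp \<in> measurable M (count_space UNIV)" unfolding fp_def by measurable
  have Zfp [measurable]: "(\<lambda>\<omega>. Z (real (fp \<omega>) * h) \<omega>) \<in> borel_measurable M"
    by (rule measurable_compose_countable[where f="\<lambda>i \<omega>. Z (real i * h) \<omega>"]) measurable
  have G_meas [measurable]: "G \<in> borel_measurable M" unfolding G_def by measurable
  have W_meas [measurable]: "W \<in> borel_measurable M" unfolding W_def by measurable
  have G_bound: "norm (G \<omega>) \<le> B * ?A" for \<omega>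
  proof -
    have "norm (G \<omega>) \<le> (LINT t|lborel. norm (of_real (?a t) * f (x + Z (grid h t) \<omega>)))"
      unfolding G_def by (rule integral_norm_bound)
    also have "\<dots> \<le> (LINT t|lborel. B * ?a t)"
      by (rule integral_mono_AE') (use B a B0 in \<open>auto simp: norm_mult split: split_indicator\<close>)
    finally show ?thesis by simp
  qed
  have W_bound: "norm (W \<omega>) \<le> B * ?A" for \<omega>
  proof -
    have "norm (W \<omega>) \<le> 1 * (B * ?A)"
      unfolding W_def norm_mult using norm_grid_potential[OF f B m h] m h
      by (intro mult_mono) auto
    thus ?thesis by simp
  qed
  have fp_iff: "first_passage l x h k \<omega> \<longleftrightarrow> hit \<omega> \<and> fp \<omega> = k" for k \<omega>
  proof
    assume "first_passage l x h k \<omega>"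
    thus "hit \<omega> \<and> fp \<omega> = k" unfolding first_passage_def hit_def fp_def
      by (auto intro!: Least_equality simp: not_less[symmetric])
  next
    assume *: "hit \<omega> \<and> fp \<omega> = k"
    hence "(x + Z (real (fp \<omega>) * h) \<omega>) \<bullet> l < 0" unfolding hit_def fp_def by (auto intro: LeastI)
    moreover have "\<not> (x + Z (real i * h) \<omega>) \<bullet> l < 0" if "i < fp \<omega>" for i
      using that not_less_Least unfolding fp_def by blast
    ultimately show "first_passage l x h k \<omega>" using * unfolding first_passage_def by (auto simp: not_less)
  qed
  have G0: "G \<omega> = 0" if "\<not> hit \<omega>" for \<omega>
  proof -
    have zero: "of_real (?a t) * f (x + Z (grid h t) \<omega>) = 0" for t
    proof (cases "t \<ge> 0")
      case True
      then obtain j where "grid h t = real j * h" using grid_eq_nat[OF h] by metis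
      with that show ?thesis unfolding hit_def by (auto simp: not_less intro!: f0)
    qed simp
    show ?thesis unfolding G_def zero by simp
  qed
  have zero: "(LINT \<omega>|M. of_bool (first_passage l x h k \<omega>) * (W \<omega> - G \<omega>)) = 0" for k
  proof -
    have [measurable]: "Measurable.pred M (first_passage l x h k)" by measurable
    have i1: "integrable M (\<lambda>\<omega>. of_bool (first_passage l x h k \<omega>) * W \<omega>)" "integrable M (\<lambda>\<omega>. of_bool (first_passage l x h k \<omega>) * G \<omega>)"
      by (rule integrable_const_bound[where B="B * ?A"]; use W_bound G_bound B0 A0 in \<open>auto\<close>)+
    have "(LINT \<omega>|M. of_bool (first_passage l x h k \<omega>) * W \<omega>) = (LINT \<omega>|M. of_bool (first_passage l x h k \<omega>) * G \<omega>)"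
    proof -
      have "(LINT \<omega>|M. of_bool (first_passage l x h k \<omega>) * G \<omega>) =
        (LINT \<omega>|M. LINT t|lborel. of_real (?a t) * (indicator {\<omega>. first_passage l x h k \<omega>} \<omega> * f (x + Z (grid h t) \<omega>)))"
        unfolding G_def by (subst integral_mult_right_zero[symmetric]) (simp add: indicator_def of_bool_def mult_ac)
      also have "\<dots> = (LINT \<omega>|M. indicator {\<omega>. first_passage l x h k \<omega>} \<omega> * (of_real (exp (- m * (real k * h))) * grid_potential m h f (x + Z (real k * h) \<omega>)))"
        by (rule grid_first_passage[OF h m f B f0])
      also have "\<dots> = (LINT \<omega>|M. of_bool (first_passage l x h k \<omega>) * W \<omega>)"
        unfolding W_def by (intro Bochner_Integration.integral_cong refl) (auto simp: indicator_def fp_iff)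
      finally show ?thesis ..
    qed
    thus ?thesis using i1 by (simp add: right_diff_distrib)
  qed
  \<comment> \<open>The partial sum equals \<open>W - G\<close> on the part of \<open>hit\<close>
    with \<open>fp < K\<close>, and \<open>W - G\<close> is bounded, so the sum over all
    \<open>k\<close> is a dominated limit.\<close>
  have "(\<lambda>K. LINT \<omega>|M. (\<Sum>k<K. of_bool (first_passage l x h k \<omega>) * (W \<omega> - G \<omega>))) \<longlonglongrightarrow> (LINT \<omega>|M. of_bool (hit \<omega>) * (W \<omega> - G \<omega>))"
  proof (rule integral_dominated_convergence)
    have sum_eq: "(\<Sum>k<K. of_bool (first_passage l x h k \<omega>) * (W \<omega> - G \<omega>)) = of_bool (hit \<omega> \<and> fp \<omega> < K) * (W \<omega> - G \<omega>)" for K \<omega>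
    proof -
      have "(\<Sum>k<K. of_bool (first_passage l x h k \<omega>) * (W \<omega> - G \<omega>)) = (\<Sum>k<K. if k = fp \<omega> then of_bool (hit \<omega>) * (W \<omega> - G \<omega>) else 0)"
        by (intro sum.cong refl) (auto simp: fp_iff)
      thus ?thesis by (auto simp: sum.delta')
    qed
    show "integrable M (\<lambda>\<omega>. 2 * (B * ?A))" by simp
    show "AE \<omega> in M. (\<lambda>K. \<Sum>k<K. of_bool (first_passage l x h k \<omega>) * (W \<omega> - G \<omega>)) \<longlonglongrightarrow> of_bool (hit \<omega>) * (W \<omega> - G \<omega>)"
    proof (intro AE_I2 tendsto_eventually)
      fix \<omega>
      show "\<forall>\<^sub>F K in sequentially. (\<Sum>k<K. of_bool (first_passage l x h k \<omega>) * (W \<omega> - G \<omega>)) = of_bool (hit \<omega>) * (W \<omega> - G \<omega>)"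
        unfolding sum_eq using eventually_gt_at_top[of "fp \<omega>"] by eventually_elim auto
    qed
    show "AE \<omega> in M. norm (\<Sum>k<K. of_bool (first_passage l x h k \<omega>) * (W \<omega> - G \<omega>)) \<le> 2 * (B * ?A)" for K
    proof (rule AE_I2)
      fix \<omega>
      have "norm (W \<omega> - G \<omega>) \<le> 2 * (B * ?A)" using norm_triangle_ineq4[of "W \<omega>" "G \<omega>"] W_bound[of \<omega>] G_bound[of \<omega>] by linarith
      thus "norm (\<Sum>k<K. of_bool (first_passage l x h k \<omega>) * (W \<omega> - G \<omega>)) \<le> 2 * (B * ?A)"
        unfolding sum_eq using A0 B0 by (auto simp: norm_mult)
    qed
  qed measurable
  moreover have "(LINT \<omega>|M. (\<Sum>k<K. of_bool (first_passage l x h k \<omega>) * (W \<omega> - G \<omega>))) = 0" for K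
  proof -
    have "integrable M (\<lambda>\<omega>. of_bool (first_passage l x h k \<omega>) * (W \<omega> - G \<omega>))" for k
    proof (rule integrable_const_bound[where B="2 * (B * ?A)"])
      show "AE \<omega> in M. norm (of_bool (first_passage l x h k \<omega>) * (W \<omega> - G \<omega>)) \<le> 2 * (B * ?A)"
      proof (rule AE_I2)
        fix \<omega>
        have "norm (W \<omega> - G \<omega>) \<le> 2 * (B * ?A)" using norm_triangle_ineq4[of "W \<omega>" "G \<omega>"] W_bound[of \<omega>] G_bound[of \<omega>] by linarith
        thus "norm (of_bool (first_passage l x h k \<omega>) * (W \<omega> - G \<omega>)) \<le> 2 * (B * ?A)"
          using A0 B0 by (auto simp: norm_mult)
      qed
    qed measurable
    thus ?thesis by (subst Bochner_Integration.integral_sum) (auto simp: zero)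
  qed
  ultimately have "(LINT \<omega>|M. of_bool (hit \<omega>) * (W \<omega> - G \<omega>)) = 0"
    using LIMSEQ_unique[OF _ tendsto_const] by simp
  moreover have "integrable M (\<lambda>\<omega>. of_bool (hit \<omega>) * W \<omega>)" "integrable M (\<lambda>\<omega>. of_bool (hit \<omega>) * G \<omega>)"
    by (rule integrable_const_bound[where B="B * ?A"]; use W_bound G_bound B0 A0 in \<open>auto\<close>)+
  ultimately have "(LINT \<omega>|M. of_bool (hit \<omega>) * W \<omega>) = (LINT \<omega>|M. of_bool (hit \<omega>) * G \<omega>)"
    by (simp add: right_diff_distrib)
  also have "\<dots> = (LINT \<omega>|M. G \<omega>)"
    by (intro Bochner_Integration.integral_cong refl) (use G0 in auto)
  also have "\<dots> = grid_potential m h f x"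
    unfolding G_def grid_potential_def transition_def by (rule time_fubini[OF a _ B]) measurable
  finally show ?thesis unfolding W_def ..
qed

section \<open>Vanishing mesh\<close>

text \<open>The grid potential samples left end points, from which right continuity gives no limit.
  Splitting off the first cell, where the transition operator is the identity, turns the remainder
  into sampling at right end points.\<close>

lemma grid_potential_shift:
  fixes f :: "'a \<Rightarrow> complex"
  assumes h: "h > 0" and m: "m > 0" and f [measurable]: "f \<in> borel_measurable borel" and B: "\<And>y. norm (f y) \<le> B"
  shows "grid_potential m h f y = of_real h * f y +
    (LINT t|lborel. of_real (indicator {0..} t * exp (- m * (grid h t + h))) * transition (grid h t + h) f y)"
proof -
  let ?\<phi> = "\<lambda>t. of_real (exp (- m * grid h t)) * transition (grid h t) f y"
  have int: "integrable lborel (\<lambda>t. of_real (indicator {0..} t) * ?\<phi> t)"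
  proof (rule Bochner_Integration.integrable_bound[OF integrable_mult_right[OF integrable_exp_grid[OF m h], of B]])
    show "AE t in lborel. norm (of_real (indicator {0..} t) * ?\<phi> t) \<le> norm (B * (indicator {0..} t * exp (- m * grid h t)))"
    proof (rule AE_I2)
      fix t :: real
      have "norm (transition (grid h t) f y) \<le> \<bar>B\<bar>" using norm_transition[OF f B, of "grid h t" y] by linarith
      thus "norm (of_real (indicator {0..} t) * ?\<phi> t) \<le> norm (B * (indicator {0..} t * exp (- m * grid h t)))"
        by (auto simp: norm_mult abs_mult split: split_indicator)
    qed
  qed measurable
  have part: "integrable lborel (\<lambda>t. of_real (indicator S t) * ?\<phi> t)" if "S \<subseteq> {0..}" "S \<in> sets borel" for S
    by (rule Bochner_Integration.integrable_bound[OF int]) (use that in \<open>auto split: split_indicator\<close>)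
  have "grid_potential m h f y = (LINT t|lborel. of_real (indicator {0..<h} t) * ?\<phi> t + of_real (indicator {h..} t) * ?\<phi> t)"
    unfolding grid_potential_def by (intro Bochner_Integration.integral_cong refl) (use h in \<open>auto split: split_indicator\<close>)
  also have "\<dots> = (LINT t|lborel. of_real (indicator {0..<h} t) * ?\<phi> t) + (LINT t|lborel. of_real (indicator {h..} t) * ?\<phi> t)"
    by (rule Bochner_Integration.integral_add[OF part part]) (use h in auto)
  also have "(LINT t|lborel. of_real (indicator {0..<h} t) * ?\<phi> t) = (LINT t|lborel. of_real (indicator {0..<h} t) * f y)"
  proof (intro Bochner_Integration.integral_cong refl)
    fix t :: real
    show "of_real (indicator {0..<h} t) * ?\<phi> t = of_real (indicator {0..<h} t) * f y"
    proof (cases "t \<in> {0..<h}")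
      case True
      hence "\<lfloor>t / h\<rfloor> = 0" using h by (simp add: floor_eq_iff)
      hence "grid h t = 0" by (simp add: grid_def)
      thus ?thesis by (simp add: transition_def Z_nonpos prob_space)
    qed simp
  qed
  also have "\<dots> = of_real h * f y" using h by (simp add: integral_complex_of_real)
  also have "(LINT t|lborel. of_real (indicator {h..} t) * ?\<phi> t) = (LINT t|lborel. of_real (indicator {h..} (h + 1 * t)) * ?\<phi> (h + 1 * t))"
    by (subst lborel_integral_real_affine[where c=1 and t=h]) simp_all
  also have "\<dots> = (LINT t|lborel. of_real (indicator {0..} t * exp (- m * (grid h t + h))) * transition (grid h t + h) f y)"
  proof (intro Bochner_Integration.integral_cong refl)
    fix t :: real
    have "grid h (h + 1 * t) = grid h t + h" using grid_add[OF h, of 1 t] by simp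
    thus "of_real (indicator {h..} (h + 1 * t)) * ?\<phi> (h + 1 * t) = of_real (indicator {0..} t * exp (- m * (grid h t + h))) * transition (grid h t + h) f y"
      by (auto split: split_indicator)
  qed
  finally show ?thesis .
qed

text \<open>The starting point varies together with the mesh, because the potential will be
  evaluated at first passage positions that depend on the mesh. Continuity of \<open>f\<close> is
  used for both limits; the cell split off before contributes O(h).\<close>

lemma grid_potential_tendsto:
  fixes f :: "'a \<Rightarrow> complex"
  assumes m: "m > 0" and f: "continuous_on UNIV f" and B: "\<And>y. norm (f y) \<le> B" and y: "y \<longlonglongrightarrow> y0"
  shows "(\<lambda>n. grid_potential m (1 / real (Suc n)) f (y n)) \<longlonglongrightarrow> potential m f y0"
proof -
  let ?h = "\<lambda>n. 1 / real (Suc n)"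
  have f_meas [measurable]: "f \<in> borel_measurable borel" using f by (rule borel_measurable_continuous_onI)
  have f_lim: "(\<lambda>n. f (u n)) \<longlonglongrightarrow> f v" if "u \<longlonglongrightarrow> v" for u v
    using f that by (auto simp: continuous_on_eq_continuous_at intro: isCont_tendsto_compose)
  have g: "grid (?h n) t + ?h n \<ge> t" for n t by (rule grid_upper_ge)
  have h0: "?h \<longlonglongrightarrow> 0" using LIMSEQ_inverse_real_of_nat by (simp add: inverse_eq_divide)
  have trans: "(\<lambda>n. transition (grid (?h n) t + ?h n) f (y n)) \<longlonglongrightarrow> transition t f y0" for t
    unfolding transition_def
  proof (rule integral_dominated_convergence)
    show "AE \<omega> in M. (\<lambda>n. f (y n + Z (grid (?h n) t + ?h n) \<omega>)) \<longlonglongrightarrow> f (y0 + Z t \<omega>)"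
      by (intro AE_I2 f_lim tendsto_add y Z_grid_tendsto)
    show "integrable M (\<lambda>\<omega>. B)" by simp
  qed (use B in auto)
  have tm: "(\<lambda>t. transition (grid (?h n) t + ?h n) f (y n)) \<in> borel_measurable borel" for n
    unfolding transition_def by measurable
  have "(\<lambda>n. LINT t|lborel. of_real (indicator {0..} t * exp (- m * (grid (?h n) t + ?h n))) * transition (grid (?h n) t + ?h n) f (y n))
     \<longlonglongrightarrow> (LINT t|lborel. of_real (indicator {0..} t * exp (- m * t)) * transition t f y0)"
  proof (rule integral_dominated_convergence)
    have [measurable]: "(\<lambda>t. transition t f y0) \<in> borel_measurable borel"
      unfolding transition_def by measurable
    show "(\<lambda>t. of_real (indicator {0..} t * exp (- m * t)) * transition t f y0) \<in> borel_measurable lborel" by measurable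
    show "(\<lambda>t. of_real (indicator {0..} t * exp (- m * (grid (?h n) t + ?h n))) * transition (grid (?h n) t + ?h n) f (y n)) \<in> borel_measurable lborel" for n
      using tm[of n] by measurable
    show "integrable lborel (\<lambda>t. indicator {0..} t * exp (- m * t) * B)" using integrable_exp_decay[OF m] by simp
    show "AE t in lborel. (\<lambda>n. of_real (indicator {0..} t * exp (- m * (grid (?h n) t + ?h n))) * transition (grid (?h n) t + ?h n) f (y n))
       \<longlonglongrightarrow> of_real (indicator {0..} t * exp (- m * t)) * transition t f y0"
      by (intro AE_I2 tendsto_mult tendsto_of_real tendsto_const tendsto_exp grid_upper_tendsto trans)
    show "AE t in lborel. norm (of_real (indicator {0..} t * exp (- m * (grid (?h n) t + ?h n))) * transition (grid (?h n) t + ?h n) f (y n))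
       \<le> indicator {0..} t * exp (- m * t) * B" for n
    proof (rule AE_I2)
      fix t :: real
      have "exp (- m * (grid (?h n) t + ?h n)) \<le> exp (- m * t)" using g[of t n] m by simp
      thus "norm (of_real (indicator {0..} t * exp (- m * (grid (?h n) t + ?h n))) * transition (grid (?h n) t + ?h n) f (y n))
       \<le> indicator {0..} t * exp (- m * t) * B"
        using norm_transition[OF f_meas B, of "grid (?h n) t + ?h n" "y n"]
        by (auto simp: norm_mult split: split_indicator intro!: mult_mono)
    qed
  qed
  moreover have "(\<lambda>n. of_real (?h n) * f (y n)) \<longlonglongrightarrow> of_real 0 * f y0"
    by (intro tendsto_mult tendsto_of_real h0 f_lim y)
  ultimately have "(\<lambda>n. of_real (?h n) * f (y n) + (LINT t|lborel. of_real (indicator {0..} t * exp (- m * (grid (?h n) t + ?h n))) * transition (grid (?h n) t + ?h n) f (y n)))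
    \<longlonglongrightarrow> of_real 0 * f y0 + potential m f y0"
    unfolding potential_def by (intro tendsto_add)
  moreover have "?h n > 0" for n by simp
  ultimately show ?thesis
    using grid_potential_shift[OF _ m f_meas B] by (simp del: of_nat_Suc)
qed

end

section \<open>The hitting time of a half-space\<close>

context regular_levy
begin

section \<open>Hitting times and their grid approximations\<close>

definition hits :: "'a \<Rightarrow> 'a \<Rightarrow> 'w \<Rightarrow> bool" where
  "hits l x \<omega> \<longleftrightarrow> (\<exists>t\<ge>0. (x + Z t \<omega>) \<bullet> l < 0)"

text \<open>The value 0 on paths that never hit keeps the time real; the indicator of
  \<open>hits\<close> accompanies it in every expectation.\<close>

definition hit_time :: "'a \<Rightarrow> 'a \<Rightarrow> 'w \<Rightarrow> real" where
  "hit_time l x \<omega> = (if hits l x \<omega> then Inf {t. 0 \<le> t \<and> (x + Z t \<omega>) \<bullet> l < 0} else 0)"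

definition grid_hits :: "'a \<Rightarrow> 'a \<Rightarrow> nat \<Rightarrow> 'w \<Rightarrow> bool" where
  "grid_hits l x n \<omega> \<longleftrightarrow> (\<exists>k. (x + Z (real k * (1 / real (Suc n))) \<omega>) \<bullet> l < 0)"

definition grid_hit_time :: "'a \<Rightarrow> 'a \<Rightarrow> nat \<Rightarrow> 'w \<Rightarrow> real" where
  "grid_hit_time l x n \<omega> = real (LEAST k. (x + Z (real k * (1 / real (Suc n))) \<omega>) \<bullet> l < 0) * (1 / real (Suc n))"

lemma hit_time_le: "t \<ge> 0 \<Longrightarrow> (x + Z t \<omega>) \<bullet> l < 0 \<Longrightarrow> hits l x \<omega> \<and> hit_time l x \<omega> \<le> t"
  unfolding hit_time_def hits_def by (auto intro!: cInf_lower bdd_belowI[of _ 0])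

lemma hit_time_nonneg: "hit_time l x \<omega> \<ge> 0"
  unfolding hit_time_def hits_def by (auto intro!: cInf_greatest)

lemma grid_hit_time_neg: "grid_hits l x n \<omega> \<Longrightarrow> (x + Z (grid_hit_time l x n \<omega>) \<omega>) \<bullet> l < 0"
  unfolding grid_hits_def grid_hit_time_def by (rule LeastI_ex)

lemma grid_hit_time_nonneg: "grid_hit_time l x n \<omega> \<ge> 0"
  unfolding grid_hit_time_def by simp

lemma grid_hits_imp: "grid_hits l x n \<omega> \<Longrightarrow> hits l x \<omega> \<and> hit_time l x \<omega> \<le> grid_hit_time l x n \<omega>"
  using hit_time_le[OF grid_hit_time_nonneg grid_hit_time_neg] .

text \<open>This is where openness matters: right after a visit to the open half-space the path
  remains there for an interval, and a fine enough grid has a point in that interval.\<close>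

lemma grid_hits_eventually:
  assumes hits: "hits l x \<omega>" and e: "e > 0"
  shows "\<forall>\<^sub>F n in sequentially. grid_hits l x n \<omega> \<and> grid_hit_time l x n \<omega> < hit_time l x \<omega> + e"
proof -
  have "{t. 0 \<le> t \<and> (x + Z t \<omega>) \<bullet> l < 0} \<noteq> {}" using hits by (auto simp: hits_def)
  moreover have "Inf {t. 0 \<le> t \<and> (x + Z t \<omega>) \<bullet> l < 0} < hit_time l x \<omega> + e"
    using hits e by (simp add: hit_time_def)
  ultimately obtain t where t: "0 \<le> t" "(x + Z t \<omega>) \<bullet> l < 0" "t < hit_time l x \<omega> + e"
    using cInf_lessD by (metis (mono_tags, lifting) mem_Collect_eq)
  have "((\<lambda>s. (x + Z s \<omega>) \<bullet> l) \<longlongrightarrow> (x + Z t \<omega>) \<bullet> l) (at_right t)"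
    by (intro tendsto_intros Z_right)
  hence "\<forall>\<^sub>F s in at_right t. (x + Z s \<omega>) \<bullet> l < 0"
    using t(2) by (rule order_tendstoD)
  then obtain b where b: "b > t" "\<And>s. t < s \<Longrightarrow> s < b \<Longrightarrow> (x + Z s \<omega>) \<bullet> l < 0"
    unfolding eventually_at_right_field by auto
  \<comment> \<open>A mesh below this bound places the right end point of the cell of
    \<open>t\<close> both inside the interval of visits and before
    \<open>hit_time l x \<omega> + e\<close>.\<close>
  let ?d = "min (b - t) (hit_time l x \<omega> + e - t)"
  have "?d > 0" using b t by simp
  moreover have "(\<lambda>n. 1 / real (Suc n)) \<longlonglongrightarrow> 0" using LIMSEQ_inverse_real_of_nat by (simp add: inverse_eq_divide)
  ultimately have "\<forall>\<^sub>F n in sequentially. 1 / real (Suc n) < ?d" by (rule order_tendstoD(2)[rotated])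
  thus ?thesis
  proof eventually_elim
    case (elim n)
    let ?h = "1 / real (Suc n)"
    have h: "?h > 0" by simp
    obtain j where j: "grid ?h t = real j * ?h" using grid_eq_nat[OF h t(1)] .
    have s: "grid ?h t + ?h > t" "grid ?h t + ?h \<le> t + ?h" using grid_bounds[OF h, of t] by linarith+
    have eq: "grid ?h t + ?h = real (Suc j) * ?h" unfolding j by (simp add: field_simps)
    have neg: "(x + Z (real (Suc j) * ?h) \<omega>) \<bullet> l < 0"
      unfolding eq[symmetric] using s elim by (intro b(2)) linarith+
    hence gh: "grid_hits l x n \<omega>" unfolding grid_hits_def by blast
    have "(LEAST k. (x + Z (real k * ?h) \<omega>) \<bullet> l < 0) \<le> Suc j" using neg by (rule Least_le)
    hence "grid_hit_time l x n \<omega> \<le> real (Suc j) * ?h" unfolding grid_hit_time_def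
      by (intro mult_right_mono) (simp_all del: of_nat_Suc)
    also have "\<dots> \<le> t + ?h" using s eq by linarith
    also have "\<dots> < hit_time l x \<omega> + e" using elim by linarith
    finally show ?case using gh by simp
  qed
qed

lemma grid_hit_time_tendsto:
  assumes hits: "hits l x \<omega>"
  shows "(\<lambda>n. grid_hit_time l x n \<omega>) \<longlonglongrightarrow> hit_time l x \<omega>"
proof (rule order_tendstoI)
  have ev: "\<forall>\<^sub>F n in sequentially. grid_hits l x n \<omega>"
    using grid_hits_eventually[OF hits, of 1] by (auto elim: eventually_mono)
  fix a assume "a < hit_time l x \<omega>"
  thus "\<forall>\<^sub>F n in sequentially. a < grid_hit_time l x n \<omega>"
    using ev by (auto elim!: eventually_mono dest!: grid_hits_imp)
next
  fix a assume "hit_time l x \<omega> < a"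
  thus "\<forall>\<^sub>F n in sequentially. grid_hit_time l x n \<omega> < a"
    using grid_hits_eventually[OF hits, of "a - hit_time l x \<omega>"] by (auto elim!: eventually_mono)
qed

text \<open>Grid hitting times approach the hitting time from the right, so right continuity gives
  convergence of the positions. The second branch only fills in the finitely many meshes that miss
  the visit, where the least index is unspecified.\<close>

lemma Z_grid_hit_time_tendsto:
  assumes hits: "hits l x \<omega>"
  shows "(\<lambda>n. if grid_hits l x n \<omega> then Z (grid_hit_time l x n \<omega>) \<omega> else Z (hit_time l x \<omega>) \<omega>) \<longlonglongrightarrow> Z (hit_time l x \<omega>) \<omega>"
proof -
  have ev: "\<forall>\<^sub>F n in sequentially. grid_hits l x n \<omega>"
    using grid_hits_eventually[OF hits, of 1] by (auto elim: eventually_mono)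
  \<comment> \<open>The maximum puts every member of the sequence at or after the hitting time;
    eventually it is the grid time itself.\<close>
  have "(\<lambda>n. Z (max (hit_time l x \<omega>) (grid_hit_time l x n \<omega>)) \<omega>) \<longlonglongrightarrow> Z (hit_time l x \<omega>) \<omega>"
  proof (rule Z_tendsto)
    show "(\<lambda>n. max (hit_time l x \<omega>) (grid_hit_time l x n \<omega>)) \<longlonglongrightarrow> hit_time l x \<omega>"
      using tendsto_max[OF tendsto_const[of "hit_time l x \<omega>"] grid_hit_time_tendsto[OF hits]] by simp
  qed simp
  moreover have "\<forall>\<^sub>F n in sequentially. Z (max (hit_time l x \<omega>) (grid_hit_time l x n \<omega>)) \<omega> =
     (if grid_hits l x n \<omega> then Z (grid_hit_time l x n \<omega>) \<omega> else Z (hit_time l x \<omega>) \<omega>)"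
    using ev by eventually_elim (use grid_hits_imp in \<open>auto simp: max_def intro: antisym\<close>)
  ultimately show ?thesis by (rule Lim_transform_eventually)
qed

text \<open>Limits of strictly negative values may vanish: at the infimum the path can sit on the
  boundary. The formulas for exponentials below therefore have to cover the value 0.\<close>

lemma hit_position:
  assumes hits: "hits l x \<omega>"
  shows "(x + Z (hit_time l x \<omega>) \<omega>) \<bullet> l \<le> 0"
proof (rule tendsto_upperbound)
  show "(\<lambda>n. (x + (if grid_hits l x n \<omega> then Z (grid_hit_time l x n \<omega>) \<omega> else Z (hit_time l x \<omega>) \<omega>)) \<bullet> l) \<longlonglongrightarrow> (x + Z (hit_time l x \<omega>) \<omega>) \<bullet> l"
    by (intro tendsto_intros Z_grid_hit_time_tendsto hits)
  have "\<forall>\<^sub>F n in sequentially. grid_hits l x n \<omega>"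
    using grid_hits_eventually[OF hits, of 1] by (auto elim: eventually_mono)
  thus "\<forall>\<^sub>F n in sequentially. (x + (if grid_hits l x n \<omega> then Z (grid_hit_time l x n \<omega>) \<omega> else Z (hit_time l x \<omega>) \<omega>)) \<bullet> l \<le> 0"
    by eventually_elim (use grid_hit_time_neg in \<open>auto intro: less_imp_le\<close>)
qed simp

lemma measurable_grid_hits [measurable]: "Measurable.pred M (grid_hits l x n)"
  unfolding grid_hits_def by measurable

lemma measurable_grid_hit_time [measurable]: "grid_hit_time l x n \<in> borel_measurable M"
  unfolding grid_hit_time_def by measurable

text \<open>Replaces the uncountable union over times by a countable one, from which measurability
  of the event follows.\<close>

lemma hits_iff: "hits l x \<omega> \<longleftrightarrow> (\<exists>n. grid_hits l x n \<omega>)"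
proof
  assume "hits l x \<omega>"
  hence "\<forall>\<^sub>F n in sequentially. grid_hits l x n \<omega>"
    using grid_hits_eventually[of l x \<omega> 1] by (auto elim: eventually_mono)
  thus "\<exists>n. grid_hits l x n \<omega>" by (auto simp: eventually_sequentially)
qed (auto dest: grid_hits_imp)

lemma measurable_hits [measurable]: "Measurable.pred M (hits l x)"
  unfolding hits_iff by measurable

lemma measurable_hit_time [measurable]: "hit_time l x \<in> borel_measurable M"
proof (rule borel_measurable_LIMSEQ_metric)
  show "(\<lambda>\<omega>. of_bool (hits l x \<omega>) * grid_hit_time l x n \<omega>) \<in> borel_measurable M" for n
    by measurable
  show "(\<lambda>n. of_bool (hits l x \<omega>) * grid_hit_time l x n \<omega>) \<longlonglongrightarrow> hit_time l x \<omega>" for \<omega>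
    using grid_hit_time_tendsto[of l x \<omega>] by (cases "hits l x \<omega>") (auto simp: hit_time_def)
qed

text \<open>Discretising time turns the hitting time into a first passage time of a random walk, for which the strong Markov
  property is elementary; right continuity of the paths removes the discretisation.\<close>

theorem potential_hitting_identity:
  fixes f :: "'a \<Rightarrow> complex"
  assumes m: "m > 0" and f: "continuous_on UNIV f" and B: "\<And>y. norm (f y) \<le> B" and f0: "\<And>y. y \<bullet> l \<ge> 0 \<Longrightarrow> f y = 0"
  shows "potential m f x = (LINT \<omega>|M. of_bool (hits l x \<omega>) *
    (of_real (exp (- m * hit_time l x \<omega>)) * potential m f (x + Z (hit_time l x \<omega>) \<omega>)))"
proof -
  let ?h = "\<lambda>n. 1 / real (Suc n)"
  have f_meas [measurable]: "f \<in> borel_measurable borel" using f by (rule borel_measurable_continuous_onI)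
  have h: "?h n > 0" for n by simp
  have B0: "B \<ge> 0" using B norm_ge_zero order_trans by blast
  define W where "W n \<omega> = of_bool (grid_hits l x n \<omega>) * (of_real (exp (- m * grid_hit_time l x n \<omega>)) *
      grid_potential m (?h n) f (x + Z (grid_hit_time l x n \<omega>) \<omega>))" for n \<omega>
  have W_meas [measurable]: "W n \<in> borel_measurable M" for n
    unfolding W_def by measurable
  have id: "grid_potential m (?h n) f x = (LINT \<omega>|M. W n \<omega>)" for n
    unfolding W_def grid_hits_def grid_hit_time_def by (rule grid_hit_identity[OF h m f_meas B f0])
  \<comment> \<open>All meshes are at most 1, so the loss from rounding is at most
    \<open>exp m\<close>, uniformly in \<open>n\<close>; this gives the dominating constant.\<close>
  have bound: "(LINT t|lborel. indicator {0..} t * exp (- m * grid (?h n) t)) \<le> exp m * (LINT t|lborel. indicator {0..} t * exp (- m * t))" for n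
  proof -
    have "(LINT t|lborel. indicator {0..} t * exp (- m * grid (?h n) t)) \<le> (LINT t|lborel. exp m * (indicator {0..} t * exp (- m * t)))"
    proof (rule Bochner_Integration.integral_mono[OF integrable_exp_grid[OF m h] integrable_mult_right[OF integrable_exp_decay[OF m]]])
      fix t :: real
      have "?h n \<le> 1" by simp
      hence "t \<le> grid (?h n) t + 1" using grid_bounds[OF h, of n t] by linarith
      hence "m * t \<le> m * (grid (?h n) t + 1)" using m by (intro mult_left_mono) auto
      hence "exp (- m * grid (?h n) t) \<le> exp m * exp (- m * t)"
        by (simp add: exp_add[symmetric] algebra_simps)
      thus "indicator {0..} t * exp (- m * grid (?h n) t) \<le> exp m * (indicator {0..} t * exp (- m * t))"
        by (auto split: split_indicator)
    qed
    thus ?thesis by simp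
  qed
  let ?C = "B * (exp m * (LINT t|lborel. indicator {0..} t * exp (- m * t)))"
  have C0: "?C \<ge> 0" using B0 by (intro mult_nonneg_nonneg Bochner_Integration.integral_nonneg) auto
  have gp: "norm (grid_potential m (?h n) f y) \<le> ?C" for n y
    using norm_grid_potential[OF f_meas B m h, of n y] mult_left_mono[OF bound[of n] B0] by linarith
  have "(\<lambda>n. LINT \<omega>|M. W n \<omega>) \<longlonglongrightarrow> (LINT \<omega>|M. of_bool (hits l x \<omega>) *
    (of_real (exp (- m * hit_time l x \<omega>)) * potential m f (x + Z (hit_time l x \<omega>) \<omega>)))"
  proof (rule integral_dominated_convergence)
    show "AE \<omega> in M. (\<lambda>n. W n \<omega>) \<longlonglongrightarrow> of_bool (hits l x \<omega>) * (of_real (exp (- m * hit_time l x \<omega>)) * potential m f (x + Z (hit_time l x \<omega>) \<omega>))"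
    proof (rule AE_I2)
      fix \<omega>
      show "(\<lambda>n. W n \<omega>) \<longlonglongrightarrow> of_bool (hits l x \<omega>) * (of_real (exp (- m * hit_time l x \<omega>)) * potential m f (x + Z (hit_time l x \<omega>) \<omega>))"
      proof (cases "hits l x \<omega>")
        case True
        have "(\<lambda>n. of_real (exp (- m * grid_hit_time l x n \<omega>)) * grid_potential m (?h n) f
           (x + (if grid_hits l x n \<omega> then Z (grid_hit_time l x n \<omega>) \<omega> else Z (hit_time l x \<omega>) \<omega>)))
          \<longlonglongrightarrow> of_real (exp (- m * hit_time l x \<omega>)) * potential m f (x + Z (hit_time l x \<omega>) \<omega>)"
          by (intro tendsto_intros grid_potential_tendsto[OF m f B] Z_grid_hit_time_tendsto grid_hit_time_tendsto True)
        moreover have "\<forall>\<^sub>F n in sequentially. grid_hits l x n \<omega>"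
          using grid_hits_eventually[OF True, of 1] by (auto elim: eventually_mono)
        hence "\<forall>\<^sub>F n in sequentially. of_real (exp (- m * grid_hit_time l x n \<omega>)) * grid_potential m (?h n) f
           (x + (if grid_hits l x n \<omega> then Z (grid_hit_time l x n \<omega>) \<omega> else Z (hit_time l x \<omega>) \<omega>)) = W n \<omega>"
          by eventually_elim (simp add: W_def)
        ultimately show ?thesis using True by (auto intro: Lim_transform_eventually)
      next
        case False
        hence "W n \<omega> = 0" for n using grid_hits_imp[of l x n \<omega>] by (auto simp: W_def)
        thus ?thesis using False by simp
      qed
    qed
    show "(\<lambda>\<omega>. of_bool (hits l x \<omega>) * (of_real (exp (- m * hit_time l x \<omega>)) * potential m f (x + Z (hit_time l x \<omega>) \<omega>))) \<in> borel_measurable M"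
      unfolding potential_def transition_def by measurable
    show "integrable M (\<lambda>\<omega>. ?C)" by simp
    show "AE \<omega> in M. norm (W n \<omega>) \<le> ?C" for n
    proof (rule AE_I2)
      fix \<omega>
      have "norm (W n \<omega>) \<le> 1 * (1 * ?C)" unfolding W_def norm_mult
        using gp m grid_hit_time_nonneg[of l x n \<omega>] C0 by (intro mult_mono) auto
      thus "norm (W n \<omega>) \<le> ?C" by simp
    qed
  qed measurable
  moreover have "(\<lambda>n. LINT \<omega>|M. W n \<omega>) \<longlonglongrightarrow> potential m f x"
    unfolding id[symmetric] by (rule grid_potential_tendsto[OF m f B tendsto_const])
  ultimately show ?thesis by (rule LIMSEQ_unique[rotated])
qed

end

section \<open>Wiener--Hopf factorization\<close>

text \<open>A test function on the negative half-line whose potential is explicit there: the fractional integral of order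
  \<open>1 - b\<close> of an exponential.\<close>

definition wh_test :: "real \<Rightarrow> real \<Rightarrow> real \<Rightarrow> real \<Rightarrow> complex" where
  "wh_test b w \<xi> u = (LINT q|lborel. of_real (indicator {0<..} q * q powr (- b) * exp (- w * q)) *
     (of_real (indicator {..<0} (u + q)) * iexp (\<xi> * (u + q))))"

lemma integrable_wh_weight:
  assumes "b < 1" "w > 0"
  shows "integrable lborel (\<lambda>q::real. indicator {0<..} q * q powr (- b) * exp (- w * q))"
  using gamma_integral_scaled[of "1 - b" w] assms by (auto intro: integrable.intros)

lemma norm_wh_test:
  assumes "b < 1" "w > 0"
  shows "norm (wh_test b w \<xi> u) \<le> (LINT q|lborel. indicator {0<..} q * q powr (- b) * exp (- w * q))"
  unfolding wh_test_def
  by (rule order_trans[OF integral_norm_bound integral_mono_AE'])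
     (use integrable_wh_weight[OF assms] in \<open>auto simp: norm_mult split: split_indicator\<close>)

lemma wh_test_nonneg: "u \<ge> 0 \<Longrightarrow> wh_test b w \<xi> u = 0"
proof -
  assume u: "u \<ge> 0"
  have "of_real (indicator {0<..} q * q powr (- b) * exp (- w * q)) *
     (of_real (indicator {..<0} (u + q)) * iexp (\<xi> * (u + q))) = (0 :: complex)" for q
    using u by (auto split: split_indicator)
  thus ?thesis unfolding wh_test_def by (simp only: integral_zero)
qed

text \<open>The hitting identity needs continuous test functions, and a truncated exponential jumps
  at 0. Integrating it against the weight q^(-b) exp(-w q) removes the jump, since for fixed
  \<open>u\<close> the discontinuity is met only at the single point q = -u.\<close>

lemma continuous_wh_test:
  assumes "b < 1" "w > 0"
  shows "continuous_on UNIV (wh_test b w \<xi>)"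
proof -
  have "(\<lambda>n. wh_test b w \<xi> (X n)) \<longlonglongrightarrow> wh_test b w \<xi> u" if X: "X \<longlonglongrightarrow> u" for X u
    unfolding wh_test_def
  proof (rule integral_dominated_convergence[OF _ _ integrable_wh_weight[OF assms]])
    have "AE q in lborel. q \<noteq> - u" by (rule AE_lborel_singleton)
    thus "AE q in lborel. (\<lambda>n. of_real (indicator {0<..} q * q powr (- b) * exp (- w * q)) *
       (of_real (indicator {..<0} (X n + q)) * iexp (\<xi> * (X n + q)))) \<longlonglongrightarrow>
       of_real (indicator {0<..} q * q powr (- b) * exp (- w * q)) *
       (of_real (indicator {..<0} (u + q)) * iexp (\<xi> * (u + q)))"
    proof eventually_elim
      case (elim q)
      have lim: "(\<lambda>n. X n + q) \<longlonglongrightarrow> u + q" by (intro tendsto_intros X)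
      have "(\<lambda>n. indicator {..<0} (X n + q) :: real) \<longlonglongrightarrow> indicator {..<0} (u + q)"
      proof (cases "u + q < 0")
        case True
        have "\<forall>\<^sub>F n in sequentially. X n + q < 0" by (rule order_tendstoD(2)[OF lim True])
        thus ?thesis using True by (intro tendsto_eventually) (auto elim!: eventually_mono)
      next
        case False
        hence "u + q > 0" using elim by linarith
        hence "\<forall>\<^sub>F n in sequentially. X n + q > 0" by (rule order_tendstoD(1)[OF lim])
        thus ?thesis using False by (intro tendsto_eventually) (auto elim!: eventually_mono)
      qed
      thus ?case by (intro tendsto_intros X)
    qed
  qed (auto simp: norm_mult split: split_indicator)
  thus ?thesis
    by (auto simp: continuous_on_sequentially comp_def)
qed

text \<open>For u < 0 the integration stops at p = -u, and this upper limit contributes exp(w u). It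
  is the reason why each test function links the frequency i\<xi> with the point w.\<close>

lemma integral_exp_truncated:
  fixes w \<xi> u :: real
  assumes w: "w > 0"
  shows "(LINT p|lborel. of_real (indicator {0<..} p * exp (- w * p)) * (of_real (indicator {..<0} (u + p)) * iexp (\<xi> * (u + p))))
    = of_real (indicator {..<0} u) * ((exp (\<i> * of_real \<xi> * of_real u) - exp (of_real w * of_real u)) / (of_real w - \<i> * of_real \<xi>))"
proof (cases "u < 0")
  case True
  let ?c = "\<i> * of_real \<xi> - of_real w :: complex"
  let ?F = "\<lambda>p::real. exp (\<i> * of_real \<xi> * of_real u) * exp (?c * of_real p) / ?c"
  let ?f = "\<lambda>p::real. exp (\<i> * of_real \<xi> * of_real u) * exp (?c * of_real p)"
  have c: "?c \<noteq> 0" using w by (auto simp: complex_eq_iff)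
  have "has_bochner_integral lborel (\<lambda>p. indicator {0..-u} p *\<^sub>R ?f p) (?F (-u) - ?F 0)"
  proof (rule has_bochner_integral_FTC_Icc)
    fix p :: real
    have "((\<lambda>p. ?F p) has_vector_derivative ?f p) (at p)"
      by (rule has_vector_derivative_real_field) (use c in \<open>auto intro!: derivative_eq_intros\<close>)
    thus "((\<lambda>p. ?F p) has_vector_derivative ?f p) (at p within {0..-u})" by (rule has_vector_derivative_at_within)
  qed (use True in \<open>auto intro!: continuous_intros\<close>)
  hence "(LINT p|lborel. indicator {0..-u} p *\<^sub>R ?f p) = ?F (-u) - ?F 0"
    by (rule has_bochner_integral_integral_eq)
  moreover have "(LINT p|lborel. indicator {0..-u} p *\<^sub>R ?f p) =
    (LINT p|lborel. of_real (indicator {0<..} p * exp (- w * p)) * (of_real (indicator {..<0} (u + p)) * iexp (\<xi> * (u + p))))"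
  proof (rule integral_cong_AE)
    have "AE p in lborel. p \<noteq> (0::real)" "AE p in lborel. p \<noteq> - u" by (rule AE_lborel_singleton)+
    thus "AE p in lborel. indicator {0..-u} p *\<^sub>R ?f p = of_real (indicator {0<..} p * exp (- w * p)) * (of_real (indicator {..<0} (u + p)) * iexp (\<xi> * (u + p)))"
    proof eventually_elim
      case (elim p)
      have "?f p = of_real (exp (- w * p)) * iexp (\<xi> * (u + p))"
        unfolding exp_of_real[symmetric] exp_add[symmetric] by (rule arg_cong[where f=exp]) (simp add: algebra_simps)
      thus ?case using elim by (auto split: split_indicator simp: scaleR_conv_of_real)
    qed
  qed auto
  moreover have "?F (-u) - ?F 0 = (exp (\<i> * of_real \<xi> * of_real u) - exp (of_real w * of_real u)) / (of_real w - \<i> * of_real \<xi>)"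
  proof -
    have "exp (\<i> * of_real \<xi> * of_real u) * exp (?c * of_real (-u)) = exp (of_real w * of_real u)"
      unfolding exp_add[symmetric] by (rule arg_cong[where f=exp]) (simp add: algebra_simps)
    hence "?F (-u) - ?F 0 = (exp (of_real w * of_real u) - exp (\<i> * of_real \<xi> * of_real u)) / ?c"
      by (simp add: diff_divide_distrib)
    also have "\<dots> = (exp (\<i> * of_real \<xi> * of_real u) - exp (of_real w * of_real u)) / (- ?c)"
      using minus_divide_divide[of "exp (\<i> * of_real \<xi> * of_real u) - exp (of_real w * of_real u)" "of_real w - \<i> * of_real \<xi>"] by simp
    finally show ?thesis by simp
  qed
  ultimately show ?thesis using True by simp
next
  case False
  hence "of_real (indicator {0<..} p * exp (- w * p)) * (of_real (indicator {..<0} (u + p)) * iexp (\<xi> * (u + p))) = (0::complex)" for p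
    by (auto split: split_indicator)
  hence "(LINT p|lborel. of_real (indicator {0<..} p * exp (- w * p)) * (of_real (indicator {..<0} (u + p)) * iexp (\<xi> * (u + p)))) = (0::complex)"
    by (simp only: integral_zero)
  thus ?thesis using False by simp
qed

section \<open>The gamma kernels acting on truncated exponentials\<close>

text \<open>The downward gamma kernel applied to the function exp(\<mu> u) restricted to u < 0,
  evaluated at \<open>y\<close>: a downward step \<open>s\<close> from \<open>y\<close> lands below
  0 exactly when \<open>s > y\<close>.\<close>

definition ladder_exp :: "real \<Rightarrow> real \<Rightarrow> complex \<Rightarrow> real \<Rightarrow> complex" where
  "ladder_exp b w \<mu> y = exp (\<mu> * y) * (LINT s|lborel. of_real (indicator {max 0 y<..} s * s powr (b - 1)) * exp (- (w + \<mu>) * of_real s))"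

lemma ladder_exp_nonpos: "y \<le> 0 \<Longrightarrow> ladder_exp b w \<mu> y = exp (\<mu> * y) * laplace_powr b (w + \<mu>)"
  by (simp add: ladder_exp_def laplace_powr_def max_absorb1)

text \<open>Compared with the formula for y \<le> 0, the exponential exp(\<mu> y) is replaced by its
  average over the profile placed on the negative half-line. The profile thus acts as the sweeping
  of the point y, which is what identifies it as the hitting law.\<close>

lemma ladder_exp_pos:
  assumes "0 < b" "b < 1" "w > 0" "y > 0" "Re \<mu> \<ge> 0"
  shows "ladder_exp b w \<mu> y = laplace_powr b (w + \<mu>) * (LINT v|lborel. of_real (poisson_profile b w y v) * exp (- \<mu> * of_real v))"
  using laplace_poisson_profile[OF assms(1-4), of \<mu>] assms by (simp add: ladder_exp_def max_absorb2)

text \<open>The upward steps \<open>r\<close> undo the fractional integral in \<open>wh_test\<close>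
  and leave a difference of two truncated exponentials; the downward steps \<open>s\<close> turn
  each of these into a \<open>ladder_exp\<close>.\<close>

lemma wh_potential_1d:
  fixes w \<xi> y :: real
  assumes b: "0 < b" "b < 1" and w: "w > 0"
  shows "(LINT s|lborel. of_real (indicator {0<..} s * s powr (b - 1) * exp (- w * s)) *
      (LINT r|lborel. of_real (indicator {0<..} r * r powr (b - 1) * exp (- w * r)) * wh_test b w \<xi> (y + (r - s))))
    = of_real (Gamma b * Gamma (1 - b)) / (of_real w - \<i> * of_real \<xi>) * (ladder_exp b w (\<i> * of_real \<xi>) y - ladder_exp b w (of_real w) y)"
proof -
  let ?H = "\<lambda>v. of_real (indicator {..<0} v) * iexp (\<xi> * v) :: complex"
  let ?K = "of_real (Gamma b * Gamma (1 - b)) / (of_real w - \<i> * of_real \<xi>) :: complex"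
  let ?S = "\<lambda>\<mu> s. of_real (indicator {max 0 y<..} s * s powr (b - 1)) * exp (- (of_real w + \<mu>) * of_real s) :: complex"
  have c: "of_real w - \<i> * of_real \<xi> \<noteq> (0::complex)" using w by (auto simp: complex_eq_iff)
  \<comment> \<open>The upward part: the orders b and 1 - b combine to one and the elementary
    truncated integral remains.\<close>
  have inner: "(LINT r|lborel. of_real (indicator {0<..} r * r powr (b - 1) * exp (- w * r)) * wh_test b w \<xi> (y + (r - s)))
    = ?K * (of_real (indicator {..<0} (y - s)) * (exp (\<i> * of_real \<xi> * of_real (y - s)) - exp (of_real w * of_real (y - s))))" for s
  proof -
    have "wh_test b w \<xi> (y + (r - s)) = (LINT q|lborel. of_real (indicator {0<..} q * q powr (- b) * exp (- w * q)) * ?H ((y - s) + (r + q)))" for r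
      unfolding wh_test_def by (simp add: algebra_simps)
    hence "(LINT r|lborel. of_real (indicator {0<..} r * r powr (b - 1) * exp (- w * r)) * wh_test b w \<xi> (y + (r - s))) =
      (LINT r|lborel. of_real (indicator {0<..} r * r powr (b - 1) * exp (- w * r)) *
      (LINT q|lborel. of_real (indicator {0<..} q * q powr (- b) * exp (- w * q)) * ?H ((y - s) + (r + q))))"
      by (simp only:)
    also have "\<dots> = of_real (Gamma b * Gamma (1 - b)) * (LINT p|lborel. of_real (indicator {0<..} p * exp (- w * p)) * ?H ((y - s) + p))"
      by (rule powr_semigroup_integral[OF b w, where B=1]) (auto simp: norm_mult split: split_indicator)
    also have "(LINT p|lborel. of_real (indicator {0<..} p * exp (- w * p)) * ?H ((y - s) + p)) =
       of_real (indicator {..<0} (y - s)) * ((exp (\<i> * of_real \<xi> * of_real (y - s)) - exp (of_real w * of_real (y - s))) / (of_real w - \<i> * of_real \<xi>))"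
      by (rule integral_exp_truncated[OF w])
    finally show ?thesis by simp
  qed
  have int: "integrable lborel (?S \<mu>)" if "Re \<mu> \<ge> 0" for \<mu>
  proof (rule Bochner_Integration.integrable_bound[OF integrable_laplace_powr[OF b(1), of "of_real w + \<mu>"]])
    show "0 < Re (of_real w + \<mu>)" using that w by simp
  qed (auto simp: norm_mult split: split_indicator)
  have pt: "of_real (indicator {0<..} s * s powr (b - 1) * exp (- w * s)) * (?K * (of_real (indicator {..<0} (y - s)) * (exp (\<i> * of_real \<xi> * of_real (y - s)) - exp (of_real w * of_real (y - s)))))
    = ?K * (exp (\<i> * of_real \<xi> * y) * ?S (\<i> * of_real \<xi>) s - exp (complex_of_real w * y) * ?S (of_real w) s)" for s
  proof (cases "s > max 0 y")
    case True
    have e: "of_real (exp (- w * s)) * exp (\<mu> * of_real (y - s)) = exp (\<mu> * y) * exp (- (of_real w + \<mu>) * of_real s)" for \<mu> :: complex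
      unfolding exp_of_real[symmetric] exp_add[symmetric] by (rule arg_cong[where f=exp]) (simp add: algebra_simps)
    have "of_real (indicator {0<..} s * s powr (b - 1) * exp (- w * s)) * (?K * (of_real (indicator {..<0} (y - s)) * (exp (\<i> * of_real \<xi> * of_real (y - s)) - exp (of_real w * of_real (y - s)))))
     = ?K * of_real (s powr (b - 1)) * (of_real (exp (- w * s)) * exp (\<i> * of_real \<xi> * of_real (y - s)) - of_real (exp (- w * s)) * exp (of_real w * of_real (y - s)))"
      using True by (simp add: algebra_simps)
    also have "\<dots> = ?K * of_real (s powr (b - 1)) * (exp (\<i> * of_real \<xi> * y) * exp (- (of_real w + \<i> * of_real \<xi>) * of_real s) -
        exp (complex_of_real w * y) * exp (- (complex_of_real w + complex_of_real w) * complex_of_real s))"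
      unfolding e ..
    also have "\<dots> = ?K * (exp (\<i> * of_real \<xi> * y) * ?S (\<i> * of_real \<xi>) s - exp (complex_of_real w * y) * ?S (of_real w) s)"
      using True by (simp add: right_diff_distrib mult_ac)
    finally show ?thesis .
  qed (auto split: split_indicator)
  have "(LINT s|lborel. ?K * (exp (\<i> * of_real \<xi> * y) * ?S (\<i> * of_real \<xi>) s - exp (complex_of_real w * y) * ?S (of_real w) s))
    = ?K * (exp (\<i> * of_real \<xi> * y) * (LINT s|lborel. ?S (\<i> * of_real \<xi>) s) - exp (complex_of_real w * y) * (LINT s|lborel. ?S (of_real w) s))"
  proof -
    have i1: "integrable lborel (\<lambda>s. exp (\<i> * of_real \<xi> * y) * ?S (\<i> * of_real \<xi>) s)"
      by (intro integrable_mult_right int) simp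
    have i2: "integrable lborel (\<lambda>s. exp (complex_of_real w * y) * ?S (of_real w) s)"
      by (intro integrable_mult_right int) (use w in simp)
    show ?thesis by (simp only: integral_mult_right_zero Bochner_Integration.integral_diff[OF i1 i2])
  qed
  thus ?thesis unfolding inner pt ladder_exp_def .
qed

section \<open>Factorized resolvent and transform of the hitting law\<close>

text \<open>In the application \<open>b\<close> is \<alpha>/2, \<open>c\<close> is m^(1/\<alpha>)
  and \<open>l\<close> is the last coordinate vector, the normal that points into the upper
  half-space.\<close>

locale relativistic_regular = regular_levy M Z for M :: "'w measure" and Z :: "real \<Rightarrow> 'w \<Rightarrow> 'a::euclidean_space" +
  fixes m b c :: real and l :: 'a
  assumes m: "m > 0" and c: "c > 0" and b: "0 < b" "b < 1" and l: "norm l = 1"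
    and char: "\<And>t z. t \<ge> 0 \<Longrightarrow> (LINT \<omega>|M. iexp (z \<bullet> Z t \<omega>)) = of_real (exp (m * t) * exp (- t * ((norm z)\<^sup>2 + c\<^sup>2) powr b))"
begin

definition width :: "'a \<Rightarrow> real" where "width z = sqrt ((norm z)\<^sup>2 + c\<^sup>2)"

lemma width_pos: "width z > 0"
  unfolding width_def using c by (simp add: add_nonneg_pos)

text \<open>Integrating out time gives (w^2 + \<xi>^2)^(-b) with \<open>w = width z\<close>, since
  \<open>z\<close> and \<open>l\<close> are orthogonal. For p = w - i\<xi> this is |p|^(-2b), the
  product of the conjugate powers p^(-b) and (cnj p)^(-b), and each factor is a normalised gamma
  transform.\<close>

lemma resolvent_factorization:
  assumes z: "z \<bullet> l = 0"
  shows "(LINT t|lborel. of_real (indicator {0..} t * exp (- m * t)) * (LINT \<omega>|M. iexp ((z + \<xi> *\<^sub>R l) \<bullet> Z t \<omega>)))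
    = laplace_powr b (of_real (width z) - \<i> * of_real \<xi>) * laplace_powr b (of_real (width z) + \<i> * of_real \<xi>) / of_real ((Gamma b)\<^sup>2)"
proof -
  let ?w = "width z" and ?p = "of_real (width z) - \<i> * of_real \<xi> :: complex"
  let ?q = "((norm (z + \<xi> *\<^sub>R l))\<^sup>2 + c\<^sup>2) powr b"
  have norm: "(norm (z + \<xi> *\<^sub>R l))\<^sup>2 + c\<^sup>2 = ?w\<^sup>2 + \<xi>\<^sup>2"
    using z l by (simp add: width_def power2_norm_eq_inner inner_add_left inner_add_right inner_commute[of l z] power2_eq_square[of \<xi>] norm_eq_1)
  have pos: "?w\<^sup>2 + \<xi>\<^sup>2 > 0" using width_pos[of z] by (simp add: add_pos_nonneg)
  hence q: "?q > 0" unfolding norm using width_pos[of z] by simp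
  have "(LINT t|lborel. of_real (indicator {0..} t * exp (- m * t)) * (LINT \<omega>|M. iexp ((z + \<xi> *\<^sub>R l) \<bullet> Z t \<omega>)))
    = (LINT t|lborel. complex_of_real (indicator {0<..} t * t powr (1 - 1) * exp (- ?q * t)))"
  proof (rule integral_cong_AE)
    have "AE t in lborel. t \<noteq> (0::real)" by (rule AE_lborel_singleton)
    thus "AE t in lborel. of_real (indicator {0..} t * exp (- m * t)) * (LINT \<omega>|M. iexp ((z + \<xi> *\<^sub>R l) \<bullet> Z t \<omega>))
       = complex_of_real (indicator {0<..} t * t powr (1 - 1) * exp (- ?q * t))"
    proof eventually_elim
      case (elim t)
      show ?case
      proof (cases "t > 0")
        case True
        have "exp (- m * t) * (exp (m * t) * exp (- t * ?q)) = exp (- ?q * t)"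
          by (simp add: exp_add[symmetric])
        thus ?thesis using True char[of t "z + \<xi> *\<^sub>R l"] by (simp flip: of_real_mult)
      qed (use elim in auto)
    qed
  qed measurable
  also have "\<dots> = of_real (?q powr (-1))"
    unfolding integral_complex_of_real using has_bochner_integral_integral_eq[OF gamma_integral_scaled[of 1 ?q]] q by simp
  also have "?q powr (-1) = 1 / (?w\<^sup>2 + \<xi>\<^sup>2) powr b"
    unfolding norm using pos width_pos[of z] by (simp add: powr_powr powr_minus divide_inverse)
  finally have lhs: "(LINT t|lborel. of_real (indicator {0..} t * exp (- m * t)) * (LINT \<omega>|M. iexp ((z + \<xi> *\<^sub>R l) \<bullet> Z t \<omega>)))
    = of_real (1 / (?w\<^sup>2 + \<xi>\<^sup>2) powr b)" .
  have p1: "laplace_powr b ?p * ?p powr of_real b = Gamma b"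
    by (rule laplace_powr_eq) (use b width_pos in auto)
  have p2: "laplace_powr b (cnj ?p) * (cnj ?p) powr of_real b = Gamma b"
    by (rule laplace_powr_eq) (use b width_pos in auto)
  have "cnj (?p powr of_real b) = (cnj ?p) powr of_real b"
    by (subst cnj_powr) (use width_pos[of z] in auto)
  hence "?p powr of_real b * (cnj ?p) powr of_real b = of_real ((norm (?p powr of_real b))\<^sup>2)"
    using complex_norm_square[of "?p powr of_real b"] by simp
  also have "norm (?p powr of_real b) = norm ?p powr b" by (simp add: norm_powr_real_powr')
  also have "norm ?p = sqrt (?w\<^sup>2 + \<xi>\<^sup>2)" by (simp add: cmod_def)
  also have "(sqrt (?w\<^sup>2 + \<xi>\<^sup>2) powr b)\<^sup>2 = (?w\<^sup>2 + \<xi>\<^sup>2) powr b"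
    using pos by (simp add: powr_half_sqrt[symmetric] powr_powr power2_eq_square powr_add[symmetric])
  finally have pp: "?p powr of_real b * (cnj ?p) powr of_real b = of_real ((?w\<^sup>2 + \<xi>\<^sup>2) powr b)" .
  have "laplace_powr b ?p * laplace_powr b (cnj ?p) * (?p powr of_real b * (cnj ?p) powr of_real b) = of_real ((Gamma b)\<^sup>2)"
    using p1 p2 by (simp add: power2_eq_square mult_ac)
  hence "laplace_powr b ?p * laplace_powr b (cnj ?p) * of_real ((?w\<^sup>2 + \<xi>\<^sup>2) powr b) = of_real ((Gamma b)\<^sup>2)"
    unfolding pp .
  moreover have "(?w\<^sup>2 + \<xi>\<^sup>2) powr b \<noteq> 0" "(Gamma b)\<^sup>2 \<noteq> 0" using pos width_pos[of z] Gamma_real_pos[OF b(1)] by auto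
  moreover have "cnj ?p = of_real ?w + \<i> * of_real \<xi>" by simp
  ultimately show ?thesis unfolding lhs by (simp add: field_simps)
qed

text \<open>Once the tangential oscillation is moved into the weight, the resolvent and the product
  of gamma kernels are two complex measures on the line with the same Fourier transform in \<xi>.
  \<open>fourier_determines\<close> then evaluates the potential for every bounded continuous
  \<open>g\<close>.\<close>

lemma potential_product_exp:
  fixes g :: "real \<Rightarrow> complex"
  assumes z: "z \<bullet> l = 0" and g: "continuous_on UNIV g" and B: "\<And>u. norm (g u) \<le> B"
  shows "potential m (\<lambda>u. iexp (z \<bullet> u) * g (u \<bullet> l)) y = iexp (z \<bullet> y) / of_real ((Gamma b)\<^sup>2) *
    (LINT s|lborel. of_real (indicator {0<..} s * s powr (b - 1) * exp (- width z * s)) *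
      (LINT r|lborel. of_real (indicator {0<..} r * r powr (b - 1) * exp (- width z * r)) * g (y \<bullet> l + (r - s))))"
proof -
  let ?a = "\<lambda>t. indicator {0..} t * exp (- m * t) :: real"
  let ?v = "\<lambda>r. complex_of_real (indicator {0<..} r * r powr (b - 1) * exp (- width z * r))"
  interpret P: pair_sigma_finite M "lborel :: real measure" ..
  have a: "integrable lborel ?a" by (rule integrable_exp_decay[OF m])
  have v: "integrable lborel ?v"
    using gamma_integral_scaled[OF b(1) width_pos[of z]] by (auto intro!: integrable_of_real simp del: of_real_mult intro: integrable.intros)
  have [measurable]: "g \<in> borel_measurable borel" using g by (rule borel_measurable_continuous_onI)
  \<comment> \<open>\<open>c1\<close> and \<open>\<phi>1\<close> describe the discounted normal
    displacement of the process, weighted by the oscillation at frequency \<open>z\<close>;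
    \<open>c2\<close> and \<open>\<phi>2\<close> describe the difference of an upward and a downward
    gamma variable.\<close>
  define c1 where "c1 = (\<lambda>(\<omega>, t). of_real (?a t) * iexp (z \<bullet> Z t \<omega>))"
  define \<phi>1 where "\<phi>1 = (\<lambda>(\<omega>, t). Z t \<omega> \<bullet> l)"
  define c2 where "c2 = (\<lambda>(s, r). ?v s * ?v r / of_real ((Gamma b)\<^sup>2))"
  define \<phi>2 where "\<phi>2 = (\<lambda>(s, r). r - s :: real)"
  have em: "(\<lambda>(t, \<omega>). iexp (z' \<bullet> Z t \<omega>)) \<in> borel_measurable (borel \<Otimes>\<^sub>M M)" for z'
    by measurable
  have en: "norm (iexp (z' \<bullet> Z t \<omega>)) \<le> 1" for z' t \<omega>
    by simp
  have c1: "integrable (M \<Otimes>\<^sub>M lborel) c1"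
    unfolding c1_def by (rule time_integrable[OF a em en])
  have c2: "integrable (lborel \<Otimes>\<^sub>M lborel) c2"
    unfolding c2_def
  proof (rule lborel_pair.Fubini_integrable)
    show "(\<lambda>(s, r). ?v s * ?v r / of_real ((Gamma b)\<^sup>2)) \<in> borel_measurable (lborel \<Otimes>\<^sub>M lborel)" by measurable
    have "integrable lborel (\<lambda>s. norm (?v s) * (LINT r|lborel. norm (?v r)) / norm (complex_of_real ((Gamma b)\<^sup>2)))"
      using v by (intro integrable_divide integrable_mult_left integrable_norm) auto
    thus "integrable lborel (\<lambda>s. LINT r|lborel. norm (case (s, r) of (s, r) \<Rightarrow> ?v s * ?v r / of_real ((Gamma b)\<^sup>2)))"
      unfolding prod.case norm_divide norm_mult[of "?v _"] by simp
    show "AE s in lborel. integrable lborel (\<lambda>r. case (s, r) of (s, r) \<Rightarrow> ?v s * ?v r / of_real ((Gamma b)\<^sup>2))"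
      unfolding prod.case using v by (intro AE_I2 integrable_divide integrable_mult_right)
  qed
  have bnd: "norm (k (\<phi>2 p)) \<le> B \<Longrightarrow> B \<ge> 0 \<Longrightarrow> norm (c2 p * k (\<phi>2 p)) \<le> norm (B * norm (c2 p))" for k :: "real \<Rightarrow> complex" and p B
    using mult_left_mono[of "norm (k (\<phi>2 p))" B "norm (c2 p)"] by (simp add: norm_mult mult.commute)
  have iter: "(LINT p|(lborel \<Otimes>\<^sub>M lborel). c2 p * k (\<phi>2 p)) = (LINT s|lborel. ?v s * (LINT r|lborel. ?v r * k (r - s))) / of_real ((Gamma b)\<^sup>2)"
    if [measurable]: "k \<in> borel_measurable borel" and kB: "\<And>u. norm (k u) \<le> B'" for k :: "real \<Rightarrow> complex" and B'
  proof -
    have B0: "B' \<ge> 0" using kB norm_ge_zero order_trans by blast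
    have [measurable]: "c2 \<in> borel_measurable (lborel \<Otimes>\<^sub>M lborel)" using c2 by auto
    have [measurable]: "\<phi>2 \<in> borel_measurable (lborel \<Otimes>\<^sub>M lborel)" unfolding \<phi>2_def by measurable
    have "integrable (lborel \<Otimes>\<^sub>M lborel) (\<lambda>p. c2 p * k (\<phi>2 p))"
      by (rule Bochner_Integration.integrable_bound[OF integrable_mult_right[OF integrable_norm[OF c2], of B']])
         (measurable, intro AE_I2 bnd kB B0)
    from lborel_pair.integral_fst'[OF this]
    have "(LINT p|(lborel \<Otimes>\<^sub>M lborel). c2 p * k (\<phi>2 p)) = (LINT s|lborel. LINT r|lborel. c2 (s, r) * k (\<phi>2 (s, r)))" by simp
    also have "\<dots> = (LINT s|lborel. LINT r|lborel. ?v s / of_real ((Gamma b)\<^sup>2) * (?v r * k (r - s)))"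
      by (intro Bochner_Integration.integral_cong refl) (simp add: c2_def \<phi>2_def)
    also have "\<dots> = (LINT s|lborel. ?v s * (LINT r|lborel. ?v r * k (r - s)) / of_real ((Gamma b)\<^sup>2))"
      unfolding integral_mult_right_zero by (intro Bochner_Integration.integral_cong refl) simp
    finally show ?thesis by simp
  qed
  have main: "(LINT p|(M \<Otimes>\<^sub>M lborel). c1 p * g (y \<bullet> l + \<phi>1 p)) = (LINT p|(lborel \<Otimes>\<^sub>M lborel). c2 p * g (y \<bullet> l + \<phi>2 p))"
  proof (rule fourier_determines[where g="\<lambda>u. g (y \<bullet> l + u)"])
    show "sigma_finite_measure (M \<Otimes>\<^sub>M (lborel :: real measure))" ..
    show "sigma_finite_measure ((lborel :: real measure) \<Otimes>\<^sub>M (lborel :: real measure))" ..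
    show "\<phi>1 \<in> borel_measurable (M \<Otimes>\<^sub>M lborel)" unfolding \<phi>1_def by measurable
    show "\<phi>2 \<in> borel_measurable (lborel \<Otimes>\<^sub>M lborel)" unfolding \<phi>2_def by measurable
    show "continuous_on UNIV (\<lambda>u. g (y \<bullet> l + u))"
      by (rule continuous_on_compose2[OF g]) (auto intro!: continuous_intros)
    fix \<xi> :: real
    have "(LINT p|(M \<Otimes>\<^sub>M lborel). c1 p * iexp (\<xi> \<bullet> \<phi>1 p))
      = (LINT p|(M \<Otimes>\<^sub>M lborel). (\<lambda>(\<omega>, t). of_real (?a t) * iexp ((z + \<xi> *\<^sub>R l) \<bullet> Z t \<omega>)) p)"
      by (intro Bochner_Integration.integral_cong refl)
         (auto simp: c1_def \<phi>1_def mult.assoc exp_add[symmetric] inner_add_left inner_commute[of l] algebra_simps split: prod.split)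
    also have "\<dots> = (LINT \<omega>|M. LINT t|lborel. of_real (?a t) * iexp ((z + \<xi> *\<^sub>R l) \<bullet> Z t \<omega>))"
      by (subst P.integral_fst'[symmetric], rule time_integrable[OF a em en]) simp
    also have "\<dots> = (LINT t|lborel. of_real (?a t) * (LINT \<omega>|M. iexp ((z + \<xi> *\<^sub>R l) \<bullet> Z t \<omega>)))"
      by (rule time_fubini[OF a em en])
    also have "\<dots> = laplace_powr b (of_real (width z) - \<i> * of_real \<xi>) * laplace_powr b (of_real (width z) + \<i> * of_real \<xi>) / of_real ((Gamma b)\<^sup>2)"
      by (rule resolvent_factorization[OF z])
    also have "\<dots> = (LINT s|lborel. ?v s * (LINT r|lborel. ?v r * iexp (\<xi> * (r - s)))) / of_real ((Gamma b)\<^sup>2)"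
    proof -
      have e: "?v r * iexp (\<xi> * r) = of_real (indicator {0<..} r * r powr (b - 1)) * exp (- (of_real (width z) - \<i> * of_real \<xi>) * of_real r)"
        and e': "?v r * exp (- (\<i> * of_real (\<xi> * r))) = of_real (indicator {0<..} r * r powr (b - 1)) * exp (- (of_real (width z) + \<i> * of_real \<xi>) * of_real r)" for r
      proof -
        have x: "complex_of_real (exp (- width z * r)) * iexp (\<xi> * r) = exp (- (of_real (width z) - \<i> * of_real \<xi>) * of_real r)"
          "complex_of_real (exp (- width z * r)) * exp (- (\<i> * of_real (\<xi> * r))) = exp (- (of_real (width z) + \<i> * of_real \<xi>) * of_real r)"
          unfolding exp_of_real[symmetric] exp_add[symmetric] by (rule arg_cong[where f=exp], simp add: algebra_simps)+
        show "?v r * iexp (\<xi> * r) = of_real (indicator {0<..} r * r powr (b - 1)) * exp (- (of_real (width z) - \<i> * of_real \<xi>) * of_real r)"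
          "?v r * exp (- (\<i> * of_real (\<xi> * r))) = of_real (indicator {0<..} r * r powr (b - 1)) * exp (- (of_real (width z) + \<i> * of_real \<xi>) * of_real r)"
          unfolding x[symmetric] of_real_mult by (simp_all only: mult.assoc)
      qed
      have "?v r * iexp (\<xi> * (r - s)) = exp (- (\<i> * of_real (\<xi> * s))) * (?v r * iexp (\<xi> * r))" for r s
        by (simp add: exp_add[symmetric] exp_diff[symmetric] algebra_simps)
      hence "(LINT r|lborel. ?v r * iexp (\<xi> * (r - s))) = exp (- (\<i> * of_real (\<xi> * s))) * laplace_powr b (of_real (width z) - \<i> * of_real \<xi>)" for s
        unfolding laplace_powr_def e[symmetric] by (simp only: integral_mult_right_zero)
      hence "(LINT s|lborel. ?v s * (LINT r|lborel. ?v r * iexp (\<xi> * (r - s))))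
        = (LINT s|lborel. (?v s * exp (- (\<i> * of_real (\<xi> * s)))) * laplace_powr b (of_real (width z) - \<i> * of_real \<xi>))"
        by (simp only: mult.assoc)
      also have "\<dots> = laplace_powr b (of_real (width z) + \<i> * of_real \<xi>) * laplace_powr b (of_real (width z) - \<i> * of_real \<xi>)"
        unfolding integral_mult_left_zero unfolding laplace_powr_def[of b "of_real (width z) + \<i> * of_real \<xi>"] e'[symmetric] ..
      finally show ?thesis by (simp add: mult.commute)
    qed
    also have "\<dots> = (LINT p|(lborel \<Otimes>\<^sub>M lborel). c2 p * iexp (\<xi> \<bullet> \<phi>2 p))"
      using iter[of "\<lambda>u. iexp (\<xi> * u)" 1] by simp
    finally show "(LINT p|(M \<Otimes>\<^sub>M lborel). c1 p * iexp (\<xi> \<bullet> \<phi>1 p)) = (LINT p|(lborel \<Otimes>\<^sub>M lborel). c2 p * iexp (\<xi> \<bullet> \<phi>2 p))" .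
  qed (use c1 c2 B in auto)
  have B0: "B \<ge> 0" using B norm_ge_zero order_trans by blast
  have eg: "norm (iexp (z \<bullet> Z t \<omega>) * g (y \<bullet> l + Z t \<omega> \<bullet> l)) \<le> B" for t \<omega> using B by (simp add: norm_mult)
  have egm: "(\<lambda>(t, \<omega>). iexp (z \<bullet> Z t \<omega>) * g (y \<bullet> l + Z t \<omega> \<bullet> l)) \<in> borel_measurable (borel \<Otimes>\<^sub>M M)"
    by measurable
  have "potential m (\<lambda>u. iexp (z \<bullet> u) * g (u \<bullet> l)) y
     = (LINT t|lborel. of_real (?a t) * (LINT \<omega>|M. iexp (z \<bullet> y) * (iexp (z \<bullet> Z t \<omega>) * g (y \<bullet> l + Z t \<omega> \<bullet> l))))"
    unfolding potential_def transition_def by (simp add: inner_add_right inner_add_left exp_add distrib_left mult.assoc)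
  also have "\<dots> = iexp (z \<bullet> y) * (LINT t|lborel. of_real (?a t) * (LINT \<omega>|M. iexp (z \<bullet> Z t \<omega>) * g (y \<bullet> l + Z t \<omega> \<bullet> l)))"
    unfolding integral_mult_right_zero by (subst integral_mult_right_zero[symmetric]) (simp only: mult_ac)
  also have "(LINT t|lborel. of_real (?a t) * (LINT \<omega>|M. iexp (z \<bullet> Z t \<omega>) * g (y \<bullet> l + Z t \<omega> \<bullet> l)))
    = (LINT \<omega>|M. LINT t|lborel. of_real (?a t) * (iexp (z \<bullet> Z t \<omega>) * g (y \<bullet> l + Z t \<omega> \<bullet> l)))"
    by (rule time_fubini[OF a _ eg, symmetric]) measurable
  also have "\<dots> = (LINT p|(M \<Otimes>\<^sub>M lborel). c1 p * g (y \<bullet> l + \<phi>1 p))"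
  proof -
    have "(LINT p|(M \<Otimes>\<^sub>M lborel). c1 p * g (y \<bullet> l + \<phi>1 p)) = (LINT p|(M \<Otimes>\<^sub>M lborel). (\<lambda>(\<omega>, t). of_real (?a t) * (iexp (z \<bullet> Z t \<omega>) * g (y \<bullet> l + Z t \<omega> \<bullet> l))) p)"
      by (intro Bochner_Integration.integral_cong refl) (auto simp: c1_def \<phi>1_def split: prod.split)
    also have "\<dots> = (LINT \<omega>|M. LINT t|lborel. of_real (?a t) * (iexp (z \<bullet> Z t \<omega>) * g (y \<bullet> l + Z t \<omega> \<bullet> l)))"
      by (subst P.integral_fst'[symmetric], rule time_integrable[OF a egm eg]) simp
    finally show ?thesis ..
  qed
  also note main
  also have "(LINT p|(lborel \<Otimes>\<^sub>M lborel). c2 p * g (y \<bullet> l + \<phi>2 p)) = (LINT s|lborel. ?v s * (LINT r|lborel. ?v r * g (y \<bullet> l + (r - s)))) / of_real ((Gamma b)\<^sup>2)"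
    by (rule iter[of "\<lambda>u. g (y \<bullet> l + u)" B]) (use B in auto)
  finally show ?thesis by simp
qed

text \<open>Wiener--Hopf argument: testing the hitting identity with \<^const>\<open>wh_test\<close> shows that the difference of the two
  sides, multiplied by the transform of the ladder potential, does not depend on \<open>\<xi>\<close>; it vanishes as \<open>\<xi> \<rightarrow> \<infinity>\<close>.\<close>

theorem hitting_fourier:
  assumes x: "x \<bullet> l > 0" and z: "z \<bullet> l = 0"
  shows "(LINT \<omega>|M. of_bool (hits l x \<omega>) * (of_real (exp (- m * hit_time l x \<omega>)) *
      iexp ((z + \<xi> *\<^sub>R l) \<bullet> (x + Z (hit_time l x \<omega>) \<omega>))))
    = iexp (z \<bullet> x) * (LINT v|lborel. of_real (poisson_profile b (width z) (x \<bullet> l) v) * exp (- (\<i> * of_real \<xi>) * of_real v))"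
proof -
  let ?w = "width z"
  define Y where "Y \<omega> = (x + Z (hit_time l x \<omega>) \<omega>) \<bullet> l" for \<omega>
  define H where "H \<omega> = of_bool (hits l x \<omega>) * (of_real (exp (- m * hit_time l x \<omega>)) * iexp (z \<bullet> (x + Z (hit_time l x \<omega>) \<omega>)))" for \<omega>
  define L where "L \<mu> = (LINT \<omega>|M. H \<omega> * exp (\<mu> * of_real (Y \<omega>)))" for \<mu> :: complex
  define F where "F \<mu> = (LINT v|lborel. of_real (poisson_profile b ?w (x \<bullet> l) v) * exp (- \<mu> * of_real v))" for \<mu> :: complex
  define I where "I \<mu> = laplace_powr b (of_real ?w + \<mu>)" for \<mu> :: complex
  let ?e = "iexp (z \<bullet> x)"
  have [measurable]: "Y \<in> borel_measurable M" unfolding Y_def by measurable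
  have [measurable]: "H \<in> borel_measurable M" unfolding H_def by measurable
  have H_bound: "norm (H \<omega>) \<le> 1" for \<omega>
    using m hit_time_nonneg[of l x \<omega>] by (auto simp: H_def norm_mult)
  have H0: "H \<omega> = 0" if "\<not> hits l x \<omega>" for \<omega> using that by (simp add: H_def)
  have Y_neg: "Y \<omega> \<le> 0" if "hits l x \<omega>" for \<omega> using hit_position[OF that] by (simp add: Y_def)
  have HY_bound: "norm (H \<omega> * exp (\<mu> * of_real (Y \<omega>))) \<le> 1" if "Re \<mu> \<ge> 0" for \<mu> \<omega>
  proof (cases "hits l x \<omega>")
    case True
    have "norm (exp (\<mu> * of_real (Y \<omega>))) \<le> 1" using that Y_neg[OF True] by (simp add: mult_nonneg_nonpos)
    thus ?thesis unfolding norm_mult using H_bound[of \<omega>] by (intro mult_le_one) auto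
  qed (simp add: H0)
  have HY_int: "integrable M (\<lambda>\<omega>. H \<omega> * exp (\<mu> * of_real (Y \<omega>)))" if "Re \<mu> \<ge> 0" for \<mu>
    by (rule integrable_const_bound[where B=1]) (use HY_bound[OF that] in auto)
  have L_bound: "norm (L \<mu>) \<le> 1" if "Re \<mu> \<ge> 0" for \<mu>
  proof -
    have "norm (L \<mu>) \<le> (LINT \<omega>|M. norm (H \<omega> * exp (\<mu> * of_real (Y \<omega>))))"
      unfolding L_def by (rule integral_norm_bound)
    also have "\<dots> \<le> (LINT \<omega>|M. 1)"
      by (rule Bochner_Integration.integral_mono[OF integrable_norm[OF HY_int[OF that]]]) (use HY_bound[OF that] in auto)
    finally show ?thesis by (simp add: prob_space)
  qed
  \<comment> \<open>Both sides are the same function of \<mu>, namely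
    \<open>I \<mu> * (L \<mu> - ?e * F \<mu>)\<close>, at i\<xi> and at w. The hitting position is
    nonpositive, so \<open>L\<close> enters through \<open>ladder_exp_nonpos\<close>; the start is
    positive, so \<open>F\<close> enters through \<open>ladder_exp_pos\<close>.\<close>
  have key: "I (\<i> * of_real \<xi>) * (L (\<i> * of_real \<xi>) - ?e * F (\<i> * of_real \<xi>)) = I (of_real ?w) * (L (of_real ?w) - ?e * F (of_real ?w))" for \<xi>
  proof -
    let ?f = "\<lambda>u. iexp (z \<bullet> u) * wh_test b ?w \<xi> (u \<bullet> l)"
    let ?\<kappa> = "of_real (Gamma b * Gamma (1 - b)) / (of_real ?w - \<i> * of_real \<xi>) / of_real ((Gamma b)\<^sup>2) :: complex"
    let ?B = "LINT q|lborel. indicator {0<..} q * q powr (- b) * exp (- ?w * q)"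
    have wB: "norm (wh_test b ?w \<xi> u) \<le> ?B" for u by (rule norm_wh_test[OF b(2) width_pos])
    have wc: "continuous_on UNIV (wh_test b ?w \<xi>)" by (rule continuous_wh_test[OF b(2) width_pos])
    have k0: "?\<kappa> \<noteq> 0"
    proof -
      have "of_real ?w - \<i> * of_real \<xi> \<noteq> (0::complex)" using width_pos[of z] by (auto simp: complex_eq_iff)
      moreover have "Gamma b > 0" "Gamma (1 - b) > 0" using b by (auto intro: Gamma_real_pos)
      ultimately show ?thesis by simp
    qed
    have pot: "potential m ?f y = ?\<kappa> * (iexp (z \<bullet> y) * (ladder_exp b ?w (\<i> * of_real \<xi>) (y \<bullet> l) - ladder_exp b ?w (of_real ?w) (y \<bullet> l)))" for y
      unfolding potential_product_exp[OF z wc wB] wh_potential_1d[OF b width_pos] by (simp add: mult_ac)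
    have "potential m ?f x = (LINT \<omega>|M. of_bool (hits l x \<omega>) * (of_real (exp (- m * hit_time l x \<omega>)) * potential m ?f (x + Z (hit_time l x \<omega>) \<omega>)))"
    proof (rule potential_hitting_identity[OF m])
      have "continuous_on UNIV (\<lambda>u. wh_test b ?w \<xi> (u \<bullet> l))"
        by (rule continuous_on_compose2[OF wc]) (auto intro!: continuous_intros)
      thus "continuous_on UNIV ?f" by (intro continuous_intros)
      show "norm (?f u) \<le> ?B" for u using wB by (simp add: norm_mult)
      show "?f u = 0" if "u \<bullet> l \<ge> 0" for u using wh_test_nonneg[OF that] by simp
    qed
    also have "\<dots> = (LINT \<omega>|M. ?\<kappa> * (H \<omega> * exp (\<i> * of_real \<xi> * of_real (Y \<omega>)) * I (\<i> * of_real \<xi>) - H \<omega> * exp (of_real ?w * of_real (Y \<omega>)) * I (of_real ?w)))"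
    proof (intro Bochner_Integration.integral_cong refl)
      fix \<omega>
      show "of_bool (hits l x \<omega>) * (of_real (exp (- m * hit_time l x \<omega>)) * potential m ?f (x + Z (hit_time l x \<omega>) \<omega>))
        = ?\<kappa> * (H \<omega> * exp (\<i> * of_real \<xi> * of_real (Y \<omega>)) * I (\<i> * of_real \<xi>) - H \<omega> * exp (of_real ?w * of_real (Y \<omega>)) * I (of_real ?w))"
      proof (cases "hits l x \<omega>")
        case True
        show ?thesis unfolding pot ladder_exp_nonpos[OF hit_position[OF True]] H_def I_def Y_def using True by (simp add: algebra_simps)
      qed (simp add: H0)
    qed
    also have "\<dots> = ?\<kappa> * (L (\<i> * of_real \<xi>) * I (\<i> * of_real \<xi>) - L (of_real ?w) * I (of_real ?w))"
    proof -
      have i1: "integrable M (\<lambda>\<omega>. H \<omega> * exp (\<i> * of_real \<xi> * of_real (Y \<omega>)) * I (\<i> * of_real \<xi>))"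
        by (intro integrable_mult_left HY_int) simp
      have i2: "integrable M (\<lambda>\<omega>. H \<omega> * exp (of_real ?w * of_real (Y \<omega>)) * I (of_real ?w))"
        by (intro integrable_mult_left HY_int) (use width_pos[of z] in simp)
      show ?thesis
        by (simp only: integral_mult_right_zero Bochner_Integration.integral_diff[OF i1 i2] integral_mult_left_zero L_def)
    qed
    finally have "?e * (ladder_exp b ?w (\<i> * of_real \<xi>) (x \<bullet> l) - ladder_exp b ?w (of_real ?w) (x \<bullet> l))
      = L (\<i> * of_real \<xi>) * I (\<i> * of_real \<xi>) - L (of_real ?w) * I (of_real ?w)"
      unfolding pot using k0 by (simp only: mult_cancel_left) simp
    moreover have "ladder_exp b ?w (\<i> * of_real \<xi>) (x \<bullet> l) = I (\<i> * of_real \<xi>) * F (\<i> * of_real \<xi>)"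
      unfolding I_def F_def by (rule ladder_exp_pos[OF b width_pos x]) simp
    moreover have "ladder_exp b ?w (of_real ?w) (x \<bullet> l) = I (of_real ?w) * F (of_real ?w)"
      unfolding I_def F_def by (rule ladder_exp_pos[OF b width_pos x]) (use width_pos[of z] in simp)
    ultimately show ?thesis by (simp add: algebra_simps)
  qed
  \<comment> \<open>The value at w depends on \<open>z\<close> but not on \<xi>.\<close>
  define C where "C = I (of_real ?w) * (L (of_real ?w) - ?e * F (of_real ?w))"
  let ?P = "LINT v|lborel. poisson_profile b ?w (x \<bullet> l) v"
  have F_bound: "norm (F (\<i> * of_real \<xi>)) \<le> ?P" for \<xi>
  proof -
    have "norm (F (\<i> * of_real \<xi>)) \<le> (LINT v|lborel. norm (of_real (poisson_profile b ?w (x \<bullet> l) v) * exp (- (\<i> * of_real \<xi>) * of_real v)))"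
      unfolding F_def by (rule integral_norm_bound)
    also have "\<dots> = ?P" using poisson_profile_nonneg[OF b x, of ?w] by (simp add: norm_mult)
    finally show ?thesis .
  qed
  have I_eq: "I (\<i> * of_real \<xi>) * (of_real ?w + \<i> * of_real \<xi>) powr of_real b = Gamma b" for \<xi>
    unfolding I_def by (rule laplace_powr_eq) (use b width_pos in auto)
  \<comment> \<open>|w + i\<xi>| \<ge> \<xi> turns the exact formula for the gamma transform into
    decay of order \<xi>^(-b).\<close>
  have I_bound: "norm (I (\<i> * of_real \<xi>)) \<le> Gamma b * \<xi> powr (- b)" if "\<xi> > 0" for \<xi>
  proof -
    have "norm (I (\<i> * of_real \<xi>)) * norm (of_real ?w + \<i> * of_real \<xi>) powr b = Gamma b"
      using arg_cong[OF I_eq[of \<xi>], of norm] Gamma_real_pos[OF b(1)] by (simp add: norm_mult norm_powr_real_powr')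
    moreover have "\<xi> powr b \<le> norm (of_real ?w + \<i> * of_real \<xi>) powr b"
      using that b abs_Im_le_cmod[of "of_real ?w + \<i> * of_real \<xi>"] by (intro powr_mono2) auto
    hence "norm (I (\<i> * of_real \<xi>)) * \<xi> powr b \<le> norm (I (\<i> * of_real \<xi>)) * norm (of_real ?w + \<i> * of_real \<xi>) powr b"
      by (rule mult_left_mono) simp
    ultimately have "norm (I (\<i> * of_real \<xi>)) * \<xi> powr b \<le> Gamma b" by linarith
    thus ?thesis using that by (simp add: powr_minus field_simps)
  qed
  have "C = 0"
  proof -
    \<comment> \<open>\<open>key\<close> rewrites the constant at \<xi> = n, where \<open>L\<close>
      and \<open>F\<close> stay bounded while \<open>I\<close> decays.\<close>
    have "norm C \<le> Gamma b * real n powr (- b) * (1 + ?P)" if "n \<ge> 1" for n :: nat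
    proof -
      have "norm (L (\<i> * of_real (real n)) - ?e * F (\<i> * of_real (real n))) \<le> 1 + ?P"
        using norm_triangle_ineq4[of "L (\<i> * of_real (real n))" "?e * F (\<i> * of_real (real n))"] L_bound[of "\<i> * of_real (real n)"] F_bound[of "real n"]
        by (simp add: norm_mult)
      moreover have "norm (I (\<i> * of_real (real n))) \<le> Gamma b * real n powr (- b)"
        by (rule I_bound) (use that in simp)
      ultimately have "norm (I (\<i> * of_real (real n))) * norm (L (\<i> * of_real (real n)) - ?e * F (\<i> * of_real (real n)))
         \<le> Gamma b * real n powr (- b) * (1 + ?P)"
        using Gamma_real_pos[OF b(1)] by (intro mult_mono) auto
      thus ?thesis unfolding C_def key[of "real n", symmetric] norm_mult .
    qed
    moreover have "(\<lambda>n. Gamma b * real n powr (- b) * (1 + ?P)) \<longlonglongrightarrow> Gamma b * 0 * (1 + ?P)"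
      using b by (intro tendsto_intros tendsto_neg_powr filterlim_real_sequentially) auto
    ultimately have "norm C \<le> 0"
      by (intro LIMSEQ_le_const[where X="\<lambda>n. Gamma b * real n powr (- b) * (1 + ?P)"]) auto
    thus ?thesis by simp
  qed
  moreover have "I (\<i> * of_real \<xi>) \<noteq> 0" using I_eq[of \<xi>] Gamma_real_pos[OF b(1)] by auto
  ultimately have "L (\<i> * of_real \<xi>) = ?e * F (\<i> * of_real \<xi>)"
    unfolding C_def key[of \<xi>, symmetric] by simp
  moreover have "L (\<i> * of_real \<xi>) = (LINT \<omega>|M. of_bool (hits l x \<omega>) * (of_real (exp (- m * hit_time l x \<omega>)) *
      iexp ((z + \<xi> *\<^sub>R l) \<bullet> (x + Z (hit_time l x \<omega>) \<omega>))))"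
    unfolding L_def H_def
  proof (intro Bochner_Integration.integral_cong refl)
    fix \<omega>
    have "iexp (z \<bullet> (x + Z (hit_time l x \<omega>) \<omega>)) * exp (\<i> * of_real \<xi> * of_real (Y \<omega>)) = iexp ((z + \<xi> *\<^sub>R l) \<bullet> (x + Z (hit_time l x \<omega>) \<omega>))"
      unfolding exp_add[symmetric] Y_def by (rule arg_cong[where f=exp]) (simp add: inner_add_left inner_commute[of l] algebra_simps)
    thus "of_bool (hits l x \<omega>) * (of_real (exp (- m * hit_time l x \<omega>)) * iexp (z \<bullet> (x + Z (hit_time l x \<omega>) \<omega>))) * exp (\<i> * of_real \<xi> * of_real (Y \<omega>))
      = of_bool (hits l x \<omega>) * (of_real (exp (- m * hit_time l x \<omega>)) * iexp ((z + \<xi> *\<^sub>R l) \<bullet> (x + Z (hit_time l x \<omega>) \<omega>)))"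
      by (simp only: mult.assoc)
  qed
  ultimately show ?thesis unfolding F_def by simp
qed

end

section \<open>The Fourier transform of the kernel\<close>

lemma
  fixes \<zeta> y \<sigma> :: real
  assumes s: "\<sigma> > 0"
  shows integrable_gaussian_exp_affine: "integrable lborel (\<lambda>t. iexp (\<zeta> * t) * complex_of_real (exp (- (y - t)\<^sup>2 / (2 * \<sigma>\<^sup>2))))"
    and integral_gaussian_exp_affine: "(LINT t|lborel. iexp (\<zeta> * t) * complex_of_real (exp (- (y - t)\<^sup>2 / (2 * \<sigma>\<^sup>2))))
      = iexp (\<zeta> * y) * of_real (\<sigma> * sqrt (2 * pi) * exp (- (\<zeta> * \<sigma>)\<^sup>2 / 2))"
proof -
  let ?F = "\<lambda>t. iexp (\<zeta> * t) * complex_of_real (exp (- (y - t)\<^sup>2 / (2 * \<sigma>\<^sup>2)))"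
  have eq: "?F (y + \<sigma> * r) = iexp (\<zeta> * y) * (iexp ((\<zeta> * \<sigma>) * r) * complex_of_real (exp (- r\<^sup>2 / 2)))" for r
  proof -
    have "(y - (y + \<sigma> * r))\<^sup>2 / (2 * \<sigma>\<^sup>2) = r\<^sup>2 / 2" using s by (simp add: power_mult_distrib)
    moreover have "iexp (\<zeta> * (y + \<sigma> * r)) = iexp (\<zeta> * y) * iexp ((\<zeta> * \<sigma>) * r)"
      unfolding exp_add[symmetric] by (rule arg_cong[where f=exp]) (simp add: algebra_simps)
    ultimately show ?thesis by (simp only: mult.assoc minus_divide_left[symmetric])
  qed
  have "integrable lborel (\<lambda>r. ?F (y + \<sigma> * r))"
    unfolding eq by (intro integrable_mult_right integrable_gaussian_exp)
  thus "integrable lborel ?F"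
    using lborel_integrable_real_affine_iff[of \<sigma> ?F y] s by simp
  have "integral\<^sup>L lborel ?F = \<bar>\<sigma>\<bar> *\<^sub>R (LINT r|lborel. ?F (y + \<sigma> * r))"
    by (rule lborel_integral_real_affine) (use s in auto)
  also have "(LINT r|lborel. ?F (y + \<sigma> * r)) = iexp (\<zeta> * y) * (sqrt (2 * pi) * exp (- (\<zeta> * \<sigma>)\<^sup>2 / 2))"
    unfolding eq integral_mult_right_zero integral_gaussian_exp by simp
  finally show "integral\<^sup>L lborel ?F = iexp (\<zeta> * y) * of_real (\<sigma> * sqrt (2 * pi) * exp (- (\<zeta> * \<sigma>)\<^sup>2 / 2))"
    using s by (simp add: scaleR_conv_of_real mult_ac)
qed

text \<open>The integrand of the Bessel integral after the tangential variables have been integrated out.\<close>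

definition kernel_profile :: "real \<Rightarrow> real \<Rightarrow> real \<Rightarrow> real \<Rightarrow> real \<Rightarrow> real \<Rightarrow> real" where
  "kernel_profile b c w a t v = indicator {..<0} t * (sin (pi * b) / pi * (a / (- t)) powr b * (c / (2 * sqrt pi))) *
     (indicator {0<..} v * (v powr (-3/2) * exp (- (w / c)\<^sup>2 * v - (c * (a - t) / 2)\<^sup>2 / v)))"

lemma measurable_kernel_profile [measurable]: "(\<lambda>(t, v). kernel_profile b c w a t v) \<in> borel_measurable (borel \<Otimes>\<^sub>M borel)"
  unfolding kernel_profile_def by measurable

lemma kernel_profile_nonneg: "0 < b \<Longrightarrow> b < 1 \<Longrightarrow> a > 0 \<Longrightarrow> c > 0 \<Longrightarrow> kernel_profile b c w a t v \<ge> 0"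
  unfolding kernel_profile_def by (auto split: split_indicator intro!: mult_nonneg_nonneg divide_nonneg_nonneg sin_ge_zero)

text \<open>The inverse Gaussian integral with A = (w/c)^2 and B = (c (a - t)/2)^2: its exponent
  becomes -w (a - t), and its prefactor 2 sqrt(\<pi>) / (c (a - t)) cancels the constant of the
  integrand up to 1/(a - t). The coordinate \<open>t\<close> is negative, hence the depth
  \<open>- t\<close>.\<close>

lemma kernel_profile_integral:
  assumes b: "0 < b" "b < 1" and a: "a > 0" and c: "c > 0" and w: "w > 0"
  shows "has_bochner_integral lborel (kernel_profile b c w a t) (poisson_profile b w a (- t))"
proof (cases "t < 0")
  case True
  let ?h = "a - t"
  have h: "?h > 0" using a True by simp
  let ?C = "sin (pi * b) / pi * (a / (- t)) powr b * (c / (2 * sqrt pi))"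
  have "has_bochner_integral lborel (\<lambda>v. ?C * (indicator {0<..} v * (v powr (-3/2) * exp (- (w / c)\<^sup>2 * v - (c * ?h / 2)\<^sup>2 / v))))
     (?C * (sqrt (pi / (c * ?h / 2)\<^sup>2) * exp (- 2 * sqrt ((w / c)\<^sup>2 * (c * ?h / 2)\<^sup>2))))"
    by (intro has_bochner_integral_mult_right inverse_gaussian_integral) (use c h w in auto)
  also have "sqrt ((w / c)\<^sup>2 * (c * ?h / 2)\<^sup>2) = w * ?h / 2"
    using c h w by (simp add: real_sqrt_mult power_mult_distrib[symmetric])
  also have "sqrt (pi / (c * ?h / 2)\<^sup>2) = 2 * sqrt pi / (c * ?h)"
    using c h by (simp add: real_sqrt_divide)
  also have "?C * (2 * sqrt pi / (c * ?h) * exp (- 2 * (w * ?h / 2))) = poisson_profile b w a (- t)"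
  proof -
    have "c / (2 * sqrt pi) * (2 * sqrt pi / (c * ?h)) = 1 / ?h" using c by simp
    hence "?C * (2 * sqrt pi / (c * ?h) * exp (- 2 * (w * ?h / 2))) = sin (pi * b) / pi * (a / (- t)) powr b * (1 / ?h) * exp (- w * ?h)"
      using c by (simp only: mult.assoc[symmetric]) simp
    thus ?thesis using True by (simp add: poisson_profile_def)
  qed
  finally show ?thesis using True by (simp add: kernel_profile_def[abs_def])
next
  case False
  thus ?thesis by (simp add: kernel_profile_def[abs_def] poisson_profile_def has_bochner_integral_zero)
qed

lemma integrable_kernel_profile:
  assumes b: "0 < b" "b < 1" and a: "a > 0" and c: "c > 0" and w: "w > 0"
  shows "integrable (lborel \<Otimes>\<^sub>M lborel) (\<lambda>(t, v). kernel_profile b c w a t v)"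
proof (rule lborel_pair.Fubini_integrable)
  show "(\<lambda>(t, v). kernel_profile b c w a t v) \<in> borel_measurable (lborel \<Otimes>\<^sub>M lborel)"
    by (simp cong: measurable_cong_sets) measurable
  have "integrable lborel (\<lambda>t. poisson_profile b w a (0 + (-1) * t))"
    by (rule lborel_integrable_real_affine[OF integrable_poisson_profile[OF b w a]]) simp
  thus "integrable lborel (\<lambda>t. LINT v|lborel. norm (case (t, v) of (t, v) \<Rightarrow> kernel_profile b c w a t v))"
    using kernel_profile_nonneg[OF b a c] has_bochner_integral_integral_eq[OF kernel_profile_integral[OF b a c w]] by simp
  show "AE t in lborel. integrable lborel (\<lambda>v. case (t, v) of (t, v) \<Rightarrow> kernel_profile b c w a t v)"
    using kernel_profile_integral[OF b a c w] by (auto intro: integrable.intros)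
qed

section \<open>The kernel as a mixture of Gaussians\<close>

text \<open>The integrand of the Bessel integral at r = c |x - u|, with the constants of the theorem
  already combined: r^(d/2) cancels |x - u|^(d/2) up to c^(d/2). For fixed \<open>v\<close> it is a
  Gaussian in \<open>u\<close> times a power of the normal coordinate, so integrating over
  \<open>v\<close> last keeps the Fourier transform elementary. It is zero on the boundary
  hyperplane too.\<close>

definition kernel_integrand :: "real \<Rightarrow> real \<Rightarrow> 'a::euclidean_space \<Rightarrow> 'a \<Rightarrow> real \<Rightarrow> 'a \<Rightarrow> real" where
  "kernel_integrand b c l x v u = indicator {..<0} (u \<bullet> l) * (sin (pi * b) / pi * ((x \<bullet> l) / (- (u \<bullet> l))) powr b * (c / (2 * sqrt pi)) ^ DIM('a)) *
     (indicator {0<..} v * (exp (- v) * v powr (-1 - real DIM('a) / 2) * exp (- (c * norm (x - u))\<^sup>2 / (4 * v))))"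

definition half_space_kernel :: "real \<Rightarrow> real \<Rightarrow> 'a::euclidean_space \<Rightarrow> 'a \<Rightarrow> 'a \<Rightarrow> real" where
  "half_space_kernel b c l x u = (LINT v|lborel. kernel_integrand b c l x v u)"

lemma measurable_kernel_integrand [measurable]: "(\<lambda>(v, u). kernel_integrand b c l x v u) \<in> borel_measurable (borel \<Otimes>\<^sub>M borel)"
  unfolding kernel_integrand_def by measurable

lemma measurable_kernel [measurable]: "half_space_kernel b c l x \<in> borel_measurable borel"
  unfolding half_space_kernel_def kernel_integrand_def by measurable

lemma kernel_integrand_nonneg: "0 < b \<Longrightarrow> b < 1 \<Longrightarrow> c > 0 \<Longrightarrow> x \<bullet> l > 0 \<Longrightarrow> kernel_integrand b c l x v u \<ge> 0"
  unfolding kernel_integrand_def by (auto split: split_indicator intro!: mult_nonneg_nonneg divide_nonneg_nonneg sin_ge_zero zero_le_power)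

lemma kernel_nonneg: "0 < b \<Longrightarrow> b < 1 \<Longrightarrow> c > 0 \<Longrightarrow> x \<bullet> l > 0 \<Longrightarrow> half_space_kernel b c l x u \<ge> 0"
  unfolding half_space_kernel_def by (intro Bochner_Integration.integral_nonneg kernel_integrand_nonneg)

text \<open>With \<open>l\<close> a basis vector the integrand splits into coordinates. Each of the
  d - 1 tangential Gaussians contributes a factor sqrt v and its own transform, which changes
  v^(-1-d/2) to v^(-3/2) and exp(-v) to exp(-(w/c)^2 v); the normal coordinate is left as an
  integral.\<close>

lemma
  fixes x z l :: "'a::euclidean_space"
  assumes b: "0 < b" "b < 1" and c: "c > 0" and l: "l \<in> Basis" and x: "x \<bullet> l > 0" and z: "z \<bullet> l = 0"
  shows kernel_integrand_fourier: "(LINT u|lborel. of_real (kernel_integrand b c l x v u) * iexp ((z + \<xi> *\<^sub>R l) \<bullet> u))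
    = iexp (z \<bullet> x) * (LINT t|lborel. of_real (kernel_profile b c (sqrt ((norm z)\<^sup>2 + c\<^sup>2)) (x \<bullet> l) t v) * iexp (\<xi> * t))"
      (is ?eq)
    and kernel_integrand_integrable: "integrable lborel (\<lambda>u. complex_of_real (kernel_integrand b c l x v u) * iexp ((z + \<xi> *\<^sub>R l) \<bullet> u))"
      (is ?int)
proof -
  have "?eq \<and> ?int"
  proof (cases "v > 0")
    case False
    thus ?thesis by (simp add: kernel_integrand_def kernel_profile_def)
  next
    case v: True
    let ?d = "DIM('a)" and ?w2 = "(norm z)\<^sup>2 + c\<^sup>2"
    define \<sigma> where "\<sigma> = sqrt (2 * v) / c"
    have s: "\<sigma> > 0" using v c by (simp add: \<sigma>_def)
    have s2: "2 * \<sigma>\<^sup>2 = 4 * v / c\<^sup>2" using v by (simp add: \<sigma>_def power_divide)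
    let ?G = "\<lambda>y t. complex_of_real (exp (- (y - t)\<^sup>2 / (2 * \<sigma>\<^sup>2)))"
    let ?a = "\<lambda>t. indicator {..<0} t * (sin (pi * b) / pi * ((x \<bullet> l) / (- t)) powr b) :: real"
    let ?K = "(c / (2 * sqrt pi)) ^ ?d * (exp (- v) * v powr (-1 - real ?d / 2)) :: real"
    \<comment> \<open>One factor per coordinate, with the singular power attached to the normal
      one.\<close>
    define f where "f b' t = (if b' = l then of_real (?a t) else 1) * (iexp (((z + \<xi> *\<^sub>R l) \<bullet> b') * t) * ?G (x \<bullet> b') t)" for b' t
    have gauss: "exp (- (c * norm (x - u))\<^sup>2 / (4 * v)) = (\<Prod>b'\<in>Basis. exp (- (x \<bullet> b' - u \<bullet> b')\<^sup>2 / (2 * \<sigma>\<^sup>2)))" for u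
      unfolding s2 using c v
      by (simp add: exp_sum[symmetric] power_mult_distrib norm_sq_Basis inner_diff_left sum_negf sum_divide_distrib sum_distrib_left mult.commute)
    have osc: "iexp ((z + \<xi> *\<^sub>R l) \<bullet> u) = (\<Prod>b'\<in>Basis. iexp (((z + \<xi> *\<^sub>R l) \<bullet> b') * (u \<bullet> b')))" for u
      by (simp only: exp_sum[symmetric] euclidean_inner[of "z + \<xi> *\<^sub>R l" u] sum_distrib_left[symmetric] of_real_sum finite_Basis)
    have sel: "(\<Prod>b'\<in>Basis. if b' = l then of_real (?a (u \<bullet> b')) else (1::complex)) = of_real (?a (u \<bullet> l))" for u
      using l by (simp add: prod.delta)
    have prod: "of_real (kernel_integrand b c l x v u) * iexp ((z + \<xi> *\<^sub>R l) \<bullet> u) = of_real ?K * (\<Prod>b'\<in>Basis. f b' (u \<bullet> b'))" for u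
    proof -
      have "(\<Prod>b'\<in>Basis. f b' (u \<bullet> b')) = of_real (?a (u \<bullet> l)) * (iexp ((z + \<xi> *\<^sub>R l) \<bullet> u) * of_real (exp (- (c * norm (x - u))\<^sup>2 / (4 * v))))"
        unfolding f_def prod.distrib osc gauss of_real_prod sel ..
      thus ?thesis using v by (simp add: kernel_integrand_def mult_ac)
    qed
    have f_ne: "integrable lborel (f b')" "(LINT t|lborel. f b' t) = iexp ((z \<bullet> b') * (x \<bullet> b')) * of_real (\<sigma> * sqrt (2 * pi) * exp (- ((z \<bullet> b') * \<sigma>)\<^sup>2 / 2))"
      if "b' \<in> Basis - {l}" for b'
    proof -
      have "(z + \<xi> *\<^sub>R l) \<bullet> b' = z \<bullet> b'" using that l by (auto simp: inner_add_left inner_Basis)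
      hence f: "f b' = (\<lambda>t. iexp ((z \<bullet> b') * t) * ?G (x \<bullet> b') t)" using that by (auto simp: f_def)
      show "integrable lborel (f b')" unfolding f by (rule integrable_gaussian_exp_affine[OF s])
      show "(LINT t|lborel. f b' t) = iexp ((z \<bullet> b') * (x \<bullet> b')) * of_real (\<sigma> * sqrt (2 * pi) * exp (- ((z \<bullet> b') * \<sigma>)\<^sup>2 / 2))"
        unfolding f by (rule integral_gaussian_exp_affine[OF s])
    qed
    have f_l: "f l = (\<lambda>t. of_real (?a t) * (iexp (\<xi> * t) * ?G (x \<bullet> l) t))"
      using l z by (auto simp: f_def inner_add_left inner_Basis)
    have rel: "of_real (kernel_profile b c (sqrt ?w2) (x \<bullet> l) t v) * iexp (\<xi> * t) =
       of_real (c / (2 * sqrt pi) * (v powr (-3/2) * exp (- (?w2 / c\<^sup>2) * v))) * f l t" for t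
    proof -
      have "(x \<bullet> l - t)\<^sup>2 / (2 * \<sigma>\<^sup>2) = (c * (x \<bullet> l - t) / 2)\<^sup>2 / v"
        unfolding s2 power_mult_distrib power_divide using c v by simp
      moreover have "(sqrt ?w2 / c)\<^sup>2 = ?w2 / c\<^sup>2" by (simp add: power_divide)
      ultimately have "exp (- (sqrt ?w2 / c)\<^sup>2 * v - (c * (x \<bullet> l - t) / 2)\<^sup>2 / v) = exp (- (?w2 / c\<^sup>2) * v) * exp (- (x \<bullet> l - t)\<^sup>2 / (2 * \<sigma>\<^sup>2))"
        by (simp add: exp_add[symmetric])
      thus ?thesis unfolding f_l kernel_profile_def using v by (simp add: mult_ac)
    qed
    have "integrable lborel (f l)"
    proof -
      \<comment> \<open>For t < 0 the square of x\<bullet>l - t is at least 2 (x\<bullet>l)(-t),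
        which bounds the Gaussian by exp(-?W (-t)). Together with (-t)^(-b) this is a gamma
        integrand of order 1 - b.\<close>
      let ?W = "x \<bullet> l / \<sigma>\<^sup>2" and ?S = "\<bar>sin (pi * b) / pi\<bar> * (x \<bullet> l) powr b"
      have W: "?W > 0" using x s by simp
      let ?g = "\<lambda>r. indicator {0<..} r * r powr ((1 - b) - 1) * exp (- ?W * r) :: real"
      have "integrable lborel ?g"
        using gamma_integral_scaled[of "1 - b" ?W] b W by (auto intro: integrable.intros)
      hence "integrable lborel (\<lambda>t. ?g (0 + (-1) * t))" by (rule lborel_integrable_real_affine) simp
      hence "integrable lborel (\<lambda>t. ?S * ?g (0 + (-1) * t))" by (rule integrable_mult_right)
      thus ?thesis
      proof (rule Bochner_Integration.integrable_bound)
        show "f l \<in> borel_measurable lborel" unfolding f_l by measurable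
        show "AE t in lborel. norm (f l t) \<le> norm (?S * ?g (0 + (-1) * t))"
        proof (rule AE_I2)
          fix t :: real
          show "norm (f l t) \<le> norm (?S * ?g (0 + (-1) * t))"
          proof (cases "t < 0")
            case True
            have "?W * (- t) = 2 * (x \<bullet> l) * (- t) / (2 * \<sigma>\<^sup>2)" by simp
            also have "\<dots> \<le> (x \<bullet> l - t)\<^sup>2 / (2 * \<sigma>\<^sup>2)"
              by (rule divide_right_mono) (auto simp: power2_diff)
            finally have "exp (- (x \<bullet> l - t)\<^sup>2 / (2 * \<sigma>\<^sup>2)) \<le> exp (- ?W * (- t))" by simp
            hence "?S * (- t) powr (- b) * exp (- (x \<bullet> l - t)\<^sup>2 / (2 * \<sigma>\<^sup>2)) \<le> ?S * (- t) powr (- b) * exp (- ?W * (- t))"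
              by (intro mult_left_mono) auto
            moreover have "norm (f l t) = ?S * (- t) powr (- b) * exp (- (x \<bullet> l - t)\<^sup>2 / (2 * \<sigma>\<^sup>2))"
            proof -
              have "((x \<bullet> l) / (- t)) powr b = (x \<bullet> l) powr b * (- t) powr (- b)"
                using True x by (simp only: powr_divide[of "x \<bullet> l" "- t"] powr_minus_divide) simp
              thus ?thesis using True unfolding f_l norm_mult norm_of_real norm_exp_i_times by (simp add: abs_mult)
            qed
            moreover have "norm (?S * ?g (0 + (-1) * t)) = ?S * (- t) powr (- b) * exp (- ?W * (- t))"
              using True by (simp add: abs_mult)
            ultimately show ?thesis by (simp only:)
          qed (simp add: f_l)
        qed
      qed
    qed
    hence f_int: "integrable lborel (f b')" if "b' \<in> Basis" for b' using f_ne(1)[of b'] that by (cases "b' = l") auto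
    have ?int unfolding prod by (intro integrable_mult_right integrable_lborel_prod f_int)
    have "(LINT u|lborel. of_real (kernel_integrand b c l x v u) * iexp ((z + \<xi> *\<^sub>R l) \<bullet> u)) = of_real ?K * (\<Prod>b'\<in>Basis. LINT t|lborel. f b' t)"
      unfolding prod integral_mult_right_zero by (subst integral_lborel_prod[OF f_int]) auto
    also have "(\<Prod>b'\<in>Basis. LINT t|lborel. f b' t) = (LINT t|lborel. f l t) * (\<Prod>b'\<in>Basis - {l}. LINT t|lborel. f b' t)"
      using l by (subst prod.remove[of _ l]) auto
    also have "(\<Prod>b'\<in>Basis - {l}. LINT t|lborel. f b' t) =
       (\<Prod>b'\<in>Basis - {l}. iexp ((z \<bullet> b') * (x \<bullet> b')) * of_real (\<sigma> * sqrt (2 * pi) * exp (- ((z \<bullet> b') * \<sigma>)\<^sup>2 / 2)))"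
      by (intro prod.cong refl f_ne(2))
    also have "\<dots> = iexp (z \<bullet> x) * of_real ((\<sigma> * sqrt (2 * pi)) ^ (?d - 1) * exp (- (norm z * \<sigma>)\<^sup>2 / 2))"
    proof -
      have 1: "(\<Prod>b'\<in>Basis - {l}. iexp ((z \<bullet> b') * (x \<bullet> b'))) = iexp (z \<bullet> x)"
      proof -
        have "z \<bullet> x = (\<Sum>b'\<in>Basis - {l}. (z \<bullet> b') * (x \<bullet> b'))"
          unfolding euclidean_inner[of z x] using l z by (subst sum.remove[of _ l]) auto
        thus ?thesis by (simp add: exp_sum[symmetric] sum_distrib_left)
      qed
      have 2: "(\<Prod>b'\<in>Basis - {l}. exp (- ((z \<bullet> b') * \<sigma>)\<^sup>2 / 2)) = exp (- (norm z * \<sigma>)\<^sup>2 / 2)"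
      proof -
        have "(norm z)\<^sup>2 = (\<Sum>b'\<in>Basis - {l}. (z \<bullet> b')\<^sup>2)"
          unfolding norm_sq_Basis using l z by (subst sum.remove[of _ l]) auto
        thus ?thesis by (simp add: exp_sum[symmetric] power_mult_distrib sum_negf sum_divide_distrib sum_distrib_right)
      qed
      have 3: "(\<Prod>b'\<in>Basis - {l}. \<sigma>) * (\<Prod>b'\<in>Basis - {l}. sqrt (2 * pi)) = (\<sigma> * sqrt (2 * pi)) ^ (?d - 1)"
        using l by (simp only: prod_constant card_Diff_singleton power_mult_distrib)
      show ?thesis by (simp only: prod.distrib 1 of_real_prod[symmetric] 2 3)
    qed
    also have "of_real ?K * ((LINT t|lborel. f l t) * (iexp (z \<bullet> x) * of_real ((\<sigma> * sqrt (2 * pi)) ^ (?d - 1) * exp (- (norm z * \<sigma>)\<^sup>2 / 2))))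
      = iexp (z \<bullet> x) * (of_real (c / (2 * sqrt pi) * (v powr (-3/2) * exp (- (?w2 / c\<^sup>2) * v))) * (LINT t|lborel. f l t))"
    proof -
      have "?K * ((\<sigma> * sqrt (2 * pi)) ^ (?d - 1) * exp (- (norm z * \<sigma>)\<^sup>2 / 2)) = c / (2 * sqrt pi) * (v powr (-3/2) * exp (- (?w2 / c\<^sup>2) * v))"
      proof -
        have d: "?d = Suc (?d - 1)" using DIM_positive[where 'a='a] by simp
        have sv: "\<sigma> * sqrt (2 * pi) = sqrt v * (2 * sqrt pi / c)" using v by (simp add: \<sigma>_def real_sqrt_mult)
        have f1: "(c / (2 * sqrt pi)) ^ ?d * (\<sigma> * sqrt (2 * pi)) ^ (?d - 1) = c / (2 * sqrt pi) * (sqrt v) ^ (?d - 1)"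
        proof -
          obtain k where k: "?d = Suc k" using d by blast
          have one: "(c / (2 * sqrt pi)) ^ k * (2 * sqrt pi / c) ^ k = 1"
            using c by (simp flip: power_mult_distrib)
          have "(c / (2 * sqrt pi)) ^ Suc k * (sqrt v * (2 * sqrt pi / c)) ^ k
             = c / (2 * sqrt pi) * (sqrt v) ^ k * ((c / (2 * sqrt pi)) ^ k * (2 * sqrt pi / c) ^ k)"
            unfolding power_mult_distrib[of "sqrt v"] power_Suc by (simp only: mult_ac)
          thus ?thesis unfolding sv k one by simp
        qed
        \<comment> \<open>Exponents: -1 - d/2 + (d - 1)/2 = -3/2, whatever the dimension.\<close>
        have f2: "v powr (-1 - real ?d / 2) * (sqrt v) ^ (?d - 1) = v powr (-3/2)"
        proof -
          have "(sqrt v) ^ (?d - 1) = v powr (real (?d - 1) / 2)"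
            using v by (simp add: powr_half_sqrt[symmetric] powr_powr flip: powr_realpow)
          moreover have "real (?d - 1) = real ?d - 1" by (subst (2) d) simp
          ultimately show ?thesis using v by (simp add: powr_add[symmetric] field_simps)
        qed
        have f3: "exp (- v) * exp (- (norm z * \<sigma>)\<^sup>2 / 2) = exp (- (?w2 / c\<^sup>2) * v)"
        proof -
          have "(norm z * \<sigma>)\<^sup>2 / 2 = (norm z)\<^sup>2 / c\<^sup>2 * v" using v by (simp add: \<sigma>_def power_mult_distrib power_divide)
          moreover have "?w2 / c\<^sup>2 * v = v + (norm z)\<^sup>2 / c\<^sup>2 * v" using c by (simp add: field_simps)
          ultimately show ?thesis by (simp add: exp_add[symmetric])
        qed
        have "A * (e * q) * (S * E) = (A * S) * q * (e * E)" for A e q S E :: real by (simp only: mult_ac)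
        hence "?K * ((\<sigma> * sqrt (2 * pi)) ^ (?d - 1) * exp (- (norm z * \<sigma>)\<^sup>2 / 2))
          = c / (2 * sqrt pi) * (sqrt v) ^ (?d - 1) * v powr (-1 - real ?d / 2) * exp (- (?w2 / c\<^sup>2) * v)"
          by (simp only: f1 f3)
        also have "\<dots> = c / (2 * sqrt pi) * (v powr (-3/2) * exp (- (?w2 / c\<^sup>2) * v))"
          unfolding f2[symmetric] by (simp only: mult_ac)
        finally show ?thesis .
      qed
      hence eqK: "of_real ?K * (of_real ((\<sigma> * sqrt (2 * pi)) ^ (?d - 1) * exp (- (norm z * \<sigma>)\<^sup>2 / 2))) = (of_real (c / (2 * sqrt pi) * (v powr (-3/2) * exp (- (?w2 / c\<^sup>2) * v))) :: complex)"
        by (simp only: of_real_mult[symmetric])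
      show ?thesis unfolding eqK[symmetric] by (simp only: mult_ac)
    qed
    also have "of_real (c / (2 * sqrt pi) * (v powr (-3/2) * exp (- (?w2 / c\<^sup>2) * v))) * (LINT t|lborel. f l t)
       = (LINT t|lborel. of_real (kernel_profile b c (sqrt ?w2) (x \<bullet> l) t v) * iexp (\<xi> * t))"
      unfolding rel integral_mult_right_zero ..
    finally have ?eq .
    with \<open>?int\<close> show ?thesis by blast
  qed
  thus ?eq ?int by blast+
qed

text \<open>Integrating over \<open>u\<close> before \<open>v\<close> gives the Gaussian transform,
  and integrating over \<open>v\<close> before \<open>t\<close> then gives the inverse Gaussian one;
  the two exchanges in between produce the profile.\<close>

lemma
  fixes x z l :: "'a::euclidean_space"
  assumes b: "0 < b" "b < 1" and c: "c > 0" and l: "l \<in> Basis" and x: "x \<bullet> l > 0"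
  shows integrable_kernel: "integrable lborel (half_space_kernel b c l x)"
    and kernel_fourier: "z \<bullet> l = 0 \<Longrightarrow> (LINT u|lborel. of_real (half_space_kernel b c l x u) * iexp ((z + \<xi> *\<^sub>R l) \<bullet> u))
      = iexp (z \<bullet> x) * (LINT v|lborel. of_real (poisson_profile b (sqrt ((norm z)\<^sup>2 + c\<^sup>2)) (x \<bullet> l) v) * exp (- (\<i> * of_real \<xi>) * of_real v))"
proof -
  let ?k = "kernel_integrand b c l x"
  let ?p = "\<lambda>z. kernel_profile b c (sqrt ((norm (z::'a))\<^sup>2 + c\<^sup>2)) (x \<bullet> l)"
  let ?E = "\<lambda>z \<xi> u. iexp (((z::'a) + \<xi> *\<^sub>R l) \<bullet> u)"
  have w: "sqrt ((norm z)\<^sup>2 + c\<^sup>2) > 0" for z :: 'a using c by (simp add: add_nonneg_pos)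
  have meas_k: "(\<lambda>(v, u). ?k v u) \<in> borel_measurable (lborel \<Otimes>\<^sub>M lborel)"
    by (simp cong: measurable_cong_sets) measurable
  have pint: "integrable (lborel \<Otimes>\<^sub>M lborel) (\<lambda>(t, v). ?p z t v)" for z
    by (rule integrable_kernel_profile[OF b x c w])
  have knn: "?k v u \<ge> 0" for v u by (rule kernel_integrand_nonneg[OF b c x])
  \<comment> \<open>At zero frequency the Fourier identity computes the mass of the nonnegative
    integrand, which supplies the integrability for every other frequency.\<close>
  have kint_v: "integrable lborel (?k v)" "(LINT u|lborel. ?k v u) = (LINT t|lborel. ?p 0 t v)" for v
  proof -
    have "integrable lborel (\<lambda>u. complex_of_real (?k v u))"
      using kernel_integrand_integrable[OF b c l x, of 0 v 0] by simp
    thus "integrable lborel (?k v)" by (subst (asm) complex_of_real_integrable_eq)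
    have "complex_of_real (LINT u|lborel. ?k v u) = complex_of_real (LINT t|lborel. ?p 0 t v)"
      using kernel_integrand_fourier[OF b c l x, of 0 v 0] by simp
    thus "(LINT u|lborel. ?k v u) = (LINT t|lborel. ?p 0 t v)" by (simp only: of_real_eq_iff)
  qed
  have kint: "integrable (lborel \<Otimes>\<^sub>M lborel) (\<lambda>(v, u). ?k v u)"
  proof (rule lborel_pair.Fubini_integrable[OF meas_k])
    have "integrable lborel (\<lambda>v. LINT t|lborel. ?p 0 t v)"
      using lborel_pair.integrable_snd[OF pint[of 0]] by simp
    thus "integrable lborel (\<lambda>v. LINT u|lborel. norm (case (v, u) of (v, u) \<Rightarrow> ?k v u))"
      using knn by (simp add: kint_v)
    show "AE v in lborel. integrable lborel (\<lambda>u. case (v, u) of (v, u) \<Rightarrow> ?k v u)" using kint_v by simp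
  qed
  show "integrable lborel (half_space_kernel b c l x)"
    unfolding half_space_kernel_def[abs_def] using lborel_pair.integrable_snd[OF kint] by simp
  assume z: "z \<bullet> l = 0"
  have kE: "integrable (lborel \<Otimes>\<^sub>M lborel) (\<lambda>(v, u). of_real (?k v u) * ?E z \<xi> u)"
  proof (rule Bochner_Integration.integrable_bound[OF kint])
    show "(\<lambda>(v, u). of_real (?k v u) * ?E z \<xi> u) \<in> borel_measurable (lborel \<Otimes>\<^sub>M lborel)"
      using meas_k by measurable
  qed (auto simp: norm_mult)
  have pE: "integrable (lborel \<Otimes>\<^sub>M lborel) (\<lambda>(t, v). of_real (?p z t v) * iexp (\<xi> * t))"
  proof (rule Bochner_Integration.integrable_bound[OF pint[of z]])
    have "(\<lambda>(t, v). ?p z t v) \<in> borel_measurable (lborel \<Otimes>\<^sub>M lborel)" by (simp cong: measurable_cong_sets) measurable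
    thus "(\<lambda>(t, v). of_real (?p z t v) * iexp (\<xi> * t)) \<in> borel_measurable (lborel \<Otimes>\<^sub>M lborel)"
      by measurable
  qed (auto simp: norm_mult)
  have "(LINT u|lborel. of_real (half_space_kernel b c l x u) * ?E z \<xi> u) = (LINT u|lborel. LINT v|lborel. of_real (?k v u) * ?E z \<xi> u)"
    unfolding half_space_kernel_def by (simp add: integral_complex_of_real)
  also have "\<dots> = (LINT v|lborel. LINT u|lborel. of_real (?k v u) * ?E z \<xi> u)"
    using lborel_pair.Fubini_integral[OF kE] by simp
  also have "\<dots> = iexp (z \<bullet> x) * (LINT v|lborel. LINT t|lborel. of_real (?p z t v) * iexp (\<xi> * t))"
    unfolding kernel_integrand_fourier[OF b c l x z] by simp
  also have "(LINT v|lborel. LINT t|lborel. of_real (?p z t v) * iexp (\<xi> * t))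
    = (LINT t|lborel. LINT v|lborel. of_real (?p z t v) * iexp (\<xi> * t))"
    using lborel_pair.Fubini_integral[OF pE] by simp
  also have "\<dots> = (LINT t|lborel. of_real (poisson_profile b (sqrt ((norm z)\<^sup>2 + c\<^sup>2)) (x \<bullet> l) (- t)) * iexp (\<xi> * t))"
    using has_bochner_integral_integral_eq[OF kernel_profile_integral[OF b x c w]] by (simp add: integral_complex_of_real)
  also have "\<dots> = (LINT v|lborel. of_real (poisson_profile b (sqrt ((norm z)\<^sup>2 + c\<^sup>2)) (x \<bullet> l) v) * exp (- (\<i> * of_real \<xi>) * of_real v))"
    using lborel_integral_real_affine[of "-1" "\<lambda>v. of_real (poisson_profile b (sqrt ((norm z)\<^sup>2 + c\<^sup>2)) (x \<bullet> l) v) * exp (- (\<i> * of_real \<xi>) * of_real v)" 0]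
    by (simp add: mult.assoc)
  finally show "(LINT u|lborel. of_real (half_space_kernel b c l x u) * ?E z \<xi> u)
      = iexp (z \<bullet> x) * (LINT v|lborel. of_real (poisson_profile b (sqrt ((norm z)\<^sup>2 + c\<^sup>2)) (x \<bullet> l) v) * exp (- (\<i> * of_real \<xi>) * of_real v))" .
qed

section \<open>The exit measure\<close>

text \<open>The indicator of a nonempty closed set is the decreasing limit of truncated distance
  functions, and closed sets form an intersection-stable generator of the Borel sets.\<close>

lemma finite_measure_eqI_continuous:
  fixes \<mu> \<nu> :: "'a::euclidean_space measure"
  assumes [simp]: "sets \<mu> = sets borel" "sets \<nu> = sets borel" and fin: "finite_measure \<mu>" "finite_measure \<nu>"
    and eq: "\<And>f :: 'a \<Rightarrow> real. continuous_on UNIV f \<Longrightarrow> (\<And>x. 0 \<le> f x \<and> f x \<le> 1) \<Longrightarrow> (LINT x|\<mu>. f x) = (LINT x|\<nu>. f x)"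
  shows "\<mu> = \<nu>"
proof (rule measure_eqI_generator_eq[where E="Collect closed" and \<Omega>=UNIV and A="\<lambda>_. UNIV"])
  have space: "space \<mu> = UNIV" "space \<nu> = UNIV" using sets_eq_imp_space_eq[of \<mu> borel] sets_eq_imp_space_eq[of \<nu> borel] by auto
  have lim: "(\<lambda>n. LINT x|\<rho>. max 0 (1 - real n * infdist x F)) \<longlonglongrightarrow> measure \<rho> F"
    if \<rho>: "finite_measure \<rho>" "sets \<rho> = sets borel" and F: "closed F" "F \<noteq> {}" for \<rho> :: "'a measure" and F
  proof -
    interpret finite_measure \<rho> by fact
    have sF: "F \<in> sets \<rho>" using F \<rho> by simp
    have "(\<lambda>n. LINT x|\<rho>. max 0 (1 - real n * infdist x F)) \<longlonglongrightarrow> (LINT x|\<rho>. indicator F x)"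
    proof (rule integral_dominated_convergence[where w="\<lambda>_. 1"])
      show "indicator F \<in> borel_measurable \<rho>" using sF by simp
      show "(\<lambda>x. max 0 (1 - real n * infdist x F)) \<in> borel_measurable \<rho>" for n
        using \<rho>(2) by (subst measurable_cong_sets[OF \<rho>(2) refl])
          (intro borel_measurable_continuous_onI continuous_intros)
      show "AE x in \<rho>. (\<lambda>n. max 0 (1 - real n * infdist x F)) \<longlonglongrightarrow> indicator F x"
      proof (rule AE_I2)
        fix x
        show "(\<lambda>n. max 0 (1 - real n * infdist x F)) \<longlonglongrightarrow> indicator F x"
        proof (cases "x \<in> F")
          case True thus ?thesis using F by simp
        next
          case False
          hence d: "infdist x F > 0" using F by (metis in_closed_iff_infdist_zero infdist_nonneg order_less_le)
          have "\<forall>\<^sub>F n in sequentially. real n > 1 / infdist x F"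
            using filterlim_real_sequentially unfolding filterlim_at_top_dense by blast
          hence "\<forall>\<^sub>F n in sequentially. max 0 (1 - real n * infdist x F) = indicator F x"
            by eventually_elim (use False d in \<open>auto simp: field_simps max_def\<close>)
          thus ?thesis by (rule tendsto_eventually)
        qed
      qed
      show "AE x in \<rho>. norm (max 0 (1 - real n * infdist x F)) \<le> 1" for n
        by (auto simp: infdist_nonneg)
    qed simp
    thus ?thesis using sF by simp
  qed
  fix F :: "'a set" assume F: "F \<in> Collect closed"
  show "emeasure \<mu> F = emeasure \<nu> F"
  \<comment> \<open>\<open>infdist x {}\<close> is \<open>0\<close> by convention, so the
    approximating functions would be constantly 1 for the empty set.\<close>
  proof (cases "F = {}")
    case False
    have "(LINT x|\<mu>. max 0 (1 - real n * infdist x F)) = (LINT x|\<nu>. max 0 (1 - real n * infdist x F))" for n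
      by (rule eq) (auto intro!: continuous_intros simp: infdist_nonneg)
    hence "measure \<mu> F = measure \<nu> F"
      using lim[OF fin(1) _ _ False] lim[OF fin(2) _ _ False] F LIMSEQ_unique by auto
    thus ?thesis using fin by (simp add: finite_measure.emeasure_eq_measure)
  qed simp
next
  show "emeasure \<mu> UNIV \<noteq> \<infinity>" for i :: nat using fin(1) by (metis finite_measure.emeasure_finite infinity_ennreal_def)
qed (auto simp: borel_eq_closed Int_stable_def)

context relativistic_regular
begin

section \<open>The law of the discounted hitting position\<close>

definition kill :: "'a \<Rightarrow> 'w \<Rightarrow> real" where
  "kill x \<omega> = of_bool (hits l x \<omega>) * exp (- m * hit_time l x \<omega>)"

lemma of_real_kill: "complex_of_real (kill x \<omega>) = of_bool (hits l x \<omega>) * of_real (exp (- m * hit_time l x \<omega>))"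
  by (simp add: kill_def)

lemma measurable_kill [measurable]: "kill x \<in> borel_measurable M"
  unfolding kill_def by measurable

lemma kill_bounds: "0 \<le> kill x \<omega>" "kill x \<omega> \<le> 1"
  using m hit_time_nonneg[of l x \<omega>] by (auto simp: kill_def)

lemma integrable_kill: "integrable M (kill x)"
  by (rule integrable_const_bound[where B=1]) (use kill_bounds in auto)

text \<open>Every frequency splits into a part orthogonal to \<open>l\<close> and a multiple of
  \<open>l\<close>; there both transforms equal the same phase times the transform of the profile,
  so Fourier uniqueness applies.\<close>

lemma kill_integral_continuous:
  fixes f :: "'a \<Rightarrow> complex"
  assumes lB: "l \<in> Basis" and x: "x \<bullet> l > 0" and f: "continuous_on UNIV f" and B: "\<And>y. norm (f y) \<le> B"
  shows "(LINT \<omega>|M. of_real (kill x \<omega>) * f (x + Z (hit_time l x \<omega>) \<omega>)) = (LINT u|lborel. of_real (half_space_kernel b c l x u) * f u)"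
proof (rule fourier_determines[OF _ _ _ _ _ _ _ f B])
  show "sigma_finite_measure M" ..
  show "sigma_finite_measure (lborel :: 'a measure)" ..
  show "integrable M (\<lambda>\<omega>. complex_of_real (kill x \<omega>))" using integrable_kill by simp
  show "integrable lborel (\<lambda>u. complex_of_real (half_space_kernel b c l x u))" using integrable_kernel[OF b c lB x] by simp
  fix \<zeta> :: 'a
  define z where "z = \<zeta> - (\<zeta> \<bullet> l) *\<^sub>R l"
  have z: "z \<bullet> l = 0" using lB by (simp add: z_def inner_diff_left)
  have \<zeta>: "\<zeta> = z + (\<zeta> \<bullet> l) *\<^sub>R l" by (simp add: z_def)
  show "(LINT \<omega>|M. of_real (kill x \<omega>) * iexp (\<zeta> \<bullet> (x + Z (hit_time l x \<omega>) \<omega>))) = (LINT u|lborel. of_real (half_space_kernel b c l x u) * iexp (\<zeta> \<bullet> u))"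
    using hitting_fourier[OF x z, of "\<zeta> \<bullet> l"] kernel_fourier[OF b c lB x z, of "\<zeta> \<bullet> l"]
    unfolding \<zeta>[symmetric] width_def of_real_kill by (simp add: mult.assoc)
qed measurable

lemma kill_integral_indicator:
  assumes lB: "l \<in> Basis" and x: "x \<bullet> l > 0" and A: "A \<in> sets borel"
  shows "(LINT \<omega>|M. kill x \<omega> * indicator A (x + Z (hit_time l x \<omega>) \<omega>)) = (LINT u|lborel. half_space_kernel b c l x u * indicator A u)"
proof -
  let ?\<phi> = "\<lambda>\<omega>. x + Z (hit_time l x \<omega>) \<omega>"
  let ?\<mu> = "distr (density M (\<lambda>\<omega>. ennreal (kill x \<omega>))) borel ?\<phi>"
  let ?\<nu> = "density lborel (\<lambda>u. ennreal (half_space_kernel b c l x u))"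
  have int\<mu>: "(LINT u|?\<mu>. f u) = (LINT \<omega>|M. kill x \<omega> * f (?\<phi> \<omega>))" if [measurable]: "f \<in> borel_measurable borel" for f :: "'a \<Rightarrow> real"
    by (subst integral_distr; (subst integral_density)?) (auto simp: kill_bounds)
  have int\<nu>: "(LINT u|?\<nu>. f u) = (LINT u|lborel. half_space_kernel b c l x u * f u)" if [measurable]: "f \<in> borel_measurable borel" for f :: "'a \<Rightarrow> real"
    by (subst integral_density) (auto simp: kernel_nonneg[OF b c x])
  have "?\<mu> = ?\<nu>"
  proof (rule finite_measure_eqI_continuous)
    have "emeasure ?\<mu> UNIV = ennreal (LINT \<omega>|M. kill x \<omega>)"
      by (subst emeasure_distr; (subst emeasure_density)?)
         (auto simp: nn_integral_eq_integral[OF integrable_kill] kill_bounds cong: nn_integral_cong)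
    thus "finite_measure ?\<mu>" by (intro finite_measureI) simp
    have "emeasure ?\<nu> UNIV = ennreal (LINT u|lborel. half_space_kernel b c l x u)"
      by (subst emeasure_density) (auto simp: nn_integral_eq_integral[OF integrable_kernel[OF b c lB x]] kernel_nonneg[OF b c x])
    thus "finite_measure ?\<nu>" by (intro finite_measureI) simp
    fix f :: "'a \<Rightarrow> real" assume f: "continuous_on UNIV f" and f1: "\<And>x. 0 \<le> f x \<and> f x \<le> 1"
    have [measurable]: "f \<in> borel_measurable borel" using f by (rule borel_measurable_continuous_onI)
    have "(LINT \<omega>|M. of_real (kill x \<omega>) * complex_of_real (f (?\<phi> \<omega>))) = (LINT u|lborel. of_real (half_space_kernel b c l x u) * complex_of_real (f u))"
    proof (rule kill_integral_continuous[OF lB x])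
      show "continuous_on UNIV (\<lambda>u. complex_of_real (f u))" using f by (intro continuous_intros)
      show "norm (complex_of_real (f u)) \<le> 1" for u using f1[of u] by simp
    qed
    hence "complex_of_real (LINT \<omega>|M. kill x \<omega> * f (?\<phi> \<omega>)) = complex_of_real (LINT u|lborel. half_space_kernel b c l x u * f u)"
      by (simp only: of_real_mult[symmetric] integral_complex_of_real)
    thus "(LINT u|?\<mu>. f u) = (LINT u|?\<nu>. f u)" by (simp only: of_real_eq_iff int\<mu>[OF \<open>f \<in> borel_measurable borel\<close>] int\<nu>[OF \<open>f \<in> borel_measurable borel\<close>])
  qed simp_all
  hence "(LINT u|?\<mu>. indicator A u) = (LINT u|?\<nu>. indicator A u :: real)" by simp
  thus ?thesis using A by (simp only: int\<mu> int\<nu> borel_measurable_indicator)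
qed

section \<open>Open versus closed half-space\<close>

text \<open>At zero frequency the mass is that of the profile, which is not visibly continuous in
  x\<bullet>l. Multiplied by the gamma transform it becomes the tail of a fixed integrable function,
  and continuity is evident.\<close>

lemma kill_mass:
  assumes x: "x \<bullet> l > 0"
  shows "laplace_powr b c * of_real (LINT \<omega>|M. kill x \<omega>) = (LINT s|lborel. of_real (indicator {x \<bullet> l<..} s * s powr (b - 1)) * exp (- complex_of_real c * of_real s))"
proof -
  have "complex_of_real (LINT \<omega>|M. kill x \<omega>) = (LINT \<omega>|M. of_real (kill x \<omega>) * 1)" by (simp add: integral_complex_of_real)
  also have "\<dots> = (LINT v|lborel. of_real (poisson_profile b c (x \<bullet> l) v))"
    using hitting_fourier[OF x, of 0 0] c by (simp add: of_real_kill width_def)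
  finally show ?thesis
    using laplace_poisson_profile[OF b c x, of 0] by simp
qed

lemma kill_mass_continuous:
  assumes x: "x \<bullet> l > 0" and y: "\<And>n. y n \<bullet> l > 0" "(\<lambda>n. y n \<bullet> l) \<longlonglongrightarrow> x \<bullet> l"
  shows "(\<lambda>n. LINT \<omega>|M. kill (y n) \<omega>) \<longlonglongrightarrow> (LINT \<omega>|M. kill x \<omega>)"
proof -
  let ?g = "\<lambda>a s. complex_of_real (indicator {a<..} s * s powr (b - 1)) * exp (- complex_of_real c * of_real s)"
  have "(\<lambda>n. LINT s|lborel. ?g (y n \<bullet> l) s) \<longlonglongrightarrow> (LINT s|lborel. ?g (x \<bullet> l) s)"
  proof (rule integral_dominated_convergence)
    show "integrable lborel (\<lambda>s. indicator {0<..} s * s powr (b - 1) * exp (- c * s))"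
      using gamma_integral_scaled[OF b(1) c] by (auto intro: integrable.intros)
    have "AE s in lborel. s \<noteq> x \<bullet> l" by (rule AE_lborel_singleton)
    thus "AE s in lborel. (\<lambda>n. ?g (y n \<bullet> l) s) \<longlonglongrightarrow> ?g (x \<bullet> l) s"
    proof eventually_elim
      case (elim s)
      have "(\<lambda>n. indicator {y n \<bullet> l<..} s :: real) \<longlonglongrightarrow> indicator {x \<bullet> l<..} s"
      proof (cases "s > x \<bullet> l")
        case True
        have "\<forall>\<^sub>F n in sequentially. y n \<bullet> l < s" by (rule order_tendstoD(2)[OF y(2) True])
        thus ?thesis using True by (intro tendsto_eventually) (auto elim!: eventually_mono)
      next
        case False
        hence "s < x \<bullet> l" using elim by linarith
        hence "\<forall>\<^sub>F n in sequentially. s < y n \<bullet> l" by (rule order_tendstoD(1)[OF y(2)])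
        thus ?thesis using False by (intro tendsto_eventually) (auto elim!: eventually_mono)
      qed
      thus ?case by (intro tendsto_intros)
    qed
    show "AE s in lborel. norm (?g (y n \<bullet> l) s) \<le> indicator {0<..} s * s powr (b - 1) * exp (- c * s)" for n
      using y(1)[of n] by (auto simp: norm_mult split: split_indicator)
  qed auto
  hence "(\<lambda>n. laplace_powr b c * of_real (LINT \<omega>|M. kill (y n) \<omega>)) \<longlonglongrightarrow> laplace_powr b c * of_real (LINT \<omega>|M. kill x \<omega>)"
    unfolding kill_mass[OF x] kill_mass[OF y(1)] by simp
  moreover have "laplace_powr b c \<noteq> 0"
    using laplace_powr_eq[OF b(1), of c] c Gamma_real_pos[OF b(1)] by auto
  ultimately have "(\<lambda>n. complex_of_real (LINT \<omega>|M. kill (y n) \<omega>)) \<longlonglongrightarrow> complex_of_real (LINT \<omega>|M. kill x \<omega>)"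
    using tendsto_mult_left_iff by blast
  thus ?thesis unfolding tendsto_of_real_iff .
qed

text \<open>The hitting time of the closed half-space lies between the hitting times of the open one from \<open>x\<close> and from points
  slightly below \<open>x\<close>, and the latter converge to the former in expectation.\<close>

lemma exit_time_eq_hit_time:
  assumes lB: "l \<in> Basis" and x: "x \<bullet> l > 0"
  shows "AE \<omega> in M. exit_time {u. u \<bullet> l > 0} (\<lambda>t. x + Z t \<omega>) = (if hits l x \<omega> then ereal (hit_time l x \<omega>) else \<infinity>)"
proof -
  \<comment> \<open>Starting points that increase to \<open>x\<close> along the normal; the offset 2
    keeps even the first of them in the upper half-space.\<close>
  define y where "y n = x - ((x \<bullet> l) / real (n + 2)) *\<^sub>R l" for n :: nat
  have ll: "l \<bullet> l = 1" using lB by simp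
  have yl: "y n \<bullet> l = x \<bullet> l - (x \<bullet> l) / real (n + 2)" for n by (simp add: y_def inner_diff_left ll)
  have y_pos: "y n \<bullet> l > 0" for n using x divide_strict_left_mono[of 1 "real (n + 2)" "x \<bullet> l"] by (simp add: yl)
  have y_lim: "(\<lambda>n. y n \<bullet> l) \<longlonglongrightarrow> x \<bullet> l"
  proof -
    have "(\<lambda>n. x \<bullet> l - (x \<bullet> l) / real (n + 2)) \<longlonglongrightarrow> x \<bullet> l" by real_asymp
    thus ?thesis by (simp add: yl)
  qed
  have shift: "(y n + v) \<bullet> l = (x + v) \<bullet> l - (x \<bullet> l) / real (n + 2)" for n v
    using yl[of n] by (simp add: inner_add_left)
  define S where "S \<omega> = {t. 0 \<le> t \<and> (x + Z t \<omega>) \<bullet> l \<le> 0}" for \<omega>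
  \<comment> \<open>The discounted hitting time of the closed half-space. It is only compared
    pointwise with measurable functions, so the question of its own measurability does not
    arise.\<close>
  define q where "q \<omega> = (if S \<omega> = {} then 0 else exp (- m * Inf (S \<omega>)))" for \<omega>
  have S_bdd: "bdd_below (S \<omega>)" for \<omega> by (auto simp: S_def intro: bdd_belowI[of _ 0])
  have mono: "kill u \<omega> \<le> kill v \<omega>" if "v \<bullet> l \<le> u \<bullet> l" for u v \<omega>
  proof (cases "hits l u \<omega>")
    case True
    have sub: "{t. 0 \<le> t \<and> (u + Z t \<omega>) \<bullet> l < 0} \<subseteq> {t. 0 \<le> t \<and> (v + Z t \<omega>) \<bullet> l < 0}" using that by (auto simp: inner_add_left)
    have hv: "hits l v \<omega>" using True sub by (auto simp: hits_def)
    have "hit_time l v \<omega> \<le> hit_time l u \<omega>"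
      unfolding hit_time_def using True hv sub
      by (auto intro!: cInf_superset_mono bdd_belowI[of _ 0] simp: hits_def)
    thus ?thesis using True hv m by (simp add: kill_def)
  qed (simp add: kill_def kill_bounds)
  have q_low: "kill x \<omega> \<le> q \<omega>" for \<omega>
  proof (cases "hits l x \<omega>")
    case True
    have sub: "{t. 0 \<le> t \<and> (x + Z t \<omega>) \<bullet> l < 0} \<subseteq> S \<omega>" by (auto simp: S_def)
    have ne: "{t. 0 \<le> t \<and> (x + Z t \<omega>) \<bullet> l < 0} \<noteq> {}" using True by (auto simp: hits_def)
    hence "Inf (S \<omega>) \<le> hit_time l x \<omega>" unfolding hit_time_def using True by (auto intro!: cInf_superset_mono[OF _ S_bdd sub])
    moreover have "S \<omega> \<noteq> {}" using ne sub by blast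
    ultimately show ?thesis using True m by (simp add: kill_def q_def)
  qed (simp add: kill_def q_def)
  \<comment> \<open>From the strictly lower point \<open>y n\<close>, a visit of the closed
    half-space seen from \<open>x\<close> is a visit of the open one.\<close>
  have q_up: "q \<omega> \<le> kill (y n) \<omega>" for \<omega> n
  proof (cases "S \<omega> = {}")
    case False
    have t: "hits l (y n) \<omega> \<and> hit_time l (y n) \<omega> \<le> t" if "t \<in> S \<omega>" for t
    proof (rule hit_time_le)
      show "0 \<le> t" using that by (simp add: S_def)
      have "(x \<bullet> l) / real (n + 2) > 0" using x by simp
      thus "(y n + Z t \<omega>) \<bullet> l < 0" using that shift[of n "Z t \<omega>"] by (simp add: S_def)
    qed
    have "hit_time l (y n) \<omega> \<le> Inf (S \<omega>)" using t False by (intro cInf_greatest) auto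
    moreover have "hits l (y n) \<omega>" using t False by blast
    ultimately show ?thesis using False m by (simp add: kill_def q_def)
  qed (simp add: q_def kill_bounds)
  define g where "g \<omega> = (INF n. kill (y n) \<omega>)" for \<omega>
  have lim: "(\<lambda>n. kill (y n) \<omega>) \<longlonglongrightarrow> g \<omega>" for \<omega>
    unfolding g_def
  proof (rule LIMSEQ_decseq_INF)
    show "bdd_below (range (\<lambda>n. kill (y n) \<omega>))" by (auto intro!: bdd_belowI[of _ 0] kill_bounds)
    show "decseq (\<lambda>n. kill (y n) \<omega>)"
      unfolding decseq_def using x by (auto intro!: mono diff_mono divide_left_mono simp: yl)
  qed
  have g_meas [measurable]: "g \<in> borel_measurable M"
    by (rule borel_measurable_LIMSEQ_metric[OF _ lim]) measurable
  have g_low: "kill x \<omega> \<le> g \<omega>" for \<omega>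
    unfolding g_def by (rule cINF_greatest) (use x in \<open>auto intro!: mono simp: yl\<close>)
  have g_up: "g \<omega> \<le> kill (y n) \<omega>" for n \<omega>
    unfolding g_def by (rule cINF_lower) (auto intro!: bdd_belowI[of _ 0] kill_bounds)
  have q_g: "q \<omega> \<le> g \<omega>" for \<omega> unfolding g_def by (rule cINF_greatest) (use q_up in auto)
  have g1: "0 \<le> g \<omega>" "g \<omega> \<le> 1" for \<omega> using g_low[of \<omega>] g_up[of \<omega> 0] kill_bounds[of x \<omega>] kill_bounds[of "y 0" \<omega>] by linarith+
  have g_int: "integrable M g" by (rule integrable_const_bound[where B=1]) (use g1 in auto)
  have "(\<lambda>n. LINT \<omega>|M. kill (y n) \<omega>) \<longlonglongrightarrow> (LINT \<omega>|M. g \<omega>)"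
    by (rule integral_dominated_convergence[where w="\<lambda>_. 1"]) (use lim kill_bounds in auto)
  hence "(LINT \<omega>|M. g \<omega>) = (LINT \<omega>|M. kill x \<omega>)"
    using kill_mass_continuous[OF x y_pos y_lim] LIMSEQ_unique by blast
  \<comment> \<open>A nonnegative function with zero integral vanishes almost everywhere, which
    squeezes \<open>q\<close> between two equal values.\<close>
  hence "(LINT \<omega>|M. g \<omega> - kill x \<omega>) = 0" using g_int integrable_kill by simp
  hence "AE \<omega> in M. g \<omega> - kill x \<omega> = 0"
    using integral_nonneg_eq_0_iff_AE[of M "\<lambda>\<omega>. g \<omega> - kill x \<omega>"] g_int integrable_kill g_low by auto
  thus ?thesis
  proof eventually_elim
    case (elim \<omega>)
    have q: "q \<omega> = kill x \<omega>" using elim q_g[of \<omega>] q_low[of \<omega>] by linarith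
    have set: "{t. 0 \<le> t \<and> x + Z t \<omega> \<notin> {u. u \<bullet> l > 0}} = S \<omega>" by (auto simp: S_def not_less)
    show ?case
    proof (cases "hits l x \<omega>")
      case True
      \<comment> \<open>Since m > 0, the discount determines the time, and it is zero exactly on
        paths without a visit.\<close>
      hence "q \<omega> > 0" unfolding q by (simp add: kill_def)
      hence ne: "S \<omega> \<noteq> {}" by (auto simp: q_def)
      hence "exp (- m * Inf (S \<omega>)) = exp (- m * hit_time l x \<omega>)" using q True by (simp add: q_def kill_def)
      hence "Inf (S \<omega>) = hit_time l x \<omega>" using m by simp
      moreover have "Inf (ereal ` S \<omega>) = ereal (Inf (S \<omega>))" using ereal_Inf'[OF S_bdd ne] by simp
      ultimately show ?thesis using True unfolding exit_time_def set by simp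
    next
      case False
      hence "q \<omega> = 0" unfolding q by (simp add: kill_def)
      hence "S \<omega> = {}" by (auto simp: q_def split: if_splits)
      thus ?thesis using False unfolding exit_time_def set by (simp add: top_ereal_def)
    qed
  qed
qed

end

section \<open>The Poisson kernel\<close>

text \<open>The exit time is known only up to a null set; this makes the integrand of
  \<open>exit_measure\<close> measurable for the completion, so the integrals can be compared almost
  everywhere.\<close>

lemma borel_measurable_completion_AE:
  assumes f: "f \<in> borel_measurable M" and eq: "AE \<omega> in M. g \<omega> = f \<omega>"
  shows "g \<in> borel_measurable (completion M)"
proof (rule measurableI)
  fix B :: "'b set" assume B: "B \<in> sets borel"
  have "f -` B \<inter> space (completion M) \<in> sets (completion M)"
    by (rule measurable_sets[OF measurable_completion[OF f] B])
  thus "g -` B \<inter> space (completion M) \<in> sets (completion M)"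
  proof (rule completion.in_sets_AE[rotated])
    show "AE \<omega> in completion M. \<omega> \<in> f -` B \<inter> space (completion M) \<longleftrightarrow> \<omega> \<in> g -` B \<inter> space (completion M)"
      using AE_completion[OF eq] by eventually_elim auto
  qed auto
qed simp

context relativistic_regular
begin

text \<open>Off one null set \<open>X\<close> and \<open>Z\<close> agree at all nonnegative times
  simultaneously, so exit time and exit position are those of \<open>Z\<close>. The former is the
  hitting time of the open half-space, whose discounted law is known.\<close>

lemma exit_measure_eq:
  assumes lB: "l \<in> Basis" and x: "x \<bullet> l > 0" and X: "AE \<omega> in M. \<forall>t\<ge>0. X t \<omega> = Z t \<omega>" and A [measurable]: "A \<in> sets borel"
  shows "exit_measure M X m {u. u \<bullet> l > 0} x A = (LINT u|lborel. half_space_kernel b c l x u * indicator A u)"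
proof -
  let ?\<tau> = "\<lambda>\<omega>. exit_time {u. u \<bullet> l > 0} (\<lambda>t. x + X t \<omega>)"
  let ?g = "\<lambda>\<omega>. indicator {\<omega> \<in> space M. ?\<tau> \<omega> < \<infinity>} \<omega> *\<^sub>R (exp (- m * real_of_ereal (?\<tau> \<omega>)) * indicat_real A (x + X (real_of_ereal (?\<tau> \<omega>)) \<omega>))"
  let ?f = "\<lambda>\<omega>. kill x \<omega> * indicator A (x + Z (hit_time l x \<omega>) \<omega>)"
  have f: "?f \<in> borel_measurable M" by measurable
  have eq: "AE \<omega> in M. ?g \<omega> = ?f \<omega>"
    using X exit_time_eq_hit_time[OF lB x] AE_space
  proof eventually_elim
    case (elim \<omega>)
    have "(\<lambda>t. 0 \<le> t \<and> x + X t \<omega> \<notin> {u. u \<bullet> l > 0}) = (\<lambda>t. 0 \<le> t \<and> x + Z t \<omega> \<notin> {u. u \<bullet> l > 0})"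
      using elim(1) by (auto simp: fun_eq_iff)
    hence "?\<tau> \<omega> = (if hits l x \<omega> then ereal (hit_time l x \<omega>) else \<infinity>)"
      using elim(2) unfolding exit_time_def by simp
    thus ?case using elim(1,3) hit_time_nonneg[of l x \<omega>] by (auto simp: kill_def)
  qed
  have "exit_measure M X m {u. u \<bullet> l > 0} x A = integral\<^sup>L (completion M) ?g"
    unfolding exit_measure_def Let_def set_lebesgue_integral_def ..
  also have "\<dots> = integral\<^sup>L (completion M) ?f"
    by (rule integral_cong_AE[OF borel_measurable_completion_AE[OF f eq] measurable_completion[OF f] AE_completion[OF eq]])
  also have "\<dots> = integral\<^sup>L M ?f" by (rule integral_completion[OF f])
  also have "\<dots> = (LINT u|lborel. half_space_kernel b c l x u * indicator A u)"
    by (rule kill_integral_indicator[OF lB x A])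
  finally show ?thesis .
qed

end

section \<open>A version with regular paths\<close>

text \<open>Independence says that the joint law is the product of the marginal laws, and laws do
  not see null sets.\<close>

lemma (in prob_space) indep_vars_cong_AE:
  assumes ind: "indep_vars (\<lambda>_. N) X I" and Y: "\<And>i. i \<in> I \<Longrightarrow> random_variable N (Y i)"
    and eq: "AE \<omega> in M. \<forall>i\<in>I. X i \<omega> = Y i \<omega>"
  shows "indep_vars (\<lambda>_. N) Y I"
proof (cases "I = {}")
  case True
  thus ?thesis by (auto simp: indep_vars_def indep_sets_def)
next
  case False
  have X: "random_variable N (X i)" if "i \<in> I" for i using ind that by (auto simp: indep_vars_def)
  have "distr M (PiM I (\<lambda>_. N)) (\<lambda>\<omega>. \<lambda>i\<in>I. Y i \<omega>) = distr M (PiM I (\<lambda>_. N)) (\<lambda>\<omega>. \<lambda>i\<in>I. X i \<omega>)"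
    by (rule distr_cong_AE) (use X Y eq in \<open>auto intro!: measurable_restrict simp: fun_eq_iff elim!: eventually_mono\<close>)
  also have "\<dots> = PiM I (\<lambda>i. distr M N (X i))"
    using ind X by (subst (asm) indep_vars_iff_distr_eq_PiM'[OF False]) auto
  also have "\<dots> = PiM I (\<lambda>i. distr M N (Y i))"
    by (intro PiM_cong refl distr_cong_AE) (use X Y eq in \<open>auto elim!: eventually_mono\<close>)
  finally show ?thesis using Y by (subst indep_vars_iff_distr_eq_PiM'[OF False]) auto
qed

text \<open>Replacing all bad paths by the zero path turns the almost sure path properties into sure
  ones, which the pathwise arguments on hitting times require; the finite-dimensional laws do not
  change.\<close>

lemma levy_process_regular_version:
  fixes X :: "real \<Rightarrow> 'w \<Rightarrow> 'a::euclidean_space"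
  assumes levy: "levy_process M X"
  obtains Z where "regular_levy M Z" "AE \<omega> in M. \<forall>t\<ge>0. X t \<omega> = Z t \<omega>"
proof -
  interpret prob_space M using levy by (simp add: levy_process_def)
  have X_meas: "X t \<in> borel_measurable M" if "t \<ge> 0" for t using levy that by (simp add: levy_process_def)
  have "AE \<omega> in M. cadlag (\<lambda>t. X t \<omega>) \<and> X 0 \<omega> = 0"
    using levy by (auto simp: levy_process_def)
  then obtain N where "{\<omega> \<in> space M. \<not> (cadlag (\<lambda>t. X t \<omega>) \<and> X 0 \<omega> = 0)} \<subseteq> N" "emeasure M N = 0" "N \<in> sets M"
    by (rule AE_E)
  hence N: "N \<in> null_sets M" "{\<omega> \<in> space M. \<not> (cadlag (\<lambda>t. X t \<omega>) \<and> X 0 \<omega> = 0)} \<subseteq> N"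
    by (auto simp: null_sets_def)
  \<comment> \<open>Points outside \<open>space M\<close> are included because the path conditions
    of \<open>regular_levy\<close> range over every \<omega>; the value 0 up to time 0 joins
    right-continuously to paths that start at 0.\<close>
  define Z where "Z t \<omega> = (if \<omega> \<in> N \<or> \<omega> \<notin> space M \<or> t \<le> 0 then 0 else X t \<omega>)" for t \<omega>
  have good: "cadlag (\<lambda>t. X t \<omega>)" "X 0 \<omega> = 0" if "\<omega> \<in> space M" "\<omega> \<notin> N" for \<omega> using that N(2) by auto
  have eq: "AE \<omega> in M. \<forall>t\<ge>0. X t \<omega> = Z t \<omega>"
  proof -
    have "AE \<omega> in M. \<omega> \<notin> N" using N(1) by (rule AE_not_in)
    thus ?thesis using AE_space by eventually_elim (auto simp: Z_def good)
  qed
  have Nm [measurable]: "N \<in> sets M" using N(1) by auto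
  have Z_meas [measurable]: "Z t \<in> borel_measurable M" for t
  proof (cases "t \<le> 0")
    case False
    have "(\<lambda>\<omega>. if \<omega> \<in> N then 0 else X t \<omega>) \<in> borel_measurable M"
      by (rule measurable_If_set) (use X_meas[of t] False in auto)
    thus ?thesis by (rule measurable_cong[THEN iffD1, rotated]) (use False in \<open>auto simp: Z_def\<close>)
  qed (simp add: Z_def[abs_def])
  have incr: "AE \<omega> in M. X s \<omega> - X t \<omega> = Z s \<omega> - Z t \<omega>" if "s \<ge> 0" "t \<ge> 0" for s t
    using eq by eventually_elim (use that in auto)
  have "levy_process M Z"
    unfolding levy_process_def
  proof (intro conjI allI impI)
    show "prob_space M" by (rule prob_space_axioms)
    show "AE \<omega> in M. Z 0 \<omega> = 0" by (simp add: Z_def)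
    fix n :: nat and t :: "nat \<Rightarrow> real" assume t: "0 \<le> t 0 \<and> (\<forall>i<n. t i < t (Suc i))"
    have tn: "t i \<ge> 0" if "i \<le> n" for i
      using that
    proof (induction i)
      case (Suc i)
      hence "t i < t (Suc i)" using t by auto
      thus ?case using Suc by auto
    qed (use t in simp)
    have "indep_vars (\<lambda>_. borel) (\<lambda>i \<omega>. X (t (Suc i)) \<omega> - X (t i) \<omega>) {..<n}"
      using levy t by (simp add: levy_process_def)
    thus "indep_vars (\<lambda>_. borel) (\<lambda>i \<omega>. Z (t (Suc i)) \<omega> - Z (t i) \<omega>) {..<n}"
    proof (rule indep_vars_cong_AE)
      show "AE \<omega> in M. \<forall>i\<in>{..<n}. X (t (Suc i)) \<omega> - X (t i) \<omega> = Z (t (Suc i)) \<omega> - Z (t i) \<omega>"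
        using eq by eventually_elim (use tn in auto)
    qed measurable
  next
    fix s t :: real assume st: "0 \<le> s" "0 \<le> t"
    have "distr M borel (\<lambda>\<omega>. Z (s + t) \<omega> - Z s \<omega>) = distr M borel (\<lambda>\<omega>. X (s + t) \<omega> - X s \<omega>)"
      by (rule distr_cong_AE) (use incr[of "s + t" s] st X_meas in \<open>auto elim!: eventually_mono\<close>)
    also have "\<dots> = distr M borel (X t)" using levy st by (simp add: levy_process_def)
    also have "\<dots> = distr M borel (Z t)"
      by (rule distr_cong_AE) (use eq st X_meas in \<open>auto elim!: eventually_mono\<close>)
    finally show "distr M borel (\<lambda>\<omega>. Z (s + t) \<omega> - Z s \<omega>) = distr M borel (Z t)" .
  next
    have cad: "AE \<omega> in M. cadlag (\<lambda>t. X t \<omega>)" using levy by (simp add: levy_process_def)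
    show "AE \<omega> in M. cadlag (\<lambda>t. Z t \<omega>)"
      using cad eq
    proof eventually_elim
      case (elim \<omega>)
      have ev: "\<forall>\<^sub>F s in at_right t. X s \<omega> = Z s \<omega>" if "t \<ge> 0" for t
        using eventually_at_right_less[of t] by eventually_elim (use elim(2) that in auto)
      have ev': "\<forall>\<^sub>F s in at_left t. X s \<omega> = Z s \<omega>" if "t > 0" for t
        using eventually_at_left_real[OF that] by eventually_elim (use elim(2) in auto)
      show ?case unfolding cadlag_def
      proof (intro conjI allI impI)
        fix t :: real assume t: "t \<ge> 0"
        have "((\<lambda>t. X t \<omega>) \<longlongrightarrow> Z t \<omega>) (at_right t)" using elim t by (auto simp: cadlag_def)
        thus "((\<lambda>t. Z t \<omega>) \<longlongrightarrow> Z t \<omega>) (at_right t)" by (rule Lim_transform_eventually[OF _ ev[OF t]])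
      next
        fix t :: real assume t: "t > 0"
        then obtain a where "((\<lambda>t. X t \<omega>) \<longlongrightarrow> a) (at_left t)" using elim by (auto simp: cadlag_def)
        hence "((\<lambda>t. Z t \<omega>) \<longlongrightarrow> a) (at_left t)" by (rule Lim_transform_eventually[OF _ ev'[OF t]])
        thus "\<exists>a. ((\<lambda>t. Z t \<omega>) \<longlongrightarrow> a) (at_left t)" ..
      qed
    qed
  qed (auto simp: Z_meas)
  moreover have "((\<lambda>s. Z s \<omega>) \<longlongrightarrow> Z t \<omega>) (at_right t)" for t \<omega>
  proof (cases "\<omega> \<in> space M \<and> \<omega> \<notin> N \<and> t \<ge> 0")
    case True
    have X_lim: "((\<lambda>s. X s \<omega>) \<longlongrightarrow> Z t \<omega>) (at_right t)"
      using good[of \<omega>] True by (auto simp: cadlag_def Z_def split: if_splits)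
    have "\<forall>\<^sub>F s in at_right t. X s \<omega> = Z s \<omega>"
      using eventually_at_right_less[of t] by eventually_elim (use True in \<open>auto simp: Z_def\<close>)
    with X_lim show ?thesis by (rule Lim_transform_eventually)
  next
    case False
    have "\<forall>\<^sub>F s in at_right t. Z s \<omega> = Z t \<omega>"
    proof (cases "t < 0")
      case True
      have "\<forall>\<^sub>F s in at_right t. s < 0" using True by (intro eventually_at_rightI[of t 0]) auto
      thus ?thesis by eventually_elim (use True in \<open>auto simp: Z_def\<close>)
    qed (use False in \<open>auto simp: Z_def\<close>)
    thus ?thesis by (rule tendsto_eventually)
  qed
  ultimately have "regular_levy M Z"
    by unfold_locales (auto simp: Z_def)
  thus ?thesis using eq that by blast
qed

section \<open>Explicit form and uniqueness of the density\<close>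

lemma half_space_kernel_eq:
  fixes x l u :: "'a::euclidean_space"
  assumes c: "c > 0" and x: "x \<bullet> l > 0" and u: "u \<bullet> l < 0"
  shows "half_space_kernel b c l x u = 2 * (sin (pi * b) / pi) * (c / (2 * pi)) powr (real DIM('a) / 2) * ((x \<bullet> l) / (- (u \<bullet> l))) powr b *
    (bessel_K (real DIM('a) / 2) (c * norm (x - u)) / norm (x - u) powr (real DIM('a) / 2))"
proof -
  let ?d = "real DIM('a)" and ?r = "norm (x - u)"
  have r: "?r > 0" using x u by auto
  let ?I = "LINT v|lborel. indicator {0<..} v * (exp (- v) * v powr (-1 - ?d / 2) * exp (- (c * ?r)\<^sup>2 / (4 * v)))"
  let ?S = "sin (pi * b) / pi * ((x \<bullet> l) / (- (u \<bullet> l))) powr b"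
  have H: "half_space_kernel b c l x u = ?S * (c / (2 * sqrt pi)) ^ DIM('a) * ?I"
    unfolding half_space_kernel_def kernel_integrand_def integral_mult_right_zero using u by simp
  have K: "bessel_K (?d / 2) (c * ?r) = 2 powr (-1 - ?d / 2) * (c * ?r) powr (?d / 2) * ?I"
  proof -
    have "(LINT v|lborel. indicator {0<..} v * (exp (- v) * exp (- (c * ?r)\<^sup>2 / (4 * v)) * v powr (-1 - ?d / 2))) = ?I"
      by (intro Bochner_Integration.integral_cong refl) (simp only: mult_ac)
    thus ?thesis unfolding bessel_K_def set_lebesgue_integral_def real_scaleR_def by (simp only:)
  qed
  \<comment> \<open>The bases collect to (1/2) (c/(2\<pi>)) c, the square of c/(2 sqrt(\<pi>)), so
    the exponent d/2 becomes the integer power d used in \<open>kernel_integrand\<close>.\<close>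
  have const: "2 * (c / (2 * pi)) powr (?d / 2) * (2 powr (-1 - ?d / 2) * (c * ?r) powr (?d / 2) / ?r powr (?d / 2)) = (c / (2 * sqrt pi)) ^ DIM('a)"
  proof -
    have e1: "2 * 2 powr (-1 - ?d / 2) = (1 / 2) powr (?d / 2)"
    proof -
      have "2 * 2 powr (-1 - ?d / 2) = (2::real) powr (1 + (-1 - ?d / 2))" by (subst powr_add) simp
      also have "\<dots> = 1 / 2 powr (?d / 2)" by (simp add: powr_minus_divide)
      also have "\<dots> = (1 / 2) powr (?d / 2)" by (subst powr_divide) simp_all
      finally show ?thesis .
    qed
    have e2: "(c * ?r) powr (?d / 2) / ?r powr (?d / 2) = c powr (?d / 2)"
      using c r by (simp add: powr_mult)
    have alg: "2 * C * (T * R / r') = (2 * T) * C * (R / r')" for C T R r' :: real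
      by (simp only: times_divide_eq_right times_divide_eq_left mult_ac)
    have "2 * (c / (2 * pi)) powr (?d / 2) * (2 powr (-1 - ?d / 2) * (c * ?r) powr (?d / 2) / ?r powr (?d / 2))
       = (1 / 2) powr (?d / 2) * (c / (2 * pi)) powr (?d / 2) * c powr (?d / 2)"
      unfolding alg e1 e2 ..
    also have "\<dots> = ((1 / 2) * (c / (2 * pi)) * c) powr (?d / 2)"
    proof -
      have p1: "((1 / 2) * (c / (2 * pi)) * c) powr (?d / 2) = ((1 / 2) * (c / (2 * pi))) powr (?d / 2) * c powr (?d / 2)"
        by (rule powr_mult)
      have p2: "((1 / 2) * (c / (2 * pi))) powr (?d / 2) = (1 / 2) powr (?d / 2) * (c / (2 * pi)) powr (?d / 2)"
        by (rule powr_mult)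
      show ?thesis unfolding p1 p2 ..
    qed
    also have "(1 / 2) * (c / (2 * pi)) * c = (c / (2 * sqrt pi)) powr 2"
      using c by (simp add: power_divide power_mult_distrib power2_eq_square[of c])
    also have "((c / (2 * sqrt pi)) powr 2) powr (?d / 2) = (c / (2 * sqrt pi)) powr ?d"
      by (simp add: powr_powr)
    also have "\<dots> = (c / (2 * sqrt pi)) ^ DIM('a)" using c by (simp add: powr_realpow)
    finally show ?thesis .
  qed
  have alg: "2 * s * C * q * (T * J / R) = (s * q) * (2 * C * (T / R)) * J" for s C q T J R :: real
    by (simp only: times_divide_eq_right times_divide_eq_left mult_ac)
  show ?thesis unfolding K alg const by (rule H)
qed

text \<open>A candidate density is constrained only outside \<open>D\<close>, so both are cut off
  there before uniqueness of densities is applied; testing on \<open>A \<inter> - D\<close> shows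
  that the two cut-off measures coincide.\<close>

lemma poisson_kernel_unique:
  fixes D :: "'a::euclidean_space set"
  assumes D: "D \<in> sets borel" and P: "is_poisson_kernel M X m D x P" and Q: "is_poisson_kernel M X m D x Q"
  shows "AE u in lborel. u \<notin> D \<longrightarrow> Q u = P u"
proof -
  have dens: "emeasure (density lborel (\<lambda>u. ennreal (indicator (- D) u * R u))) A = ennreal (exit_measure M X m D x (A \<inter> - D))"
    if A: "A \<in> sets borel" and R: "is_poisson_kernel M X m D x R" for A R
  proof -
    have [measurable]: "R \<in> borel_measurable borel" "A \<in> sets borel" "D \<in> sets borel" and R0: "\<And>u. 0 \<le> R u"
      using R A D by (auto simp: is_poisson_kernel_def)
    have int: "set_integrable lborel (A \<inter> - D) R" and eq: "exit_measure M X m D x (A \<inter> - D) = (LINT u:A \<inter> - D|lborel. R u)"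
      using R A D unfolding is_poisson_kernel_def by auto
    have "emeasure (density lborel (\<lambda>u. ennreal (indicator (- D) u * R u))) A = (\<integral>\<^sup>+u. ennreal (indicator (A \<inter> - D) u *\<^sub>R R u) \<partial>lborel)"
      by (subst emeasure_density) (auto intro!: nn_integral_cong split: split_indicator)
    also have "\<dots> = ennreal (LINT u|lborel. indicator (A \<inter> - D) u *\<^sub>R R u)"
      by (rule nn_integral_eq_integral) (use int R0 in \<open>auto simp: set_integrable_def\<close>)
    finally show ?thesis unfolding eq set_lebesgue_integral_def .
  qed
  have [measurable]: "P \<in> borel_measurable borel" "Q \<in> borel_measurable borel" "D \<in> sets borel" and nn: "\<And>u. 0 \<le> P u" "\<And>u. 0 \<le> Q u"
    using P Q D by (auto simp: is_poisson_kernel_def)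
  have "density lborel (\<lambda>u. ennreal (indicator (- D) u * Q u)) = density lborel (\<lambda>u. ennreal (indicator (- D) u * P u))"
    by (rule measure_eqI) (auto simp: dens[OF _ P] dens[OF _ Q])
  hence "AE u in lborel. ennreal (indicator (- D) u * Q u) = ennreal (indicator (- D) u * P u)"
    by (intro sigma_finite_measure.density_unique[OF sigma_finite_lborel]) auto
  thus ?thesis
    by eventually_elim (use nn in \<open>auto split: split_indicator_asm simp: ennreal_inj\<close>)
qed

theorem theorem4p2:
  fixes \<alpha> m :: real
    and M :: "'w measure"
    and X :: "real \<Rightarrow> 'w \<Rightarrow> real ^ ('n :: {finite, linorder})"
    and x :: "real ^ ('n :: {finite, linorder})"
  assumes "0 < \<alpha>" and "\<alpha> < 2" and "0 < m"
    and "relativistic_stable_process \<alpha> m M X"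
    and "x \<in> half_space"
  shows "\<exists>P. is_poisson_kernel M X m half_space x P \<and>
    (\<forall>Q. is_poisson_kernel M X m half_space x Q \<longrightarrow>
       (AE u in lborel. u \<notin> half_space \<longrightarrow> Q u = P u)) \<and>
    (\<forall>u. last_coord u < 0 \<longrightarrow>
       P u = 2 * (sin (pi * \<alpha> / 2) / pi)
           * (m powr (1 / \<alpha>) / (2 * pi)) powr (real CARD('n) / 2)
           * (last_coord x / (- last_coord u)) powr (\<alpha> / 2)
           * (bessel_K (real CARD('n) / 2) (m powr (1 / \<alpha>) * norm (x - u))
              / norm (x - u) powr (real CARD('n) / 2)))"
proof -
  \<comment> \<open>The normal direction and the parameters in the form used above;
    \<open>c\<^sup>2\<close> equals \<open>m powr (2 / \<alpha>)\<close>, which matches the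
    characteristic exponent.\<close>
  define l :: "(real, 'n) vec" where "l = axis (Max UNIV) 1"
  define b where "b = \<alpha> / 2"
  define c where "c = m powr (1 / \<alpha>)"
  have lB: "l \<in> Basis" by (simp add: l_def axis_in_Basis_iff)
  have last: "last_coord u = u \<bullet> l" for u :: "(real, 'n) vec" by (simp add: last_coord_def l_def inner_axis)
  have half: "half_space = {u :: (real, 'n) vec. u \<bullet> l > 0}" by (simp add: half_space_def last)
  have half_borel: "(half_space :: ((real, 'n) vec) set) \<in> sets borel" unfolding half by measurable
  have c: "c > 0" using assms(3) by (simp add: c_def)
  have b: "0 < b" "b < 1" using assms(1,2) by (auto simp: b_def)
  have x: "x \<bullet> l > 0" using assms(5) by (simp add: half)
  have X_levy: "levy_process M X" using assms(4) by (simp add: relativistic_stable_process_def)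
  obtain Z where "regular_levy M Z" and XZ: "AE \<omega> in M. \<forall>t\<ge>0. X t \<omega> = Z t \<omega>"
    by (rule levy_process_regular_version[OF X_levy])
  then interpret regular_levy M Z by simp
  interpret relativistic_regular M Z m b c l
  proof
    show "norm l = 1" using lB by simp
    fix t :: real and z :: "(real, 'n) vec" assume t: "t \<ge> 0"
    have [measurable]: "X t \<in> borel_measurable M" using X_levy t by (simp add: levy_process_def)
    have "(LINT \<omega>|M. iexp (z \<bullet> Z t \<omega>)) = (LINT \<omega>|M. iexp (z \<bullet> X t \<omega>))"
      by (rule integral_cong_AE) (use XZ t in \<open>auto elim!: eventually_mono\<close>)
    also have "\<dots> = complex_of_real (exp (m * t) * exp (- t * ((norm z)\<^sup>2 + m powr (2 / \<alpha>)) powr (\<alpha> / 2)))"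
      using assms(4) t unfolding relativistic_stable_process_def by blast
    also have "m powr (2 / \<alpha>) = c\<^sup>2"
      using assms(3) by (simp add: c_def powr_powr flip: powr_numeral)
    finally show "(LINT \<omega>|M. iexp (z \<bullet> Z t \<omega>)) = complex_of_real (exp (m * t) * exp (- t * ((norm z)\<^sup>2 + c\<^sup>2) powr b))"
      by (simp add: b_def)
  qed (use assms(3) c b in auto)
  let ?P = "half_space_kernel b c l x"
  have P: "is_poisson_kernel M X m half_space x ?P"
    unfolding is_poisson_kernel_def
  proof (intro conjI allI ballI impI)
    show "0 \<le> ?P u" for u by (rule kernel_nonneg[OF b c x])
    fix A :: "((real, 'n) vec) set" assume A: "A \<in> sets borel"
    show "set_integrable lborel A ?P"
      unfolding set_integrable_def using integrable_kernel[OF b c lB x] A by (intro integrable_mult_indicator) auto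
    show "exit_measure M X m half_space x A = (LINT u:A|lborel. ?P u)"
      unfolding half exit_measure_eq[OF lB x XZ A] set_lebesgue_integral_def by (simp add: mult.commute)
  qed measurable
  show ?thesis
  proof (intro exI[of _ ?P] conjI allI impI P)
    show "AE u in lborel. u \<notin> half_space \<longrightarrow> Q u = ?P u" if "is_poisson_kernel M X m half_space x Q" for Q
      by (rule poisson_kernel_unique[OF half_borel P that])
    show "?P u = 2 * (sin (pi * \<alpha> / 2) / pi)
           * (m powr (1 / \<alpha>) / (2 * pi)) powr (real CARD('n) / 2)
           * (last_coord x / (- last_coord u)) powr (\<alpha> / 2)
           * (bessel_K (real CARD('n) / 2) (m powr (1 / \<alpha>) * norm (x - u))
              / norm (x - u) powr (real CARD('n) / 2))" if "last_coord u < 0" for u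
      using half_space_kernel_eq[OF c x, of u b] that by (simp add: last b_def c_def)
  qed
qed

end
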